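(* The equivalence group $G^\sim_{\bar{\mathcal K}}$ of the class $\bar{\mathcal K}$ of Kolmogorov equations $u_t=A(t,x)u_{xx}+B(t,x)u_x$ with $A\ne0$ is constituted by the point transformations of the form \[ \tilde t=T(t),\quad\tilde x=X(t,x),\quad\tilde u=U^1u+U^0,\quad\tilde A=\frac{X_x^2}{T_t}A,\quad\tilde B=\frac{X_x}{T_t}B-\frac{X_t-X_{xx}A}{T_t}, \] where $T$ and $X$ run through the set of smooth functions of their arguments with $T_tX_x\neq0$, and $U^0$ and $U^1$ are arbitrary constants with $U^1\ne0$.
   Context: Everything is real, smooth and local; $f\neq0$ for a function means that it vanishes nowhere on its domain. The arbitrary elements of the class are the smooth functions $A$ and $B$ of $(t,x)$ with $A\neq0$; in working with equivalence transformations they are regarded as coordinates. The (usual) equivalence (pseudo)group of the class consists of the point transformations (local diffeomorphisms) in the space with coordinates $(t,x,u_{(2)},A,B)$, where $u_{(2)}$ denotes $u$ and its derivatives up to order two, that are projectable to the spaces of $(t,x,u)$ and of $(t,x,u_{(2)})$, are consistent with the contact structure of the second-order jet space (so their components for derivatives are obtained by standard prolongation and are not listed), and map every equation of the class to an equation of the class (with the transformed arbitrary elements) for any values of the arbitrary elements. *)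

theory Defs
  imports "HOL-Analysis.Analysis"
begin

text \<open>The predicates on smoothness are meant for open \<open>S\<close>: derivatives are taken at points, not within \<open>S\<close>.\<close>

primrec C_k_on :: "nat \<Rightarrow> 'a::euclidean_space set \<Rightarrow> ('a \<Rightarrow> 'b::euclidean_space) \<Rightarrow> bool" where
  "C_k_on 0 S f \<longleftrightarrow> continuous_on S f"
| "C_k_on (Suc k) S f \<longleftrightarrow>
     (\<forall>x\<in>S. f differentiable (at x)) \<and> (\<forall>v. C_k_on k S (\<lambda>x. frechet_derivative f (at x) v))"

definition smooth_on :: "'a::euclidean_space set \<Rightarrow> ('a \<Rightarrow> 'b::euclidean_space) \<Rightarrow> bool" where
  "smooth_on S f \<longleftrightarrow> (\<forall>k. C_k_on k S f)"

definition local_diffeomorphism_on :: "'a::euclidean_space set \<Rightarrow> ('a \<Rightarrow> 'a) \<Rightarrow> bool" where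
  "local_diffeomorphism_on S f \<longleftrightarrow>
     (\<forall>z\<in>S. \<exists>V V' g. open V \<and> z \<in> V \<and> V \<subseteq> S \<and> open V' \<and>
        homeomorphism V V' f g \<and> smooth_on V f \<and> smooth_on V' g)"

text \<open>
  A jet is \<open>((t, x, u), (u_t, u_x), (u_tt, u_tx, u_xx))\<close>; a point of the extended space is
  \<open>(jet, (A, B))\<close>, where the arbitrary elements serve as coordinates.
\<close>

type_synonym base = "real \<times> real \<times> real"
type_synonym jet = "base \<times> (real \<times> real) \<times> (real \<times> real \<times> real)"
type_synonym ext = "jet \<times> (real \<times> real)"

definition jet_of :: "ext \<Rightarrow> jet" where
  "jet_of z = fst z"

definition base_of :: "ext \<Rightarrow> base" where
  "base_of z = fst (jet_of z)"

definition elements_of :: "ext \<Rightarrow> real \<times> real" where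
  "elements_of z = snd z"

definition indep :: "jet \<Rightarrow> real \<times> real" where
  "indep j = (fst (fst j), fst (snd (fst j)))"

text \<open>
  The contact (Cartan) distribution of the second-order jet space: the common kernel at the given
  jet of the contact forms \<open>du - u_t dt - u_x dx\<close>, \<open>du_t - u_tt dt - u_tx dx\<close> and
  \<open>du_x - u_tx dt - u_xx dx\<close>.
\<close>

fun contact_plane :: "jet \<Rightarrow> jet set" where
  "contact_plane ((t, x, u), (ut, ux), (utt, utx, uxx)) =
     {((dt, dx, du), (dut, dux), (dutt, dutx, duxx)) | dt dx du dut dux dutt dutx duxx.
        du = ut * dt + ux * dx \<and> dut = utt * dt + utx * dx \<and> dux = utx * dt + uxx * dx}"

definition preserves_contact_on :: "jet set \<Rightarrow> (jet \<Rightarrow> jet) \<Rightarrow> bool" where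
  "preserves_contact_on S \<psi> \<longleftrightarrow>
     (\<forall>j\<in>S. \<exists>D. (\<psi> has_derivative D) (at j) \<and> D ` contact_plane j \<subseteq> contact_plane (\<psi> j))"

fun kolmogorov :: "real \<times> real \<Rightarrow> jet \<Rightarrow> bool" where
  "kolmogorov (a, b) ((t, x, u), (ut, ux), (utt, utx, uxx)) \<longleftrightarrow> ut = a * uxx + b * ux"

text \<open>
  \<open>\<theta> = (A, B)\<close> as a function of \<open>(t, x)\<close>, on an open set \<open>W\<close>.  The corresponding equation is the set
  of jets \<open>j\<close> over \<open>W\<close> with \<open>kolmogorov (\<theta> (indep j)) j\<close>.
\<close>

definition arbitrary_elements_on :: "(real \<times> real) set \<Rightarrow> (real \<times> real \<Rightarrow> real \<times> real) \<Rightarrow> bool" where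
  "arbitrary_elements_on W \<theta> \<longleftrightarrow> open W \<and> smooth_on W \<theta> \<and> (\<forall>p\<in>W. fst (\<theta> p) \<noteq> 0)"

definition lift :: "(real \<times> real \<Rightarrow> real \<times> real) \<Rightarrow> jet \<Rightarrow> ext" where
  "lift \<theta> j = (j, \<theta> (indep j))"

text \<open>
  Domains of transformations are open subsets of the part \<open>A \<noteq> 0\<close> of the extended space.  They may be
  arbitrarily small, but have to contain points at which the equations of the class are satisfied:
  over every \<open>(t, x, u, A, B)\<close>, each connected component of the set of values of the derivatives
  meets the hypersurface \<open>u_t = A u_xx + B u_x\<close>.  On pieces of a domain that miss this
  hypersurface, mapping equations to equations would be a vacuous requirement.
\<close>

definition admissible_domain :: "ext set \<Rightarrow> bool" where
  "admissible_domain \<Omega> \<longleftrightarrow>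
     open \<Omega> \<and> (\<forall>z\<in>\<Omega>. fst (elements_of z) \<noteq> 0) \<and>
     (\<forall>j \<theta>. (j, \<theta>) \<in> \<Omega> \<longrightarrow>
        (\<exists>j'. kolmogorov \<theta> j' \<and> connected_component {i. fst i = fst j \<and> (i, \<theta>) \<in> \<Omega>} j j'))"

definition point_transformation :: "ext set \<Rightarrow> (ext \<Rightarrow> ext) \<Rightarrow> bool" where
  "point_transformation \<Omega> \<Phi> \<longleftrightarrow>
     admissible_domain \<Omega> \<and> local_diffeomorphism_on \<Omega> \<Phi> \<and>
     (\<exists>\<phi>. \<forall>z\<in>\<Omega>. base_of (\<Phi> z) = \<phi> (base_of z)) \<and>
     (\<exists>\<psi>. (\<forall>z\<in>\<Omega>. jet_of (\<Phi> z) = \<psi> (jet_of z)) \<and> preserves_contact_on (jet_of ` \<Omega>) \<psi>)"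

text \<open>
  Locally near every jet \<open>j\<close>, the transformation maps the equation with arbitrary elements \<open>\<theta>\<close> to the
  equation with arbitrary elements \<open>\<theta>'\<close>.  The transformed arbitrary elements are given by the
  components of \<open>\<Phi>\<close> for \<open>A\<close> and \<open>B\<close> at all jets near \<open>j\<close>, also at those not satisfying
  the equation, and they have to be functions of the new \<open>t\<close> and \<open>x\<close> alone.
\<close>

definition maps_equations_to_equations :: "ext set \<Rightarrow> (ext \<Rightarrow> ext) \<Rightarrow> bool" where
  "maps_equations_to_equations \<Omega> \<Phi> \<longleftrightarrow>
     (\<forall>W \<theta>. arbitrary_elements_on W \<theta> \<longrightarrow>
       (\<forall>j. indep j \<in> W \<and> lift \<theta> j \<in> \<Omega> \<longrightarrow>
         (\<exists>V W' \<theta>'. open V \<and> j \<in> V \<and> arbitrary_elements_on W' \<theta>' \<and>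
           (\<forall>i\<in>V. indep i \<in> W \<and> lift \<theta> i \<in> \<Omega> \<and>
              (let i' = jet_of (\<Phi> (lift \<theta> i)) in
                 indep i' \<in> W' \<and> \<Phi> (lift \<theta> i) = lift \<theta>' i' \<and>
                 (kolmogorov (\<theta> (indep i)) i \<longleftrightarrow> kolmogorov (\<theta>' (indep i')) i'))))))"

text \<open>
  Membership of a transformation \<open>\<Phi>\<close> with domain \<open>\<Omega>\<close> in the equivalence pseudogroup.  The values of
  \<open>\<Phi>\<close> outside \<open>\<Omega>\<close> are irrelevant.
\<close>

definition in_equivalence_group :: "ext set \<Rightarrow> (ext \<Rightarrow> ext) \<Rightarrow> bool" where
  "in_equivalence_group \<Omega> \<Phi> \<longleftrightarrow> point_transformation \<Omega> \<Phi> \<and> maps_equations_to_equations \<Omega> \<Phi>"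

definition partial_t :: "(real \<times> real \<Rightarrow> real) \<Rightarrow> real \<times> real \<Rightarrow> real" where
  "partial_t F = (\<lambda>(t, x). deriv (\<lambda>s. F (s, x)) t)"

definition partial_x :: "(real \<times> real \<Rightarrow> real) \<Rightarrow> real \<times> real \<Rightarrow> real" where
  "partial_x F = (\<lambda>(t, x). deriv (\<lambda>y. F (t, y)) x)"

definition admissible_parameters ::
    "(real \<times> real) set \<Rightarrow> (real \<Rightarrow> real) \<Rightarrow> (real \<times> real \<Rightarrow> real) \<Rightarrow> real \<Rightarrow> bool" where
  "admissible_parameters W T X U1 \<longleftrightarrow>
     smooth_on (fst ` W) T \<and> smooth_on W X \<and>
     (\<forall>(t, x)\<in>W. deriv T t * partial_x X (t, x) \<noteq> 0) \<and> U1 \<noteq> 0"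

definition has_form_on ::
    "ext set \<Rightarrow> (ext \<Rightarrow> ext) \<Rightarrow> (real \<Rightarrow> real) \<Rightarrow> (real \<times> real \<Rightarrow> real) \<Rightarrow> real \<Rightarrow> real \<Rightarrow> bool" where
  "has_form_on Q \<Phi> T X U1 U0 \<longleftrightarrow>
     (\<forall>t x u p q a b. (((t, x, u), p, q), (a, b)) \<in> Q \<longrightarrow>
        (let z' = \<Phi> (((t, x, u), p, q), (a, b));
             Tt = deriv T t;
             Xt = partial_t X (t, x);
             Xx = partial_x X (t, x);
             Xxx = partial_x (partial_x X) (t, x)
         in base_of z' = (T t, X (t, x), U1 * u + U0) \<and>
            elements_of z' = (Xx\<^sup>2 / Tt * a, Xx / Tt * b - (Xt - Xxx * a) / Tt)))"

end

theory Submission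
  imports Defs
begin

text \<open>
  Taking constant arbitrary elements shows that the new \<open>(A, B)\<close> are locally constant along the
  derivative coordinates, so over each \<open>(t, x, u, A, B)\<close> one may work at a jet satisfying the
  equation.  The contact condition expresses the new derivatives through \<open>T\<close>, \<open>X\<close>, \<open>U\<close>.
  Moving along the equation in the jet, first in \<open>u_tt\<close>, then in \<open>(u_t, u_xx)\<close> and in
  \<open>(u_t, u_x)\<close>, and finally in \<open>B\<close>, gives successively \<open>T_x = T_u = 0\<close>, the formula for \<open>A\<close> with
  \<open>X_u = 0\<close>, a quadratic polynomial in \<open>u_x\<close> that vanishes identically, and \<open>U_x = 0\<close>; its coefficients
  yield \<open>U_t = U_uu = 0\<close> and the formula for \<open>B\<close>.  Convexity of the base makes \<open>T\<close>, \<open>X\<close> and the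
  constants single-valued.  Conversely, the new arbitrary elements are obtained by composing the
  formulas with a local inverse of \<open>(T, X)\<close>.
\<close>

subsection \<open>Calculus of smooth maps\<close>

text \<open>The two implications meet in a pointwise normal form: \<open>affine_fibres\<close> and
  \<open>transforms_elements\<close> are conditions on derivatives of the base components at single
  points. They make sense on every domain, whereas the functions and constants of the theorem are
  obtained over convex bases only and may change from piece to piece. The components for derivatives
  are known only through the contact relations. Second-order components enter by value and are never
  differentiated, and every formula for them is multiplied out by a nonvanishing factor. With the
  elements fixed, \<open>U_x = 0\<close> cannot be read off, because the new \<open>B\<close> is
  still unknown. It enters two coefficients of the polynomial in \<open>u_x\<close> through the same
  quantity \<open>M\<close>. When \<open>B\<close> is raised, the coefficient of \<open>u_x\<close>
  forces \<open>M\<close> to change, while the coefficient free of \<open>u_x\<close> involves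
  \<open>M\<close> only in the product \<open>M * U_x\<close>; hence \<open>U_x = 0\<close>. In the
  converse the equations correspond because the new equation, multiplied by \<open>T_t\<close>, is
  \<open>U_u\<close> times the old one.\<close>

lemma C_k_on_subset: "C_k_on k S f \<Longrightarrow> T \<subseteq> S \<Longrightarrow> C_k_on k T f"
  by (induction k arbitrary: f) (auto intro: continuous_on_subset)

lemma C_k_on_derivative:
  assumes "C_k_on (Suc k) S f" "x \<in> S"
  shows "(f has_derivative frechet_derivative f (at x)) (at x)"
  using assms by (auto simp: frechet_derivative_works)

lemma C_k_on_cong:
  assumes "open S" "\<And>x. x \<in> S \<Longrightarrow> f x = g x" "C_k_on k S f"
  shows "C_k_on k S g"
  using assms(2,3)
proof (induction k arbitrary: f g)
  case 0
  then show ?case by (simp cong: continuous_on_cong)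
next
  case (Suc k)
  have hd: "(g has_derivative frechet_derivative f (at x)) (at x)" if "x \<in> S" for x
    using C_k_on_derivative[OF Suc.prems(2) that] \<open>open S\<close> that Suc.prems(1)
    by (rule has_derivative_transform_within_open)
  then have "frechet_derivative f (at x) = frechet_derivative g (at x)" if "x \<in> S" for x
    using that frechet_derivative_at by blast
  then have "C_k_on k S (\<lambda>x. frechet_derivative g (at x) v)" for v
    using Suc.prems(2) Suc.IH[of "\<lambda>x. frechet_derivative f (at x) v"] by simp
  then show ?case using hd by (auto intro: differentiableI)
qed

text \<open>\<open>C_k_on\<close> is phrased through \<open>frechet_derivative\<close>, which is a
  choice. Uniqueness of derivatives lets an explicit formula \<open>f'\<close> take its place, so
  that the closure properties below become inductions on \<open>k\<close>.\<close>

lemma C_k_on_SucI: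
  assumes "open S" "\<And>x. x \<in> S \<Longrightarrow> (f has_derivative f' x) (at x)"
    "\<And>v. C_k_on k S (\<lambda>x. f' x v)"
  shows "C_k_on (Suc k) S f"
proof -
  have "C_k_on k S (\<lambda>x. frechet_derivative f (at x) v)" for v
    using assms(2) frechet_derivative_at[symmetric]
    by (intro C_k_on_cong[OF \<open>open S\<close> _ assms(3)]) fastforce
  then show ?thesis using assms(2) by (auto intro: differentiableI)
qed

lemma C_k_on_continuous: "C_k_on k S f \<Longrightarrow> continuous_on S f"
  by (cases k) (auto intro!: differentiable_imp_continuous_on simp: differentiable_on_def
      differentiable_at_withinI)

lemma C_k_on_less: "C_k_on (Suc k) S f \<Longrightarrow> C_k_on k S f"
proof (induction k arbitrary: f)
  case 0
  then show ?case using C_k_on_continuous[OF 0] by simp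
qed auto

lemma C_k_on_const: "open S \<Longrightarrow> C_k_on k S (\<lambda>_. c)"
  by (induction k arbitrary: c) (auto simp: frechet_derivative_const)

lemma C_k_on_linear:
  assumes "open S" "bounded_linear f" shows "C_k_on k S f"
proof (cases k)
  case 0
  then show ?thesis using assms by (simp add: linear_continuous_on)
next
  case (Suc l)
  have "C_k_on (Suc l) S f"
    by (rule C_k_on_SucI[where f' = "\<lambda>_. f"])
      (auto simp: assms bounded_linear_imp_has_derivative C_k_on_const)
  then show ?thesis using Suc by simp
qed

lemma C_k_on_add:
  assumes "open S" "C_k_on k S f" "C_k_on k S g" shows "C_k_on k S (\<lambda>x. f x + g x)"
  using assms(2,3)
proof (induction k arbitrary: f g)
  case 0
  then show ?case by (auto intro: continuous_intros)
next
  case (Suc k)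
  show ?case
    by (rule C_k_on_SucI[OF \<open>open S\<close> has_derivative_add[OF C_k_on_derivative C_k_on_derivative]])
      (use Suc in auto)
qed

lemma C_k_on_linear_compose:
  assumes "open S" "bounded_linear h" "C_k_on k S f" shows "C_k_on k S (\<lambda>x. h (f x))"
  using assms(3)
proof (induction k arbitrary: f)
  case 0
  then show ?case using assms(2)
    by (auto intro: continuous_on_compose2[OF linear_continuous_on])
next
  case (Suc k)
  show ?case
    by (rule C_k_on_SucI[OF \<open>open S\<close> bounded_linear.has_derivative[OF assms(2) C_k_on_derivative]])
      (use Suc in auto)
qed

text \<open>The product rule contains \<open>f\<close> and \<open>g\<close> undifferentiated; these
  enter the induction hypothesis after one order of smoothness has been dropped.\<close>

lemma C_k_on_bilinear:
  assumes "open S" "bounded_bilinear B" "C_k_on k S f" "C_k_on k S g"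
  shows "C_k_on k S (\<lambda>x. B (f x) (g x))"
  using assms(3,4)
proof (induction k arbitrary: f g)
  case 0
  then show ?case by (auto intro: bounded_bilinear.continuous_on[OF assms(2)])
next
  case (Suc k)
  show ?case
    by (rule C_k_on_SucI[OF \<open>open S\<close> bounded_bilinear.FDERIV[OF assms(2) C_k_on_derivative C_k_on_derivative]])
      (use Suc.prems Suc.prems[THEN C_k_on_less] in \<open>auto intro!: C_k_on_add[OF \<open>open S\<close>] Suc.IH\<close>)
qed

lemma C_k_on_sum:
  assumes "open S" "finite I" "\<And>i. i \<in> I \<Longrightarrow> C_k_on k S (f i)"
  shows "C_k_on k S (\<lambda>x. \<Sum>i\<in>I. f i x)"
  using assms(2,3)
  by (induction I rule: finite_induct) (auto intro: C_k_on_const C_k_on_add assms(1))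

lemma C_k_on_compose:
  assumes "open S" "open T" "C_k_on k S f" "C_k_on k T g" "f ` S \<subseteq> T"
  shows "C_k_on k S (\<lambda>x. g (f x))"
  using assms(3,4)
proof (induction k arbitrary: g)
  case 0
  then show ?case using assms(5) by (auto intro: continuous_on_compose2)
next
  case (Suc k)
  show ?case
  proof (rule C_k_on_SucI[OF \<open>open S\<close>])
    fix x assume "x \<in> S"
    then have "f x \<in> T" using assms(5) by auto
    have lin: "linear (frechet_derivative g (at (f x)))"
      using C_k_on_derivative[OF Suc.prems(2) \<open>f x \<in> T\<close>] has_derivative_linear by blast
    \<comment> \<open>In the chain rule the direction moves with the point, while
      \<open>C_k_on\<close> controls derivatives of \<open>g\<close> in fixed directions only.
      Expansion in the basis leaves scalar functions times derivatives of \<open>g\<close> along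
      fixed vectors.\<close>
    have "frechet_derivative g (at (f x)) v =
        (\<Sum>b\<in>Basis. (v \<bullet> b) *\<^sub>R frechet_derivative g (at (f x)) b)" for v
    proof -
      have "frechet_derivative g (at (f x)) (\<Sum>b\<in>Basis. (v \<bullet> b) *\<^sub>R b) =
          (\<Sum>b\<in>Basis. (v \<bullet> b) *\<^sub>R frechet_derivative g (at (f x)) b)"
        using lin by (simp add: linear_sum linear_cmul)
      then show ?thesis by (simp add: euclidean_representation)
    qed
    then have "(\<lambda>v. frechet_derivative g (at (f x)) (frechet_derivative f (at x) v)) =
        (\<lambda>v. \<Sum>b\<in>Basis. (frechet_derivative f (at x) v \<bullet> b) *\<^sub>R
          frechet_derivative g (at (f x)) b)" by (rule ext)
    moreover have "((\<lambda>x. g (f x)) has_derivative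
        (\<lambda>v. frechet_derivative g (at (f x)) (frechet_derivative f (at x) v))) (at x)"
      using diff_chain_at[OF C_k_on_derivative[OF Suc.prems(1) \<open>x \<in> S\<close>]
          C_k_on_derivative[OF Suc.prems(2) \<open>f x \<in> T\<close>]] by (simp add: o_def)
    ultimately show "((\<lambda>x. g (f x)) has_derivative
        (\<lambda>v. \<Sum>b\<in>Basis. (frechet_derivative f (at x) v \<bullet> b) *\<^sub>R
          frechet_derivative g (at (f x)) b)) (at x)"
      by (rule has_derivative_eq_rhs[rotated])
  next
    fix v
    have "C_k_on k S f" using Suc.prems(1) by (rule C_k_on_less)
    moreover have "C_k_on k T (\<lambda>x. frechet_derivative g (at x) b)" for b using Suc.prems(2) by auto
    ultimately have "C_k_on k S (\<lambda>x. frechet_derivative g (at (f x)) b)" for b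
      using Suc.IH[of "\<lambda>y. frechet_derivative g (at y) b"] by auto
    moreover have "C_k_on k S (\<lambda>x. frechet_derivative f (at x) v \<bullet> b)" for b
      using Suc.prems(1)
      by (intro C_k_on_linear_compose[OF \<open>open S\<close> bounded_linear_inner_left]) auto
    ultimately show "C_k_on k S (\<lambda>x. \<Sum>b\<in>Basis. (frechet_derivative f (at x) v \<bullet> b) *\<^sub>R
          frechet_derivative g (at (f x)) b)"
      by (intro C_k_on_sum C_k_on_bilinear[OF _ bounded_bilinear_scaleR] assms(1)) auto
  qed
qed

lemma C_k_on_inverse: "C_k_on k {x::real. x \<noteq> 0} inverse"
proof (induction k)
  case 0
  show ?case by (auto intro!: continuous_intros)
next
  case (Suc k)
  have o: "open {x::real. x \<noteq> 0}" by (simp add: open_Collect_neq)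
  show ?case
  proof (rule C_k_on_SucI[OF o])
    show "C_k_on k {x::real. x \<noteq> 0} (\<lambda>x. - (inverse x * v * inverse x))" for v
      by (intro C_k_on_linear_compose[OF o bounded_linear_minus[OF bounded_linear_ident]]
          C_k_on_bilinear[OF o bounded_bilinear_mult] C_k_on_const o Suc)
  qed (auto intro!: has_derivative_inverse' has_derivative_ident)
qed

lemma C_k_on_Pair:
  assumes "open S" "C_k_on k S f" "C_k_on k S g" shows "C_k_on k S (\<lambda>x. (f x, g x))"
  using assms(2,3)
proof (induction k arbitrary: f g)
  case 0
  then show ?case by (auto intro: continuous_intros)
next
  case (Suc k)
  show ?case
    by (rule C_k_on_SucI[OF \<open>open S\<close> has_derivative_Pair[OF C_k_on_derivative C_k_on_derivative]])
      (use Suc in auto)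
qed

section \<open>Smoothness of all orders: locality and closure rules\<close>

lemma smooth_on_subset: "smooth_on S f \<Longrightarrow> T \<subseteq> S \<Longrightarrow> smooth_on T f"
  unfolding smooth_on_def using C_k_on_subset by blast

lemma smooth_on_cong: "smooth_on S f \<Longrightarrow> open S \<Longrightarrow> (\<And>x. x \<in> S \<Longrightarrow> f x = g x) \<Longrightarrow> smooth_on S g"
  unfolding smooth_on_def using C_k_on_cong[of S f g] by simp

lemma C_k_on_local:
  assumes "\<And>x. x \<in> S \<Longrightarrow> \<exists>V. open V \<and> x \<in> V \<and> C_k_on k V f"
  shows "C_k_on k S f"
  using assms
proof (induction k arbitrary: f)
  case 0
  have "continuous (at x) f" if "x \<in> S" for x
    using 0[OF that] continuous_on_eq_continuous_at by auto
  then show ?case by (simp add: continuous_at_imp_continuous_on)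
next
  case (Suc k)
  have "f differentiable (at x)" if "x \<in> S" for x
    using Suc.prems[OF that] by auto
  moreover have "C_k_on k S (\<lambda>x. frechet_derivative f (at x) v)" for v
  proof (rule Suc.IH)
    fix x assume "x \<in> S"
    then obtain V where "open V" "x \<in> V" "C_k_on (Suc k) V f" using Suc.prems by blast
    then show "\<exists>V. open V \<and> x \<in> V \<and> C_k_on k V (\<lambda>x. frechet_derivative f (at x) v)"
      by (intro exI[of _ V]) simp
  qed
  ultimately show ?case by simp
qed

lemma smooth_on_local:
  assumes "\<And>x. x \<in> S \<Longrightarrow> \<exists>V. open V \<and> x \<in> V \<and> smooth_on V f"
  shows "smooth_on S f"
  unfolding smooth_on_def
proof
  fix k
  show "C_k_on k S f"
    by (rule C_k_on_local) (metis assms smooth_on_def)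
qed

lemma smooth_on_has_derivative:
  "smooth_on S f \<Longrightarrow> x \<in> S \<Longrightarrow> (f has_derivative frechet_derivative f (at x)) (at x)"
  unfolding smooth_on_def using C_k_on_derivative by blast

lemma smooth_on_frechet_derivative:
  "smooth_on S f \<Longrightarrow> smooth_on S (\<lambda>x. frechet_derivative f (at x) v)"
  unfolding smooth_on_def using C_k_on.simps(2) by blast

lemma smooth_on_continuous: "smooth_on S f \<Longrightarrow> continuous_on S f"
  unfolding smooth_on_def using C_k_on_continuous by blast

lemma smooth_on_const [simp]: "open S \<Longrightarrow> smooth_on S (\<lambda>_. c)"
  by (simp add: smooth_on_def C_k_on_const)

lemma smooth_on_linear: "open S \<Longrightarrow> bounded_linear f \<Longrightarrow> smooth_on S f"
  by (simp add: smooth_on_def C_k_on_linear)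

lemma smooth_on_add:
  "open S \<Longrightarrow> smooth_on S f \<Longrightarrow> smooth_on S g \<Longrightarrow> smooth_on S (\<lambda>x. f x + g x)"
  by (simp add: smooth_on_def C_k_on_add)

lemma smooth_on_linear_compose:
  "open S \<Longrightarrow> bounded_linear h \<Longrightarrow> smooth_on S f \<Longrightarrow> smooth_on S (\<lambda>x. h (f x))"
  by (simp add: smooth_on_def C_k_on_linear_compose)

lemma smooth_on_diff:
  "open S \<Longrightarrow> smooth_on S f \<Longrightarrow> smooth_on S g \<Longrightarrow> smooth_on S (\<lambda>x. f x - g x)"
  using smooth_on_add[of S f "\<lambda>x. - g x"]
    smooth_on_linear_compose[OF _ bounded_linear_minus[OF bounded_linear_ident], of S g]
  by simp

lemma smooth_on_mult:
  fixes f g :: "'a::euclidean_space \<Rightarrow> real"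
  shows "open S \<Longrightarrow> smooth_on S f \<Longrightarrow> smooth_on S g \<Longrightarrow> smooth_on S (\<lambda>x. f x * g x)"
  by (simp add: smooth_on_def C_k_on_bilinear[OF _ bounded_bilinear_mult])

lemma smooth_on_power:
  fixes f :: "'a::euclidean_space \<Rightarrow> real"
  shows "open S \<Longrightarrow> smooth_on S f \<Longrightarrow> smooth_on S (\<lambda>x. f x ^ n)"
  by (induction n) (auto intro: smooth_on_mult)

lemma smooth_on_compose:
  "open S \<Longrightarrow> open T \<Longrightarrow> smooth_on S f \<Longrightarrow> smooth_on T g \<Longrightarrow> f ` S \<subseteq> T \<Longrightarrow> smooth_on S (\<lambda>x. g (f x))"
  unfolding smooth_on_def using C_k_on_compose by blast

lemma smooth_on_divide:
  fixes f g :: "'a::euclidean_space \<Rightarrow> real"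
  assumes "open S" "smooth_on S f" "smooth_on S g" "\<And>x. x \<in> S \<Longrightarrow> g x \<noteq> 0"
  shows "smooth_on S (\<lambda>x. f x / g x)"
proof -
  have "smooth_on {x::real. x \<noteq> 0} inverse" by (simp add: smooth_on_def C_k_on_inverse)
  then have "smooth_on S (\<lambda>x. inverse (g x))"
    using assms by (intro smooth_on_compose[OF assms(1) _ assms(3)]) (auto simp: open_Collect_neq)
  from smooth_on_mult[OF assms(1,2) this] show ?thesis by (simp add: divide_inverse)
qed

lemma smooth_on_Pair:
  "open S \<Longrightarrow> smooth_on S f \<Longrightarrow> smooth_on S g \<Longrightarrow> smooth_on S (\<lambda>x. (f x, g x))"
  by (simp add: smooth_on_def C_k_on_Pair)

lemma smooth_on_fst: "open S \<Longrightarrow> smooth_on S f \<Longrightarrow> smooth_on S (\<lambda>x. fst (f x))"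
  and smooth_on_snd: "open S \<Longrightarrow> smooth_on S f \<Longrightarrow> smooth_on S (\<lambda>x. snd (f x))"
  by (auto intro: smooth_on_linear_compose bounded_linear_fst bounded_linear_snd)

lemma smooth_on_id: "open S \<Longrightarrow> smooth_on S (\<lambda>x. x)"
  by (auto intro: smooth_on_linear bounded_linear_ident)

lemmas smooth_intros = smooth_on_const smooth_on_add smooth_on_diff smooth_on_mult smooth_on_divide
  smooth_on_power smooth_on_Pair smooth_on_fst smooth_on_snd smooth_on_id

text \<open>
  Meant for local inverses, where \<open>G\<close> is the inverse of the derivative: a \<open>C_k\<close> solution of
  \<open>Dh = G \<circ> h\<close> is \<open>C_(k+1)\<close>.
\<close>

lemma smooth_on_bootstrap:
  assumes "open S" "open T" "h ` S \<subseteq> T" "\<And>v. smooth_on T (\<lambda>x. G x v)"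
    and "\<And>y. y \<in> S \<Longrightarrow> (h has_derivative G (h y)) (at y)"
  shows "smooth_on S h"
proof -
  have "C_k_on k S h" for k
  proof (induction k)
    case 0
    show ?case using assms(5)
      by (auto intro!: continuous_at_imp_continuous_on has_derivative_continuous)
  next
    case (Suc k)
    have "C_k_on k T (\<lambda>x. G x v)" for v using assms(4) unfolding smooth_on_def by blast
    then show ?case
      by (intro C_k_on_SucI[OF \<open>open S\<close> assms(5)] C_k_on_compose[OF \<open>open S\<close> \<open>open T\<close> Suc _ assms(3)])
  qed
  then show ?thesis by (simp add: smooth_on_def)
qed

section \<open>Symmetry of second derivatives\<close>

text \<open>The mean value theorem is applied twice: to the difference of \<open>f\<close> across
  \<open>h w\<close> as a function of the step along \<open>v\<close>, then to the derivative along
  \<open>v\<close> as a function of the step along \<open>w\<close>.\<close>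

lemma second_difference_mean_value:
  fixes f :: "'a::euclidean_space \<Rightarrow> real"
  assumes "0 < h" "smooth_on S f"
    and S: "\<And>s t. 0 \<le> s \<Longrightarrow> s \<le> h \<Longrightarrow> 0 \<le> t \<Longrightarrow> t \<le> h \<Longrightarrow> x + s *\<^sub>R v + t *\<^sub>R w \<in> S"
  shows "\<exists>s t. 0 \<le> s \<and> s \<le> h \<and> 0 \<le> t \<and> t \<le> h \<and>
    f (x + h *\<^sub>R v + h *\<^sub>R w) - f (x + h *\<^sub>R v) - f (x + h *\<^sub>R w) + f x =
    h * (h * frechet_derivative (\<lambda>y. frechet_derivative f (at y) v) (at (x + s *\<^sub>R v + t *\<^sub>R w)) w)"
proof -
  let ?fv = "\<lambda>y. frechet_derivative f (at y) v"
  have d1: "((\<lambda>s. f (x + s *\<^sub>R v + t *\<^sub>R w)) has_real_derivative ?fv (x + s *\<^sub>R v + t *\<^sub>R w)) (at s)"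
    if "0 \<le> s" "s \<le> h" "0 \<le> t" "t \<le> h" for s t
  proof -
    have f: "(f has_derivative frechet_derivative f (at (x + s *\<^sub>R v + t *\<^sub>R w)))
        (at (x + s *\<^sub>R v + t *\<^sub>R w))"
      using smooth_on_has_derivative assms(2) S that by blast
    then have lin: "linear (frechet_derivative f (at (x + s *\<^sub>R v + t *\<^sub>R w)))"
      by (rule has_derivative_linear)
    have "((\<lambda>s. x + s *\<^sub>R v + t *\<^sub>R w) has_derivative (\<lambda>r. r *\<^sub>R v)) (at s)"
      by (auto intro!: derivative_eq_intros)
    from diff_chain_at[OF this f] show ?thesis
      by (simp add: o_def has_field_derivative_def linear_cmul[OF lin] mult_commute_abs)
  qed
  have d2: "((\<lambda>t. ?fv (x + s *\<^sub>R v + t *\<^sub>R w)) has_real_derivative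
      frechet_derivative ?fv (at (x + s *\<^sub>R v + t *\<^sub>R w)) w) (at t)"
    if "0 \<le> s" "s \<le> h" "0 \<le> t" "t \<le> h" for s t
  proof -
    let ?D = "frechet_derivative ?fv (at (x + s *\<^sub>R v + t *\<^sub>R w))"
    have f: "(?fv has_derivative ?D) (at (x + s *\<^sub>R v + t *\<^sub>R w))"
      using smooth_on_has_derivative[OF smooth_on_frechet_derivative] assms(2) S that by blast
    then have lin: "linear ?D" by (rule has_derivative_linear)
    have "((\<lambda>t. x + s *\<^sub>R v + t *\<^sub>R w) has_derivative (\<lambda>r. r *\<^sub>R w)) (at t)"
      by (auto intro!: derivative_eq_intros)
    from diff_chain_at[OF this f] show ?thesis
      by (simp add: o_def has_field_derivative_def linear_cmul[OF lin] mult_commute_abs)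
  qed
  have "\<exists>s. 0 < s \<and> s < h \<and> (f (x + h *\<^sub>R v + h *\<^sub>R w) - f (x + h *\<^sub>R v + 0 *\<^sub>R w)) -
      (f (x + 0 *\<^sub>R v + h *\<^sub>R w) - f (x + 0 *\<^sub>R v + 0 *\<^sub>R w)) =
      (h - 0) * (?fv (x + s *\<^sub>R v + h *\<^sub>R w) - ?fv (x + s *\<^sub>R v + 0 *\<^sub>R w))"
    by (rule MVT2[of 0 h "\<lambda>s. f (x + s *\<^sub>R v + h *\<^sub>R w) - f (x + s *\<^sub>R v + 0 *\<^sub>R w)"])
      (use assms(1) in \<open>auto intro!: DERIV_diff d1[where t = h] d1[where t = 0, simplified]\<close>)
  then obtain s where s: "0 < s" "s < h" and e1: "(f (x + h *\<^sub>R v + h *\<^sub>R w) - f (x + h *\<^sub>R v)) -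
      (f (x + h *\<^sub>R w) - f x) = h * (?fv (x + s *\<^sub>R v + h *\<^sub>R w) - ?fv (x + s *\<^sub>R v + 0 *\<^sub>R w))"
    by auto
  have "\<exists>t. 0 < t \<and> t < h \<and> ?fv (x + s *\<^sub>R v + h *\<^sub>R w) - ?fv (x + s *\<^sub>R v + 0 *\<^sub>R w) =
      (h - 0) * frechet_derivative ?fv (at (x + s *\<^sub>R v + t *\<^sub>R w)) w"
    by (rule MVT2) (use assms(1) s in \<open>auto intro!: d2\<close>)
  then obtain t where "0 < t" "t < h" "?fv (x + s *\<^sub>R v + h *\<^sub>R w) - ?fv (x + s *\<^sub>R v + 0 *\<^sub>R w) =
      (h - 0) * frechet_derivative ?fv (at (x + s *\<^sub>R v + t *\<^sub>R w)) w" by blast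
  then show ?thesis using e1 s by (intro exI[of _ s] exI[of _ t]) simp
qed

text \<open>The second difference over the parallelogram spanned by \<open>h v\<close> and
  \<open>h w\<close> is unchanged when \<open>v\<close> and \<open>w\<close> are exchanged. It
  equals \<open>h * h\<close> times either mixed derivative at some point near \<open>x\<close>, and
  continuity carries both values back to \<open>x\<close>.\<close>

lemma smooth_on_second_derivative_symmetric:
  fixes f :: "'a::euclidean_space \<Rightarrow> real"
  assumes "open S" "smooth_on S f" "x \<in> S"
  shows "frechet_derivative (\<lambda>y. frechet_derivative f (at y) v) (at x) w =
    frechet_derivative (\<lambda>y. frechet_derivative f (at y) w) (at x) v"
    (is "?F x = ?G x")
proof (rule ccontr)
  assume "?F x \<noteq> ?G x"
  \<comment> \<open>Half of the supposed gap: two errors below \<open>e\<close> cannot bridge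
    it.\<close>
  define e where "e = dist (?F x) (?G x) / 2"
  have "e > 0" using \<open>?F x \<noteq> ?G x\<close> by (simp add: e_def)
  have cont: "continuous_on S ?F" "continuous_on S ?G"
    by (intro smooth_on_continuous smooth_on_frechet_derivative assms)+
  obtain d where d: "d > 0" "\<And>y. dist y x < d \<Longrightarrow> y \<in> S \<and> dist (?F y) (?F x) < e \<and> dist (?G y) (?G x) < e"
  proof -
    obtain d0 where d0: "d0 > 0" "ball x d0 \<subseteq> S" using assms openE by blast
    obtain d1 where d1: "d1 > 0" "\<And>y. y \<in> S \<Longrightarrow> dist y x < d1 \<Longrightarrow> dist (?F y) (?F x) < e"
      using cont(1) \<open>e > 0\<close> assms(3) unfolding continuous_on_iff by meson
    obtain d2 where d2: "d2 > 0" "\<And>y. y \<in> S \<Longrightarrow> dist y x < d2 \<Longrightarrow> dist (?G y) (?G x) < e"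
      using cont(2) \<open>e > 0\<close> assms(3) unfolding continuous_on_iff by meson
    show thesis
      by (rule that[of "min d0 (min d1 d2)"])
        (use d0 d1 d2 in \<open>auto simp: subset_iff dist_commute\<close>)
  qed
  \<comment> \<open>This size keeps the whole parallelogram within distance \<open>d\<close> of
    \<open>x\<close>; the summand 1 keeps the denominator positive when both vectors vanish.\<close>
  define h where "h = d / (2 * (norm v + norm w + 1))"
  have "h > 0" using d by (simp add: h_def add_nonneg_pos)
  have near: "dist (x + s *\<^sub>R v + t *\<^sub>R w) x < d" if "0 \<le> s" "s \<le> h" "0 \<le> t" "t \<le> h" for s t
  proof -
    have "dist (x + s *\<^sub>R v + t *\<^sub>R w) x \<le> s * norm v + t * norm w"
      using norm_triangle_ineq[of "s *\<^sub>R v" "t *\<^sub>R w"] that by (simp add: dist_norm add.assoc)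
    also have "\<dots> \<le> h * norm v + h * norm w" using that by (intro add_mono mult_right_mono) auto
    also have "\<dots> < 2 * h * (norm v + norm w + 1)" using \<open>h > 0\<close>
      by (simp add: algebra_simps add_nonneg_pos)
    also have "\<dots> = d" unfolding h_def using add_nonneg_pos[of "norm v + norm w" 1]
      by (simp add: nonzero_divide_eq_eq del: distrib_left_numeral)
    finally show ?thesis .
  qed
  obtain s t where st: "0 \<le> s" "s \<le> h" "0 \<le> t" "t \<le> h"
    "f (x + h *\<^sub>R v + h *\<^sub>R w) - f (x + h *\<^sub>R v) - f (x + h *\<^sub>R w) + f x =
      h * (h * ?F (x + s *\<^sub>R v + t *\<^sub>R w))"
    using second_difference_mean_value[OF \<open>h > 0\<close> assms(2), of x v w] near d(2) by meson
  have near': "dist (x + s *\<^sub>R w + t *\<^sub>R v) x < d" if "0 \<le> s" "s \<le> h" "0 \<le> t" "t \<le> h" for s t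
    using near[OF that(3,4,1,2)] by (simp add: add_ac)
  obtain s' t' where st': "0 \<le> s'" "s' \<le> h" "0 \<le> t'" "t' \<le> h"
    "f (x + h *\<^sub>R w + h *\<^sub>R v) - f (x + h *\<^sub>R w) - f (x + h *\<^sub>R v) + f x =
      h * (h * ?G (x + s' *\<^sub>R w + t' *\<^sub>R v))"
    using second_difference_mean_value[OF \<open>h > 0\<close> assms(2), of x w v] near' d(2) by meson
  have "h * (h * ?F (x + s *\<^sub>R v + t *\<^sub>R w)) = h * (h * ?G (x + s' *\<^sub>R w + t' *\<^sub>R v))"
    unfolding st(5)[symmetric] st'(5)[symmetric] by (simp add: add.assoc add.commute[of "h *\<^sub>R w"])
  then have "?F (x + s *\<^sub>R v + t *\<^sub>R w) = ?G (x + s' *\<^sub>R w + t' *\<^sub>R v)" using \<open>h > 0\<close> by simp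
  then have "dist (?F x) (?G x) \<le>
      dist (?F (x + s *\<^sub>R v + t *\<^sub>R w)) (?F x) + dist (?G (x + s' *\<^sub>R w + t' *\<^sub>R v)) (?G x)"
    using dist_triangle3[of "?F x" "?G x" "?F (x + s *\<^sub>R v + t *\<^sub>R w)"] by simp
  moreover have "dist (?F (x + s *\<^sub>R v + t *\<^sub>R w)) (?F x) < e"
    using d(2) near st(1-4) by blast
  moreover have "dist (?G (x + s' *\<^sub>R w + t' *\<^sub>R v)) (?G x) < e"
    using d(2) near' st'(1-4) by blast
  ultimately show False unfolding e_def by linarith
qed

subsection \<open>Point transformations and contact relations\<close>

abbreviation D :: "('a::euclidean_space \<Rightarrow> 'b::euclidean_space) \<Rightarrow> 'a \<Rightarrow> 'a \<Rightarrow> 'b" where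
  "D f x \<equiv> frechet_derivative f (at x)"

lemma D_eqI: "(f has_derivative f') (at x) \<Longrightarrow> D f x = f'"
  by (metis frechet_derivative_at)

text \<open>Functions with the same germ have the same candidates for a derivative, so both sides
  are the same choice.\<close>

lemma D_cong_open:
  assumes "open S" "x \<in> S" "\<And>y. y \<in> S \<Longrightarrow> f y = g y"
  shows "D f x = D g x"
proof -
  have "(f has_derivative f') (at x) \<longleftrightarrow> (g has_derivative f') (at x)" for f'
    using has_derivative_transform_within_open[OF _ assms(1,2), of f f' UNIV g]
      has_derivative_transform_within_open[OF _ assms(1,2), of g f' UNIV f] assms(3) by auto
  then show ?thesis by (simp add: frechet_derivative_def)
qed

lemma D_triple:
  fixes F :: "base \<Rightarrow> real"
  assumes "F differentiable (at b)"
  shows "D F b (dt, dx, du) = dt * D F b (1, 0, 0) + dx * D F b (0, 1, 0) + du * D F b (0, 0, 1)"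
proof -
  have lin: "linear (D F b)"
    using assms by (simp add: linear_frechet_derivative)
  have e: "(dt, dx, du) = dt *\<^sub>R (1, 0, 0) + dx *\<^sub>R (0, 1, 0) + du *\<^sub>R (0, 0, 1)" by simp
  show ?thesis by (subst e, simp only: linear_add[OF lin] linear_cmul[OF lin] real_scaleR_def)
qed

text \<open>Three equally spaced points suffice: the second difference isolates \<open>c2\<close>,
  then a first difference isolates \<open>c1\<close>. This splits identities valid for an interval
  of values of \<open>u_x\<close>.\<close>

lemma quadratic_coefficients_zero:
  fixes c0 :: real
  assumes "e > 0" "\<And>s. \<bar>s - s0\<bar> < e \<Longrightarrow> c0 + c1 * s + c2 * s\<^sup>2 = 0"
  shows "c0 = 0 \<and> c1 = 0 \<and> c2 = 0"
proof -
  define d where "d = e / 2"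
  have d: "d > 0" using assms(1) by (simp add: d_def)
  have a: "c0 + c1 * s0 + c2 * s0\<^sup>2 = 0" "c0 + c1 * (s0 + d) + c2 * (s0 + d)\<^sup>2 = 0"
    "c0 + c1 * (s0 - d) + c2 * (s0 - d)\<^sup>2 = 0"
    using assms by (auto intro!: assms(2) simp: d_def)
  have "2 * d\<^sup>2 * c2 = 0" using a by algebra
  then have "c2 = 0" using d by simp
  moreover from this have "d * c1 = 0" using a by algebra
  ultimately show ?thesis using a(1) d by simp
qed

lemma open_line:
  fixes z v :: "'a::real_normed_vector"
  assumes "open N" "z \<in> N"
  shows "\<exists>e>0. \<forall>s. \<bar>s\<bar> < e \<longrightarrow> z + s *\<^sub>R v \<in> N"
proof -
  obtain r where r: "r > 0" "ball z r \<subseteq> N" using assms openE by blast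
  have n: "norm v + 1 > 0" using norm_ge_zero[of v] by linarith
  have "z + s *\<^sub>R v \<in> N" if "\<bar>s\<bar> < r / (norm v + 1)" for s
  proof -
    have "\<bar>s\<bar> * norm v \<le> \<bar>s\<bar> * (norm v + 1)" by (simp add: mult_left_mono)
    also have "\<dots> < r" using that n by (simp add: pos_less_divide_eq)
    finally have "dist z (z + s *\<^sub>R v) < r" by (simp add: dist_norm)
    then show ?thesis using r(2) by auto
  qed
  then show ?thesis using r(1) n by (intro exI[of _ "r / (norm v + 1)"]) simp
qed

section \<open>Components of a point transformation with fixed projections \<open>\<phi>\<close> and
  \<open>\<psi>\<close>\<close>

locale jet_transformation =
  fixes \<Omega> :: "ext set" and \<Phi> :: "ext \<Rightarrow> ext" and \<phi> :: "base \<Rightarrow> base" and \<psi> :: "jet \<Rightarrow> jet"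
  assumes admissible: "admissible_domain \<Omega>"
    and local_diffeo: "local_diffeomorphism_on \<Omega> \<Phi>"
    and base_component: "z \<in> \<Omega> \<Longrightarrow> base_of (\<Phi> z) = \<phi> (base_of z)"
    and jet_component: "z \<in> \<Omega> \<Longrightarrow> jet_of (\<Phi> z) = \<psi> (jet_of z)"
    and contact: "preserves_contact_on (jet_of ` \<Omega>) \<psi>"
begin

definition "S = jet_of ` \<Omega>"
definition "B = base_of ` \<Omega>"
definition "T b = fst (\<phi> b)"
definition "X b = fst (snd (\<phi> b))"
definition "U b = snd (snd (\<phi> b))"
text \<open>\<open>P1\<close>, \<open>P2\<close> are the new \<open>u_t\<close>, \<open>u_x\<close>;
  \<open>Q1\<close>, \<open>Q2\<close>, \<open>Q3\<close> are the new \<open>u_tt\<close>,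
  \<open>u_tx\<close>, \<open>u_xx\<close>.\<close>

definition "P1 j = fst (fst (snd (\<psi> j)))"
definition "P2 j = snd (fst (snd (\<psi> j)))"
definition "Q1 j = fst (snd (snd (\<psi> j)))"
definition "Q2 j = fst (snd (snd (snd (\<psi> j))))"
definition "Q3 j = snd (snd (snd (snd (\<psi> j))))"

abbreviation "Tt b \<equiv> D T b (1, 0, 0)"
abbreviation "Xt b \<equiv> D X b (1, 0, 0)"
abbreviation "Xx b \<equiv> D X b (0, 1, 0)"
abbreviation "Xu b \<equiv> D X b (0, 0, 1)"
abbreviation "Ut b \<equiv> D U b (1, 0, 0)"
abbreviation "Ux b \<equiv> D U b (0, 1, 0)"
abbreviation "Uu b \<equiv> D U b (0, 0, 1)"

lemma open_domain: "open \<Omega>"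
  using admissible by (simp add: admissible_domain_def)

lemma open_S: "open S"
  unfolding S_def jet_of_def[abs_def] by (rule open_image_fst[OF open_domain])

lemma B_eq: "B = fst ` S"
  by (simp add: B_def S_def base_of_def[abs_def] image_image)

lemma open_B: "open B"
  unfolding B_eq by (rule open_image_fst[OF open_S])

lemma S_imp_B: "(b, r) \<in> S \<Longrightarrow> b \<in> B"
  unfolding B_eq by force

lemma in_domain_imp: "((b, r), \<theta>) \<in> \<Omega> \<Longrightarrow> (b, r) \<in> S \<and> b \<in> B"
  unfolding S_def B_def by (force simp: jet_of_def base_of_def)

lemma \<phi>_eq: "\<phi> b = (T b, X b, U b)"
  by (simp add: T_def X_def U_def)

lemma \<psi>_eq: "j \<in> S \<Longrightarrow> \<psi> j = (\<phi> (fst j), (P1 j, P2 j), (Q1 j, Q2 j, Q3 j))"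
  using base_component jet_component
  by (auto simp: P1_def P2_def Q1_def Q2_def Q3_def S_def base_of_def jet_of_def
      intro!: prod_eqI)

lemma \<Phi>_eq: "(j, \<theta>) \<in> \<Omega> \<Longrightarrow> \<Phi> (j, \<theta>) = (\<psi> j, snd (\<Phi> (j, \<theta>)))"
  using jet_component[of "(j, \<theta>)"] by (auto simp: jet_of_def intro!: prod_eqI)

text \<open>Smoothness is given for \<open>\<Phi>\<close> only. Freezing the derivative and element
  coordinates at a point of the domain exhibits \<open>\<phi>\<close> locally as a part of
  \<open>\<Phi>\<close>.\<close>

lemma smooth_\<phi>: "smooth_on B \<phi>"
proof (rule smooth_on_local)
  fix b assume "b \<in> B"
  then obtain r \<theta> where z: "((b, r), \<theta>) \<in> \<Omega>"
    unfolding B_def base_of_def jet_of_def by fastforce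
  then obtain V where V: "open V" "((b, r), \<theta>) \<in> V" "V \<subseteq> \<Omega>" "smooth_on V \<Phi>"
    using local_diffeo unfolding local_diffeomorphism_on_def by blast
  let ?N = "(\<lambda>b. ((b, r), \<theta>)) -` V"
  have o: "open ?N" by (intro open_vimage V continuous_intros)
  have "smooth_on ?N (\<lambda>b. fst (fst (\<Phi> ((b, r), \<theta>))))"
    by (intro smooth_intros o smooth_on_compose[OF _ V(1) _ V(4)]) auto
  then have "smooth_on ?N \<phi>"
    by (rule smooth_on_cong[OF _ o])
      (use V(3) base_component in \<open>fastforce simp: base_of_def jet_of_def\<close>)
  then show "\<exists>V. open V \<and> b \<in> V \<and> smooth_on V \<phi>" using o V(2) by blast
qed

lemma smooth_components: "smooth_on B T" "smooth_on B X" "smooth_on B U"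
  unfolding T_def[abs_def] X_def[abs_def] U_def[abs_def]
  by (intro smooth_intros open_B smooth_\<phi>)+

lemma differentiable_B: "smooth_on B f \<Longrightarrow> b \<in> B \<Longrightarrow> f differentiable (at b)"
  by (rule differentiableI) (rule smooth_on_has_derivative)

lemma D_\<phi>: "b \<in> B \<Longrightarrow> D \<phi> b v = (D T b v, D X b v, D U b v)"
proof -
  assume b: "b \<in> B"
  have "((\<lambda>b. (T b, X b, U b)) has_derivative (\<lambda>v. (D T b v, D X b v, D U b v))) (at b)"
    by (intro has_derivative_Pair smooth_on_has_derivative[OF _ b] smooth_components)
  then show ?thesis unfolding \<phi>_eq[symmetric, abs_def] by (simp add: D_eqI)
qed

text \<open>A local inverse \<open>g\<close> of \<open>\<Phi>\<close> satisfies: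
  \<open>\<phi>\<close> after the base part of \<open>g\<close> is the base projection.
  Differentiating this makes the derivative of \<open>\<phi>\<close> surjective, hence injective by
  equality of dimensions.\<close>

lemma D_\<phi>_inj:
  assumes "b \<in> B" "D \<phi> b v = 0" shows "v = 0"
proof -
  obtain z where z: "z \<in> \<Omega>" "b = fst (fst z)"
    using assms(1) by (auto simp: B_def base_of_def jet_of_def)
  then obtain V V' g where V: "open V" "z \<in> V" "V \<subseteq> \<Omega>" "open V'" "homeomorphism V V' \<Phi> g" "smooth_on V' g"
    using local_diffeo unfolding local_diffeomorphism_on_def by blast
  let ?w = "\<Phi> z"
  have w: "?w \<in> V'" "g ?w = z" using V(2,5) by (auto simp: homeomorphism_def)
  have g: "(g has_derivative D g ?w) (at ?w)" using smooth_on_has_derivative V(6) w(1) by blast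
  have "(\<phi> has_derivative D \<phi> b) (at (fst (fst (g ?w))))"
    using smooth_on_has_derivative[OF smooth_\<phi> assms(1)] by (simp add: w z)
  from diff_chain_at[OF has_derivative_fst[OF has_derivative_fst[OF g]] this]
  have c: "((\<lambda>w. \<phi> (fst (fst (g w)))) has_derivative (\<lambda>v. D \<phi> b (fst (fst (D g ?w v))))) (at ?w)"
    by (simp add: o_def)
  have "\<phi> (fst (fst (g w))) = fst (fst w)" if "w \<in> V'" for w
  proof -
    have "g w \<in> V" "\<Phi> (g w) = w" using V(5) that by (auto simp: homeomorphism_def)
    then show ?thesis using base_component[of "g w"] V(3) by (auto simp: base_of_def jet_of_def)
  qed
  then have "((\<lambda>w. fst (fst w)) has_derivative (\<lambda>v. D \<phi> b (fst (fst (D g ?w v))))) (at ?w)"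
    by (rule has_derivative_transform_within_open[OF c V(4) w(1)])
  moreover have "((\<lambda>w. fst (fst w)) has_derivative (\<lambda>v. fst (fst v))) (at ?w)"
    by (intro has_derivative_fst has_derivative_ident)
  ultimately have e: "(\<lambda>v. D \<phi> b (fst (fst (D g ?w v)))) = (\<lambda>v. fst (fst v))"
    by (rule has_derivative_unique)
  \<comment> \<open>Only the base part \<open>y\<close> of the vector matters;
    \<open>undefined\<close> fills the other coordinates.\<close>
  have "D \<phi> b (fst (fst (D g ?w ((y, undefined), undefined)))) = y" for y
    using fun_cong[OF e, of "((y, undefined), undefined)"] by simp
  then have "surj (D \<phi> b)" by (rule surjI)
  moreover have lin: "linear (D \<phi> b)"
    using smooth_on_has_derivative[OF smooth_\<phi> assms(1)] has_derivative_linear by blast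
  ultimately have "inj (D \<phi> b)" by (simp add: linear_surjective_imp_injective)
  then show ?thesis using assms(2) lin by (metis injD linear_0)
qed

text \<open>The contact vector with free \<open>dt\<close>, \<open>dx\<close> and zero second-order
  part is mapped to a contact vector at the new jet. Its three contact equations are the chain rules
  for total derivatives, which determine the prolongation implicitly.\<close>

lemma contact_relations:
  assumes j: "((t, x, u), (p1, p2), (q1, q2, q3)) \<in> S" (is "?j \<in> S")
  shows "D U (t, x, u) (dt, dx, p1 * dt + p2 * dx) =
      P1 ?j * D T (t, x, u) (dt, dx, p1 * dt + p2 * dx) + P2 ?j * D X (t, x, u) (dt, dx, p1 * dt + p2 * dx)"
    and "D P1 ?j ((dt, dx, p1 * dt + p2 * dx), (q1 * dt + q2 * dx, q2 * dt + q3 * dx), 0) =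
      Q1 ?j * D T (t, x, u) (dt, dx, p1 * dt + p2 * dx) + Q2 ?j * D X (t, x, u) (dt, dx, p1 * dt + p2 * dx)"
    and "D P2 ?j ((dt, dx, p1 * dt + p2 * dx), (q1 * dt + q2 * dx, q2 * dt + q3 * dx), 0) =
      Q2 ?j * D T (t, x, u) (dt, dx, p1 * dt + p2 * dx) + Q3 ?j * D X (t, x, u) (dt, dx, p1 * dt + p2 * dx)"
    and "(P1 has_derivative D P1 ?j) (at ?j)" "(P2 has_derivative D P2 ?j) (at ?j)"
proof -
  obtain E where E: "(\<psi> has_derivative E) (at ?j)" "E ` contact_plane ?j \<subseteq> contact_plane (\<psi> ?j)"
    using contact j unfolding preserves_contact_on_def S_def by blast
  let ?b = "(t, x, u)"
  have b: "?b \<in> B" using j by (rule S_imp_B)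
  have p1: "(P1 has_derivative (\<lambda>v. fst (fst (snd (E v))))) (at ?j)"
    unfolding P1_def[abs_def] by (intro has_derivative_fst has_derivative_snd E)
  have p2: "(P2 has_derivative (\<lambda>v. snd (fst (snd (E v))))) (at ?j)"
    unfolding P2_def[abs_def] by (intro has_derivative_fst has_derivative_snd E)
  show "(P1 has_derivative D P1 ?j) (at ?j)" "(P2 has_derivative D P2 ?j) (at ?j)"
    using p1 p2 D_eqI by metis+
  \<comment> \<open>The base part of \<open>\<psi>\<close> now has two derivatives, one from the
    contact condition and one from the smoothness of \<open>\<phi>\<close>; uniqueness identifies
    them.\<close>
  have "(\<phi> has_derivative D \<phi> ?b) (at (fst ?j))"
    using smooth_on_has_derivative[OF smooth_\<phi> b] by simp
  from diff_chain_at[OF has_derivative_fst[OF has_derivative_ident] this]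
  have "((\<lambda>j. \<phi> (fst j)) has_derivative (\<lambda>v. D \<phi> ?b (fst v))) (at ?j)" by (simp add: o_def)
  then have "((\<lambda>j. fst (\<psi> j)) has_derivative (\<lambda>v. D \<phi> ?b (fst v))) (at ?j)"
    by (rule has_derivative_transform_within_open[OF _ open_S j]) (simp add: \<psi>_eq)
  then have f: "(\<lambda>v. fst (E v)) = (\<lambda>v. D \<phi> ?b (fst v))"
    by (rule has_derivative_unique[OF has_derivative_fst[OF E(1)]])
  let ?v = "((dt, dx, p1 * dt + p2 * dx), (q1 * dt + q2 * dx, q2 * dt + q3 * dx), 0::real \<times> real \<times> real)"
  have "?v \<in> contact_plane ?j" by (auto simp: zero_prod_def)
  then have "E ?v \<in> contact_plane (\<psi> ?j)" using E by blast
  moreover have "E ?v = (D \<phi> ?b (dt, dx, p1 * dt + p2 * dx), (D P1 ?j ?v, D P2 ?j ?v), snd (snd (E ?v)))"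
    using fun_cong[OF f, of ?v] D_eqI[OF p1] D_eqI[OF p2] by (intro prod_eqI) simp_all
  moreover have "\<psi> ?j = ((T ?b, X ?b, U ?b), (P1 ?j, P2 ?j), (Q1 ?j, Q2 ?j, Q3 ?j))"
    using \<psi>_eq[OF j] by (simp add: \<phi>_eq)
  ultimately have "(D \<phi> ?b (dt, dx, p1 * dt + p2 * dx), (D P1 ?j ?v, D P2 ?j ?v), snd (snd (E ?v))) \<in>
      contact_plane ((T ?b, X ?b, U ?b), (P1 ?j, P2 ?j), (Q1 ?j, Q2 ?j, Q3 ?j))"
    by (simp only:)
  then show "D U (t, x, u) (dt, dx, p1 * dt + p2 * dx) =
      P1 ?j * D T (t, x, u) (dt, dx, p1 * dt + p2 * dx) + P2 ?j * D X (t, x, u) (dt, dx, p1 * dt + p2 * dx)"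
    "D P1 ?j ?v = Q1 ?j * D T (t, x, u) (dt, dx, p1 * dt + p2 * dx) + Q2 ?j * D X (t, x, u) (dt, dx, p1 * dt + p2 * dx)"
    "D P2 ?j ?v = Q2 ?j * D T (t, x, u) (dt, dx, p1 * dt + p2 * dx) + Q3 ?j * D X (t, x, u) (dt, dx, p1 * dt + p2 * dx)"
    by (auto simp: D_\<phi>[OF b])
qed

text \<open>If a combination of the two total-derivative directions annihilates \<open>T\<close> and
  \<open>X\<close>, then by the first contact relation it annihilates \<open>U\<close> too, and
  injectivity of the derivative of \<open>\<phi>\<close> makes it trivial.\<close>

lemma total_jacobian_nonzero:
  assumes "((t, x, u), (p1, p2), q) \<in> S"
  shows "D T (t, x, u) (1, 0, p1) * D X (t, x, u) (0, 1, p2) - D T (t, x, u) (0, 1, p2) * D X (t, x, u) (1, 0, p1) \<noteq> 0"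
proof
  obtain q1 q2 q3 where q: "q = (q1, q2, q3)" by (cases q)
  let ?b = "(t, x, u)" let ?j = "(?b, (p1, p2), (q1, q2, q3))"
  have b: "?b \<in> B" using assms by (rule S_imp_B)
  let ?v1 = "(1, 0, p1)" let ?v2 = "(0, 1, p2)"
  have U: "D U ?b ?v1 = P1 ?j * D T ?b ?v1 + P2 ?j * D X ?b ?v1"
    "D U ?b ?v2 = P1 ?j * D T ?b ?v2 + P2 ?j * D X ?b ?v2"
    using contact_relations(1)[OF assms[unfolded q], of 1 0] contact_relations(1)[OF assms[unfolded q], of 0 1]
    by simp_all
  have k: "\<alpha> = 0 \<and> \<beta> = 0"
    if "\<alpha> * D T ?b ?v1 + \<beta> * D T ?b ?v2 = 0" "\<alpha> * D X ?b ?v1 + \<beta> * D X ?b ?v2 = 0" for \<alpha> \<beta>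
  proof -
    have d: "D F ?b (\<alpha> *\<^sub>R ?v1 + \<beta> *\<^sub>R ?v2) = \<alpha> * D F ?b ?v1 + \<beta> * D F ?b ?v2" if "smooth_on B F" for F :: "base \<Rightarrow> real"
    proof -
      have "linear (D F ?b)" using smooth_on_has_derivative[OF that b] has_derivative_linear by blast
      then show ?thesis by (simp only: linear_add linear_cmul real_scaleR_def)
    qed
    have "\<alpha> * D U ?b ?v1 + \<beta> * D U ?b ?v2 = P1 ?j * (\<alpha> * D T ?b ?v1 + \<beta> * D T ?b ?v2) +
        P2 ?j * (\<alpha> * D X ?b ?v1 + \<beta> * D X ?b ?v2)"
      unfolding U by algebra
    then have "D \<phi> ?b (\<alpha> *\<^sub>R ?v1 + \<beta> *\<^sub>R ?v2) = 0"
      unfolding D_\<phi>[OF b] d[OF smooth_components(1)] d[OF smooth_components(2)] d[OF smooth_components(3)]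
      using that by (simp add: zero_prod_def)
    from D_\<phi>_inj[OF b this] show ?thesis by (simp add: zero_prod_def)
  qed
  assume 0: "D T ?b ?v1 * D X ?b ?v2 - D T ?b ?v2 * D X ?b ?v1 = 0"
  \<comment> \<open>For a singular matrix its cofactors are the coefficients of such combinations.
    So all four entries vanish, and then even the combination with coefficients 1, 0 would have to
    be trivial.\<close>
  have "D X ?b ?v2 = 0 \<and> - D X ?b ?v1 = 0" by (rule k) (use 0 in \<open>simp_all add: algebra_simps\<close>)
  moreover have "D T ?b ?v2 = 0 \<and> - D T ?b ?v1 = 0" by (rule k) (use 0 in \<open>simp_all add: algebra_simps\<close>)
  ultimately show False using k[of 1 0] by simp
qed

text \<open>The first contact relation is a linear system for \<open>P1\<close>, \<open>P2\<close>
  whose coefficients do not involve second derivatives and whose determinant is the total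
  Jacobian.\<close>

lemma first_order_projectable:
  assumes "(b, p, q) \<in> S" "(b, p, q') \<in> S"
  shows "P1 (b, p, q') = P1 (b, p, q)" "P2 (b, p, q') = P2 (b, p, q)"
proof -
  obtain t x u p1 p2 q1 q2 q3 q1' q2' q3' where e: "b = (t, x, u)" "p = (p1, p2)" "q = (q1, q2, q3)" "q' = (q1', q2', q3')"
    by (metis prod.exhaust)
  note r = contact_relations(1)[OF assms(1)[unfolded e], of 1 0] contact_relations(1)[OF assms(1)[unfolded e], of 0 1]
    contact_relations(1)[OF assms(2)[unfolded e], of 1 0] contact_relations(1)[OF assms(2)[unfolded e], of 0 1]
  define T1 T2 X1 X2 where d: "T1 = D T (t, x, u) (1, 0, p1)" "T2 = D T (t, x, u) (0, 1, p2)"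
    "X1 = D X (t, x, u) (1, 0, p1)" "X2 = D X (t, x, u) (0, 1, p2)"
  have n: "T1 * X2 - T2 * X1 \<noteq> 0" using total_jacobian_nonzero assms(1) unfolding d e by blast
  have 1: "(P1 (b, p, q') - P1 (b, p, q)) * T1 + (P2 (b, p, q') - P2 (b, p, q)) * X1 = 0"
    "(P1 (b, p, q') - P1 (b, p, q)) * T2 + (P2 (b, p, q') - P2 (b, p, q)) * X2 = 0"
    using r unfolding d e by (simp_all add: algebra_simps)
  have "(T1 * X2 - T2 * X1) * (P1 (b, p, q') - P1 (b, p, q)) = 0"
    "(T1 * X2 - T2 * X1) * (P2 (b, p, q') - P2 (b, p, q)) = 0"
    using 1 by algebra+
  then show "P1 (b, p, q') = P1 (b, p, q)" "P2 (b, p, q') = P2 (b, p, q)" using n by auto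
qed

text \<open>Near the jet with second-order part \<open>q'\<close>, the functions \<open>P1\<close>
  and \<open>P2\<close> agree with themselves composed with the map that resets this part to
  \<open>q\<close>. The chain rule does the rest.\<close>

lemma D_first_order_projectable:
  assumes "(b, p, q) \<in> S" "(b, p, q') \<in> S"
  shows "D P1 (b, p, q') (db, dp, dq) = D P1 (b, p, q) (db, dp, 0)"
    "D P2 (b, p, q') (db, dp, dq) = D P2 (b, p, q) (db, dp, 0)"
proof -
  let ?h = "\<lambda>j::jet. (fst j, fst (snd j), q)"
  let ?N = "S \<inter> ?h -` S"
  have N: "open ?N" "(b, p, q') \<in> ?N"
    using assms by (auto intro!: open_Int open_vimage open_S continuous_intros)
  have h: "(?h has_derivative (\<lambda>v. (fst v, fst (snd v), 0))) (at (b, p, q'))"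
    by (intro has_derivative_Pair has_derivative_fst has_derivative_snd has_derivative_ident has_derivative_const)
  have **: "D P (b, p, q') (db, dp, dq) = D P (b, p, q) (db, dp, 0)"
    if P: "(P has_derivative D P (b, p, q)) (at (b, p, q))" and "\<And>j. j \<in> ?N \<Longrightarrow> P (?h j) = P j" for P :: "jet \<Rightarrow> real"
  proof -
    have "((P \<circ> ?h) has_derivative (D P (b, p, q) \<circ> (\<lambda>v. (fst v, fst (snd v), 0)))) (at (b, p, q'))"
      by (rule diff_chain_at[OF h]) (use P in simp)
    then have "(P has_derivative (D P (b, p, q) \<circ> (\<lambda>v. (fst v, fst (snd v), 0)))) (at (b, p, q'))"
      by (rule has_derivative_transform_within_open[OF _ N]) (use that(2) in simp)
    then show ?thesis by (simp add: D_eqI)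
  qed
  obtain t x u p1 p2 q1 q2 q3 where e: "b = (t, x, u)" "p = (p1, p2)" "q = (q1, q2, q3)"
    by (metis prod.exhaust)
  have *: "(P1 has_derivative D P1 (b, p, q)) (at (b, p, q))" "(P2 has_derivative D P2 (b, p, q)) (at (b, p, q))"
    using contact_relations(4,5) assms(1) unfolding e by blast+
  have "P1 (?h j) = P1 j \<and> P2 (?h j) = P2 j" if "j \<in> ?N" for j
    using that first_order_projectable[of "fst j" "fst (snd j)" "snd (snd j)" q] by simp
  with ** * show "D P1 (b, p, q') (db, dp, dq) = D P1 (b, p, q) (db, dp, 0)"
    "D P2 (b, p, q') (db, dp, dq) = D P2 (b, p, q) (db, dp, 0)"
    by blast+
qed


subsection \<open>Equivalence transformations are in normal form\<close>

lemma maps_equationsE: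
  assumes m: "maps_equations_to_equations \<Omega> \<Phi>" and "arbitrary_elements_on W \<theta>"
    and "indep j \<in> W" "(j, \<theta> (indep j)) \<in> \<Omega>"
  obtains V W' \<theta>' where "open V" "j \<in> V" "arbitrary_elements_on W' \<theta>'"
    "\<And>i. i \<in> V \<Longrightarrow> (i, \<theta> (indep i)) \<in> \<Omega>"
    "\<And>i. i \<in> V \<Longrightarrow> indep (\<psi> i) \<in> W'"
    "\<And>i. i \<in> V \<Longrightarrow> snd (\<Phi> (i, \<theta> (indep i))) = \<theta>' (indep (\<psi> i))"
    "\<And>i. i \<in> V \<Longrightarrow> kolmogorov (\<theta> (indep i)) i \<longleftrightarrow> kolmogorov (\<theta>' (indep (\<psi> i))) (\<psi> i)"
proof -
  have "indep j \<in> W \<and> lift \<theta> j \<in> \<Omega>" using assms(3,4) by (simp add: lift_def)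
  from m[unfolded maps_equations_to_equations_def, THEN spec, THEN spec, THEN mp, OF assms(2),
      THEN spec, THEN mp, OF this]
  obtain V W' \<theta>' where V: "open V" "j \<in> V" "arbitrary_elements_on W' \<theta>'"
    "\<forall>i\<in>V. indep i \<in> W \<and> lift \<theta> i \<in> \<Omega> \<and>
              (let i' = jet_of (\<Phi> (lift \<theta> i)) in
                 indep i' \<in> W' \<and> \<Phi> (lift \<theta> i) = lift \<theta>' i' \<and>
                 (kolmogorov (\<theta> (indep i)) i \<longleftrightarrow> kolmogorov (\<theta>' (indep i')) i'))"
    by (elim exE conjE)
  have "(i, \<theta> (indep i)) \<in> \<Omega> \<and> indep (\<psi> i) \<in> W' \<and> snd (\<Phi> (i, \<theta> (indep i))) = \<theta>' (indep (\<psi> i)) \<and>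
    (kolmogorov (\<theta> (indep i)) i \<longleftrightarrow> kolmogorov (\<theta>' (indep (\<psi> i))) (\<psi> i))" if "i \<in> V" for i
  proof -
    note h = bspec[OF V(4) that, unfolded lift_def Let_def]
    have o: "(i, \<theta> (indep i)) \<in> \<Omega>" using h by (elim conjE)
    have p: "jet_of (\<Phi> (i, \<theta> (indep i))) = \<psi> i" using jet_component[OF o] by (simp add: jet_of_def)
    have "snd (\<Phi> (i, \<theta> (indep i))) = \<theta>' (indep (\<psi> i))"
      using h unfolding p by (elim conjE) (metis snd_conv)
    then show ?thesis using h unfolding p by (elim conjE) (intro conjI)
  qed
  then show thesis by (intro that[OF V(1-3)]) (elim conjE meta_allE, blast)+
qed

text \<open>For constant arbitrary elements, the new elements near a jet are a function of the new
  \<open>(t, x)\<close>, and these depend on the base point alone. Hence they are locally constant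
  along the fibre, and constant on connected sets in it.\<close>

lemma element_constant:
  assumes m: "maps_equations_to_equations \<Omega> \<Phi>"
    and c: "connected_component {i. fst i = fst j \<and> (i, \<theta>) \<in> \<Omega>} j j'"
  shows "snd (\<Phi> (j, \<theta>)) = snd (\<Phi> (j', \<theta>))"
proof -
  let ?F = "{i. fst i = fst j \<and> (i, \<theta>) \<in> \<Omega>}"
  obtain C where C: "connected C" "C \<subseteq> ?F" "j \<in> C" "j' \<in> C"
    using c unfolding connected_component_def by blast
  have "\<exists>N. openin (top_of_set C) N \<and> i \<in> N \<and> (\<forall>k\<in>N. snd (\<Phi> (i, \<theta>)) = snd (\<Phi> (k, \<theta>)))" if "i \<in> C" for i
  proof -
    have i: "fst i = fst j" "(i, \<theta>) \<in> \<Omega>" using C(2) that by auto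
    have "arbitrary_elements_on UNIV (\<lambda>_. \<theta>)"
      using admissible i(2) by (auto simp: arbitrary_elements_on_def admissible_domain_def elements_of_def)
    then obtain V W' \<theta>' where V: "open V" "i \<in> V" "\<And>k. k \<in> V \<Longrightarrow> (k, \<theta>) \<in> \<Omega>"
      "\<And>k. k \<in> V \<Longrightarrow> snd (\<Phi> (k, \<theta>)) = \<theta>' (indep (\<psi> k))"
      by (rule maps_equationsE[OF m, where j = i]) (use i(2) in auto)
    have e: "snd (\<Phi> (k, \<theta>)) = \<theta>' (fst (\<phi> (fst k)), fst (snd (\<phi> (fst k))))" if "k \<in> V" for k
      using V(3,4)[OF that] in_domain_imp[of "fst k" "snd k" \<theta>] \<psi>_eq[of k] by (simp add: indep_def)
    have "snd (\<Phi> (i, \<theta>)) = snd (\<Phi> (k, \<theta>))" if "k \<in> C \<inter> V" for k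
    proof -
      have "k \<in> V" "fst k = fst i" using that i C(2) by auto
      then show ?thesis using e[OF V(2)] e[of k] by simp
    qed
    moreover have "openin (top_of_set C) (C \<inter> V)" using V(1) by (rule openin_open_Int)
    ultimately show ?thesis using V(2) \<open>i \<in> C\<close> by blast
  qed
  then show ?thesis
    by (rule connected_equivalence_relation[OF C(1,3,4), where R = "\<lambda>i k. snd (\<Phi> (i, \<theta>)) = snd (\<Phi> (k, \<theta>))", rotated 2])
      (simp_all only:)
qed

text \<open>This is where the connectedness clause of \<open>admissible_domain\<close> enters:
  formulas for the new elements need proof only at jets satisfying the equation.\<close>

lemma Kolmogorov_representative:
  assumes "maps_equations_to_equations \<Omega> \<Phi>" "(j, \<theta>) \<in> \<Omega>"
  obtains j' where "fst j' = fst j" "(j', \<theta>) \<in> \<Omega>" "kolmogorov \<theta> j'"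
    "snd (\<Phi> (j', \<theta>)) = snd (\<Phi> (j, \<theta>))"
proof -
  obtain j' where j': "kolmogorov \<theta> j'" "connected_component {i. fst i = fst j \<and> (i, \<theta>) \<in> \<Omega>} j j'"
    using admissible assms(2) unfolding admissible_domain_def by blast
  then have "j' \<in> {i. fst i = fst j \<and> (i, \<theta>) \<in> \<Omega>}" using connected_component_in by blast
  then show thesis using that[OF _ _ j'(1)] element_constant[OF assms(1) j'(2)] by simp
qed

text \<open>Constant arbitrary elements turn the requirement on neighbourhoods into one at a single
  point of the extended space.\<close>

lemma transformed_equation:
  assumes m: "maps_equations_to_equations \<Omega> \<Phi>" and z: "(j, \<theta>) \<in> \<Omega>"
  shows "fst (snd (\<Phi> (j, \<theta>))) \<noteq> 0" "kolmogorov \<theta> j \<longleftrightarrow> kolmogorov (snd (\<Phi> (j, \<theta>))) (\<psi> j)"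
proof -
  have "arbitrary_elements_on UNIV (\<lambda>_. \<theta>)"
    using admissible z by (auto simp: arbitrary_elements_on_def admissible_domain_def elements_of_def)
  then obtain V W' \<theta>' where V: "j \<in> V" "arbitrary_elements_on W' \<theta>'" "indep (\<psi> j) \<in> W'"
    "snd (\<Phi> (j, \<theta>)) = \<theta>' (indep (\<psi> j))" "kolmogorov \<theta> j \<longleftrightarrow> kolmogorov (\<theta>' (indep (\<psi> j))) (\<psi> j)"
    by (rule maps_equationsE[OF m, where j = j]) (use z in auto)
  then show "fst (snd (\<Phi> (j, \<theta>))) \<noteq> 0" "kolmogorov \<theta> j \<longleftrightarrow> kolmogorov (snd (\<Phi> (j, \<theta>))) (\<psi> j)"
    unfolding arbitrary_elements_on_def by auto
qed

text \<open>A short segment with fixed base point is a connected piece of the fibre, so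
  \<open>element_constant\<close> applies along it.\<close>

lemma vary_jet:
  assumes m: "maps_equations_to_equations \<Omega> \<Phi>" and z: "(j, \<theta>) \<in> \<Omega>" and v: "fst v = 0"
  shows "\<exists>e>0. \<forall>s. \<bar>s\<bar> < e \<longrightarrow> (j + s *\<^sub>R v, \<theta>) \<in> \<Omega> \<and> snd (\<Phi> (j + s *\<^sub>R v, \<theta>)) = snd (\<Phi> (j, \<theta>))"
proof -
  obtain e where e: "e > 0" "\<And>s. \<bar>s\<bar> < e \<Longrightarrow> (j, \<theta>) + s *\<^sub>R (v, 0) \<in> \<Omega>"
    using open_line[OF open_domain z, of "(v, 0)"] by blast
  have in\<Omega>: "(j + s *\<^sub>R v, \<theta>) \<in> \<Omega>" if "\<bar>s\<bar> < e" for s using e(2)[OF that] by simp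
  have "snd (\<Phi> (j, \<theta>)) = snd (\<Phi> (j + s *\<^sub>R v, \<theta>))" if "\<bar>s\<bar> < e" for s
  proof (rule element_constant[OF m])
    have "connected ((\<lambda>s. j + s *\<^sub>R v) ` {- e<..<e})"
      by (intro connected_continuous_image continuous_intros) simp
    moreover have "(\<lambda>s. j + s *\<^sub>R v) ` {- e<..<e} \<subseteq> {i. fst i = fst j \<and> (i, \<theta>) \<in> \<Omega>}"
      using v in\<Omega> by auto
    moreover have "j + s *\<^sub>R v \<in> (\<lambda>s. j + s *\<^sub>R v) ` {- e<..<e}"
      by (rule imageI) (use that in auto)
    moreover have "j \<in> (\<lambda>s. j + s *\<^sub>R v) ` {- e<..<e}"
      using e(1) by (intro image_eqI[of _ _ 0]) auto
    ultimately show "connected_component {i. fst i = fst j \<and> (i, \<theta>) \<in> \<Omega>} j (j + s *\<^sub>R v)"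
      unfolding connected_component_def by blast
  qed
  then show ?thesis using e(1) in\<Omega> by metis
qed

lemma D_linear: "smooth_on B (F :: base \<Rightarrow> real) \<Longrightarrow> b \<in> B \<Longrightarrow>
    D F b (dt, dx, du) = dt * D F b (1, 0, 0) + dx * D F b (0, 1, 0) + du * D F b (0, 0, 1)"
  by (rule D_triple) (rule differentiable_B)

text \<open>
  Varying \<open>u_tt\<close> alone changes neither the first-order derivatives of the transformed jet nor, by the
  transformed equation, its \<open>u_xx\<close>.  With a nonzero total derivative of \<open>T\<close> the contact relations then fix
  the rest of the jet too, against injectivity.
\<close>

lemma Kolmogorov_DxT:
  assumes m: "maps_equations_to_equations \<Omega> \<Phi>"
    and z: "(((t, x, u), (p1, p2), (q1, q2, q3)), (a, b)) \<in> \<Omega>" and k: "p1 = a * q3 + b * p2"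
  shows "D T (t, x, u) (0, 1, p2) = 0"
proof (rule ccontr)
  assume n: "D T (t, x, u) (0, 1, p2) \<noteq> 0"
  let ?z = "(((t, x, u), (p1, p2), (q1, q2, q3)), (a, b))"
  obtain V V' g where V: "open V" "?z \<in> V" "homeomorphism V V' \<Phi> g"
    using local_diffeo z unfolding local_diffeomorphism_on_def by blast
  have "inj_on \<Phi> V" using homeomorphism_apply1[OF V(3)] by (rule inj_on_inverseI)
  let ?v = "(0, (0, 0), (1, 0, 0))"
  obtain e where e: "e > 0" "\<forall>s. \<bar>s\<bar> < e \<longrightarrow> ?z + s *\<^sub>R (?v, 0) \<in> V"
    using open_line[OF V(1,2)] by blast
  obtain e' where e': "e' > 0" "\<forall>s. \<bar>s\<bar> < e' \<longrightarrow> (fst ?z + s *\<^sub>R ?v, (a, b)) \<in> \<Omega> \<and>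
    snd (\<Phi> (fst ?z + s *\<^sub>R ?v, (a, b))) = snd (\<Phi> ?z)"
    using vary_jet[OF m z, of ?v] by auto
  define d where "d = min e e' / 2"
  define q1' where "q1' = q1 + d"
  have d: "\<bar>d\<bar> < e" "\<bar>d\<bar> < e'" "q1' \<noteq> q1" using e(1) e'(1) by (auto simp: d_def q1'_def)
  let ?j = "((t, x, u), (p1, p2), (q1, q2, q3))"
  let ?j' = "((t, x, u), (p1, p2), (q1', q2, q3))"
  have "fst ?z + d *\<^sub>R ?v = ?j'" by (simp add: zero_prod_def q1'_def)
  then have z': "(?j', (a, b)) \<in> \<Omega>" and s: "snd (\<Phi> (?j', (a, b))) = snd (\<Phi> (?j, (a, b)))"
    using e'(2)[rule_format, OF d(2)] by simp_all
  have "?z + d *\<^sub>R (?v, 0) = (?j', (a, b))" by (simp add: zero_prod_def q1'_def)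
  then have zV: "(?j', (a, b)) \<in> V" using e(2)[rule_format, OF d(1)] by simp
  have S: "?j \<in> S" "?j' \<in> S" using z z' in_domain_imp by blast+
  have P: "P1 ?j' = P1 ?j" "P2 ?j' = P2 ?j" using first_order_projectable S by blast+
  obtain A' B' where AB: "snd (\<Phi> (?j, (a, b))) = (A', B')" by fastforce
  have "A' \<noteq> 0" using transformed_equation(1)[OF m z] AB by simp
  have "P1 ?j = A' * Q3 ?j + B' * P2 ?j"
    using transformed_equation(2)[OF m z] k AB \<psi>_eq[OF S(1)] by (simp add: \<phi>_eq)
  moreover have "P1 ?j' = A' * Q3 ?j' + B' * P2 ?j'"
    using transformed_equation(2)[OF m z'] k AB s \<psi>_eq[OF S(2)] by (simp add: \<phi>_eq)
  ultimately have Q3: "Q3 ?j' = Q3 ?j" using P \<open>A' \<noteq> 0\<close> by simp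
  \<comment> \<open>The direction of the total \<open>x\<close>-derivative does not contain
    \<open>u_tt\<close>, so the same vector lies in the contact planes of both jets.\<close>
  let ?v = "((0, 1, p2), (q2, q3), (0, 0, 0))"
  have D: "D P1 ?j' ?v = D P1 ?j ?v" "D P2 ?j' ?v = D P2 ?j ?v"
    using D_first_order_projectable[OF S] by (simp_all add: zero_prod_def)
  have r: "D P2 ?j ?v = Q2 ?j * D T (t, x, u) (0, 1, p2) + Q3 ?j * D X (t, x, u) (0, 1, p2)"
    "D P1 ?j ?v = Q1 ?j * D T (t, x, u) (0, 1, p2) + Q2 ?j * D X (t, x, u) (0, 1, p2)"
    "D P2 ?j' ?v = Q2 ?j' * D T (t, x, u) (0, 1, p2) + Q3 ?j' * D X (t, x, u) (0, 1, p2)"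
    "D P1 ?j' ?v = Q1 ?j' * D T (t, x, u) (0, 1, p2) + Q2 ?j' * D X (t, x, u) (0, 1, p2)"
    using contact_relations(2,3)[OF S(1), of 0 1] contact_relations(2,3)[OF S(2), of 0 1]
    by (simp_all add: zero_prod_def)
  have "Q2 ?j' * D T (t, x, u) (0, 1, p2) = Q2 ?j * D T (t, x, u) (0, 1, p2)"
    using r(1) r(3)[unfolded D Q3] by simp
  then have Q2: "Q2 ?j' = Q2 ?j" using n by simp
  have "Q1 ?j' * D T (t, x, u) (0, 1, p2) = Q1 ?j * D T (t, x, u) (0, 1, p2)"
    using r(2) r(4)[unfolded D Q2] by simp
  then have Q1: "Q1 ?j' = Q1 ?j" using n by simp
  have "\<Phi> (?j', (a, b)) = \<Phi> (?j, (a, b))"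
    using \<Phi>_eq[OF z] \<Phi>_eq[OF z'] s \<psi>_eq[OF S(1)] \<psi>_eq[OF S(2)] P Q1 Q2 Q3 by simp
  then have "(?j', (a, b)) = ?z" using \<open>inj_on \<Phi> V\<close> zV V(2) by (simp add: inj_on_eq_iff)
  then show False using d(3) by simp
qed

text \<open>Stated infinitesimally because on a general domain vanishing derivatives do not make
  \<open>T\<close> a single function of \<open>t\<close>.\<close>

definition fibration :: bool where
  "fibration \<longleftrightarrow> (\<forall>b\<in>B. D T b (0, 1, 0) = 0 \<and> D T b (0, 0, 1) = 0)"

lemma B_representative:
  assumes "maps_equations_to_equations \<Omega> \<Phi>" "(t, x, u) \<in> B"
  obtains p1 p2 q1 q2 q3 a b where "(((t, x, u), (p1, p2), (q1, q2, q3)), (a, b)) \<in> \<Omega>"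
    "p1 = a * q3 + b * p2" "a \<noteq> 0"
proof -
  obtain r \<theta> where "(((t, x, u), r), \<theta>) \<in> \<Omega>"
    using assms(2) unfolding B_def base_of_def jet_of_def by fastforce
  then obtain j where j: "fst j = (t, x, u)" "(j, \<theta>) \<in> \<Omega>" "kolmogorov \<theta> j"
    by (rule Kolmogorov_representative[OF assms(1)]) simp
  obtain p1 p2 q1 q2 q3 a b where e: "j = ((t, x, u), (p1, p2), (q1, q2, q3))" "\<theta> = (a, b)"
    using j(1) by (metis prod.collapse)
  have "a \<noteq> 0" using admissible j(2) unfolding e admissible_domain_def by (auto simp: elements_of_def)
  then show thesis using that[of p1 p2 q1 q2 q3 a b] j unfolding e by simp
qed

text \<open>The direction \<open>(b, 1)\<close> in \<open>(u_t, u_x)\<close> is tangent to the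
  equation when the second derivatives and the elements are fixed.\<close>

lemma vary_p2:
  assumes m: "maps_equations_to_equations \<Omega> \<Phi>"
    and z: "(((t, x, u), (p1, p2), (q1, q2, q3)), (a, b)) \<in> \<Omega>" and k: "p1 = a * q3 + b * p2"
  shows "\<exists>e>0. \<forall>s. \<bar>s - p2\<bar> < e \<longrightarrow>
    (((t, x, u), (a * q3 + b * s, s), (q1, q2, q3)), (a, b)) \<in> \<Omega> \<and>
    snd (\<Phi> (((t, x, u), (a * q3 + b * s, s), (q1, q2, q3)), (a, b))) =
    snd (\<Phi> (((t, x, u), (p1, p2), (q1, q2, q3)), (a, b)))"
proof -
  let ?j = "((t, x, u), (p1, p2), (q1, q2, q3))"
  have e: "?j + (s - p2) *\<^sub>R (0, (b, 1), 0) = ((t, x, u), (a * q3 + b * s, s), (q1, q2, q3))" for s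
    using k by (simp add: zero_prod_def algebra_simps)
  obtain d where d: "d > 0" "\<forall>s. \<bar>s\<bar> < d \<longrightarrow> (?j + s *\<^sub>R (0, (b, 1), 0), (a, b)) \<in> \<Omega> \<and>
    snd (\<Phi> (?j + s *\<^sub>R (0, (b, 1), 0), (a, b))) = snd (\<Phi> (?j, (a, b)))"
    using vary_jet[OF m z, of "(0, (b, 1), 0)"] by (auto simp: zero_prod_def)
  show ?thesis unfolding e[symmetric]
    by (rule exI[of _ d]) (use d in blast)
qed

text \<open>The total derivative \<open>T_x + u_x T_u\<close> vanishes at all jets of the equation,
  hence for an interval of values of \<open>u_x\<close>.\<close>

lemma maps_imp_fibration:
  assumes m: "maps_equations_to_equations \<Omega> \<Phi>"
  shows fibration
  unfolding fibration_def
proof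
  fix b0 assume b0: "b0 \<in> B"
  obtain t x u where e: "b0 = (t, x, u)" by (cases b0)
  obtain p1 p2 q1 q2 q3 a b where z: "(((t, x, u), (p1, p2), (q1, q2, q3)), (a, b)) \<in> \<Omega>"
    "p1 = a * q3 + b * p2" "a \<noteq> 0" using B_representative[OF m] b0 unfolding e by metis
  obtain d where d: "d > 0" "\<And>s. \<bar>s - p2\<bar> < d \<Longrightarrow>
    (((t, x, u), (a * q3 + b * s, s), (q1, q2, q3)), (a, b)) \<in> \<Omega>"
    using vary_p2[OF m z(1,2)] by blast
  have "D T b0 (0, 1, 0) + D T b0 (0, 0, 1) * s + 0 * s\<^sup>2 = 0" if "\<bar>s - p2\<bar> < d" for s
    using Kolmogorov_DxT[OF m d(2)[OF that] refl] D_linear[OF smooth_components(1) b0, of 0 1 s]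
    by (simp add: e mult.commute)
  from quadratic_coefficients_zero[OF d(1) this]
  show "D T b0 (0, 1, 0) = 0 \<and> D T b0 (0, 0, 1) = 0" by simp
qed


section \<open>Prolongation formulas when \<open>T\<close> depends on \<open>t\<close> alone\<close>

abbreviation "Xxx b \<equiv> D (\<lambda>b. Xx b) b (0, 1, 0)"

lemma smooth_partials: "smooth_on B (\<lambda>b. D T b v)" "smooth_on B (\<lambda>b. D X b v)" "smooth_on B (\<lambda>b. D U b v)"
  by (intro smooth_on_frechet_derivative smooth_components)+

lemma fibration_D_T: "fibration \<Longrightarrow> b \<in> B \<Longrightarrow> D T b (dt, dx, du) = dt * Tt b"
  using D_linear[OF smooth_components(1), of b dt dx du] by (simp add: fibration_def)

text \<open>With \<open>T_x = T_u = 0\<close> the total Jacobian is the product of these two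
  factors.\<close>

lemma fibration_nondegenerate:
  assumes fibration "((t, x, u), (p1, p2), q) \<in> S"
  shows "Tt (t, x, u) \<noteq> 0" "Xx (t, x, u) + p2 * Xu (t, x, u) \<noteq> 0"
proof -
  have b: "(t, x, u) \<in> B" using assms(2) by (rule S_imp_B)
  have "D T (t, x, u) (0, 1, p2) = 0" "D T (t, x, u) (1, 0, p1) = Tt (t, x, u)"
    using fibration_D_T[OF assms(1) b, of 0 1 p2] fibration_D_T[OF assms(1) b, of 1 0 p1] by (simp_all only: mult_zero_left mult_1)
  moreover have "D X (t, x, u) (0, 1, p2) = Xx (t, x, u) + p2 * Xu (t, x, u)"
    using D_linear[OF smooth_components(2) b, of 0 1 p2] by simp
  ultimately show "Tt (t, x, u) \<noteq> 0" "Xx (t, x, u) + p2 * Xu (t, x, u) \<noteq> 0"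
    using total_jacobian_nonzero[OF assms(2)] by auto
qed

lemma fibration_P:
  assumes fibration "((t, x, u), (p1, p2), q) \<in> S"
  shows "P2 ((t, x, u), (p1, p2), q) * (Xx (t, x, u) + p2 * Xu (t, x, u)) = Ux (t, x, u) + p2 * Uu (t, x, u)"
    and "P1 ((t, x, u), (p1, p2), q) * Tt (t, x, u) = Ut (t, x, u) + p1 * Uu (t, x, u) -
      P2 ((t, x, u), (p1, p2), q) * (Xt (t, x, u) + p1 * Xu (t, x, u))"
proof -
  obtain q1 q2 q3 where q: "q = (q1, q2, q3)" by (cases q)
  have b: "(t, x, u) \<in> B" using assms(2) by (rule S_imp_B)
  note l = D_linear[OF smooth_components(2) b] D_linear[OF smooth_components(3) b] fibration_D_T[OF assms(1) b]
  show "P2 ((t, x, u), (p1, p2), q) * (Xx (t, x, u) + p2 * Xu (t, x, u)) = Ux (t, x, u) + p2 * Uu (t, x, u)"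
    using contact_relations(1)[OF assms(2)[unfolded q], of 0 1] unfolding q
    by (simp add: l(1)[of 0 1 p2] l(2)[of 0 1 p2] l(3)[of 0 1 p2])
  show "P1 ((t, x, u), (p1, p2), q) * Tt (t, x, u) = Ut (t, x, u) + p1 * Uu (t, x, u) -
      P2 ((t, x, u), (p1, p2), q) * (Xt (t, x, u) + p1 * Xu (t, x, u))"
    using contact_relations(1)[OF assms(2)[unfolded q], of 1 0] unfolding q
    by (simp add: l(1)[of 1 0 p1] l(2)[of 1 0 p1] l(3)[of 1 0 p1])
qed

lemma has_derivative_along_base:
  assumes "smooth_on B (F :: base \<Rightarrow> real)" "(b, r) \<in> S"
  shows "((\<lambda>j. F (fst j)) has_derivative (\<lambda>v. D F b (fst v))) (at (b, r))"
proof -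
  have "(F has_derivative D F b) (at (fst (b, r)))"
    using smooth_on_has_derivative[OF assms(1)] S_imp_B[OF assms(2)] by simp
  from diff_chain_at[OF has_derivative_fst[OF has_derivative_ident] this]
  show ?thesis by (simp add: o_def)
qed

text \<open>The identity for \<open>P2\<close> in \<open>fibration_P\<close> is differentiated along
  the total \<open>x\<close>-derivative, and the contact relation replaces the derivative of
  \<open>P2\<close> by \<open>Q3 * (Xx + p2 * Xu)\<close>.\<close>

lemma fibration_Q3:
  assumes fib: fibration and j: "((t, x, u), (p1, p2), (q1, q2, q3)) \<in> S"
  shows "Q3 ((t, x, u), (p1, p2), (q1, q2, q3)) * (Xx (t, x, u) + p2 * Xu (t, x, u))\<^sup>2 =
    D Ux (t, x, u) (0, 1, p2) + p2 * D Uu (t, x, u) (0, 1, p2) -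
    P2 ((t, x, u), (p1, p2), (q1, q2, q3)) * (D Xx (t, x, u) (0, 1, p2) + p2 * D Xu (t, x, u) (0, 1, p2)) +
    q3 * (Uu (t, x, u) - P2 ((t, x, u), (p1, p2), (q1, q2, q3)) * Xu (t, x, u))"
proof -
  let ?b = "(t, x, u)" let ?j = "(?b, (p1, p2), (q1, q2, q3))"
  have b: "?b \<in> B" using j by (rule S_imp_B)
  let ?p = "\<lambda>j::jet. snd (fst (snd j))"
  have p: "(?p has_derivative ?p) (at ?j)"
    by (intro has_derivative_snd has_derivative_fst has_derivative_ident)
  have l: "((\<lambda>j. P2 j * (Xx (fst j) + ?p j * Xu (fst j))) has_derivative
      (\<lambda>v. P2 ?j * (D Xx ?b (fst v) + (p2 * D Xu ?b (fst v) + ?p v * Xu ?b)) + D P2 ?j v * (Xx ?b + p2 * Xu ?b))) (at ?j)"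
    using has_derivative_mult[OF contact_relations(5)[OF j] has_derivative_add[OF has_derivative_along_base[OF smooth_partials(2) j]
        has_derivative_mult[OF p has_derivative_along_base[OF smooth_partials(2) j]]]] by simp
  have r: "((\<lambda>j. Ux (fst j) + ?p j * Uu (fst j)) has_derivative
      (\<lambda>v. D Ux ?b (fst v) + (p2 * D Uu ?b (fst v) + ?p v * Uu ?b))) (at ?j)"
    using has_derivative_add[OF has_derivative_along_base[OF smooth_partials(3) j]
        has_derivative_mult[OF p has_derivative_along_base[OF smooth_partials(3) j]]] by simp
  have "P2 i * (Xx (fst i) + ?p i * Xu (fst i)) = Ux (fst i) + ?p i * Uu (fst i)" if "i \<in> S" for i
  proof -
    obtain t x u p1 p2 q where "i = ((t, x, u), (p1, p2), q)" by (metis prod.exhaust)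
    then show ?thesis using fibration_P(1)[OF fib] that by simp
  qed
  from has_derivative_unique[OF has_derivative_transform_within_open[OF l open_S j this] r]
  have "P2 ?j * (D Xx ?b (0, 1, p2) + (p2 * D Xu ?b (0, 1, p2) + q3 * Xu ?b)) +
      D P2 ?j ((0, 1, p2), (q2, q3), 0) * (Xx ?b + p2 * Xu ?b) =
      D Ux ?b (0, 1, p2) + (p2 * D Uu ?b (0, 1, p2) + q3 * Uu ?b)"
    by (auto dest!: fun_cong[where x = "((0, 1, p2), (q2, q3), 0)"])
  moreover have "D P2 ?j ((0, 1, p2), (q2, q3), 0) = Q3 ?j * (Xx ?b + p2 * Xu ?b)"
    using contact_relations(3)[OF j, of 0 1] fibration_D_T[OF fib b, of 0 1 p2]
      D_linear[OF smooth_components(2) b, of 0 1 p2] by simp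
  ultimately show ?thesis by algebra
qed

text \<open>Multiplied by \<open>Xx + p2 * Xu\<close>, this factor is the Jacobian of
  \<open>(X, U)\<close> in \<open>(x, u)\<close>; if it vanished, \<open>(0, - Xu, Xx)\<close> would
  be in the kernel of the derivative of \<open>\<phi>\<close>. It is the factor with which
  \<open>u_t\<close> enters \<open>P1 * Tt\<close> and \<open>u_xx\<close> enters the formula for
  \<open>Q3\<close>.\<close>

lemma fibration_G_nonzero:
  assumes fibration and j: "((t, x, u), (p1, p2), q) \<in> S"
  shows "Uu (t, x, u) - P2 ((t, x, u), (p1, p2), q) * Xu (t, x, u) \<noteq> 0"
proof
  let ?b = "(t, x, u)" let ?P = "P2 (?b, (p1, p2), q)"
  have b: "?b \<in> B" using j by (rule S_imp_B)
  assume "Uu ?b - ?P * Xu ?b = 0"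
  then have "Uu ?b * Xx ?b - Ux ?b * Xu ?b = 0"
    using fibration_P(1)[OF assms] by algebra
  then have "D \<phi> ?b (0, - Xu ?b, Xx ?b) = 0"
    unfolding D_\<phi>[OF b] using D_linear[OF smooth_components(1) b, of 0 "- Xu ?b" "Xx ?b"]
      D_linear[OF smooth_components(2) b, of 0 "- Xu ?b" "Xx ?b"]
      D_linear[OF smooth_components(3) b, of 0 "- Xu ?b" "Xx ?b"] assms(1) b
    by (simp add: zero_prod_def fibration_def algebra_simps)
  from D_\<phi>_inj[OF b this] show False using fibration_nondegenerate(2)[OF assms] by (simp add: zero_prod_def)
qed

text \<open>Moving \<open>(u_t, u_xx)\<close> along \<open>(a, 1)\<close> stays on the equation and
  changes neither \<open>P2\<close> nor the new elements. The new equation thus ties the increment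
  of \<open>P1\<close> to that of \<open>Q3\<close>; both carry the same nonzero factor
  \<open>G\<close>, which cancels.\<close>

lemma Kolmogorov_A:
  assumes m: "maps_equations_to_equations \<Omega> \<Phi>"
    and z: "(((t, x, u), (p1, p2), (q1, q2, q3)), (a, b)) \<in> \<Omega>" and k: "p1 = a * q3 + b * p2"
  shows "fst (snd (\<Phi> (((t, x, u), (p1, p2), (q1, q2, q3)), (a, b)))) * Tt (t, x, u) =
    a * (Xx (t, x, u) + p2 * Xu (t, x, u))\<^sup>2"
proof -
  have fib: fibration using m by (rule maps_imp_fibration)
  let ?b = "(t, x, u)" let ?j = "(?b, (p1, p2), (q1, q2, q3))"
  let ?v = "(0, (a, 0), (0, 0, 1))"
  obtain e where e: "e > 0" "\<forall>s. \<bar>s\<bar> < e \<longrightarrow> (?j + s *\<^sub>R ?v, (a, b)) \<in> \<Omega> \<and>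
    snd (\<Phi> (?j + s *\<^sub>R ?v, (a, b))) = snd (\<Phi> (?j, (a, b)))"
    using vary_jet[OF m z, of ?v] by (auto simp: zero_prod_def)
  define d where "d = e / 2"
  let ?j' = "(?b, (p1 + d * a, p2), (q1, q2, q3 + d))"
  have d: "\<bar>d\<bar> < e" "d \<noteq> 0" using e(1) by (auto simp: d_def)
  have "?j + d *\<^sub>R ?v = ?j'" by (simp add: zero_prod_def)
  then have z': "(?j', (a, b)) \<in> \<Omega>" and s: "snd (\<Phi> (?j', (a, b))) = snd (\<Phi> (?j, (a, b)))"
    using e(2)[rule_format, OF d(1)] by simp_all
  have S: "?j \<in> S" "?j' \<in> S" using z z' in_domain_imp by blast+
  obtain A' B' where AB: "snd (\<Phi> (?j, (a, b))) = (A', B')" by fastforce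
  have K: "P1 ?j = A' * Q3 ?j + B' * P2 ?j"
    using transformed_equation(2)[OF m z] k AB \<psi>_eq[OF S(1)] by (simp add: \<phi>_eq)
  have k': "p1 + d * a = a * (q3 + d) + b * p2" using k by (simp add: algebra_simps)
  have K': "P1 ?j' = A' * Q3 ?j' + B' * P2 ?j'"
    using transformed_equation(2)[OF m z'] k' AB s \<psi>_eq[OF S(2)] by (simp add: \<phi>_eq)
  define \<xi> where "\<xi> = Xx ?b + p2 * Xu ?b"
  define G where "G = Uu ?b - P2 ?j * Xu ?b"
  have \<xi>: "\<xi> \<noteq> 0" and Tt: "Tt ?b \<noteq> 0" using fibration_nondegenerate[OF fib S(1)] by (simp_all add: \<xi>_def)
  have G: "G \<noteq> 0" using fibration_G_nonzero[OF fib S(1)] by (simp add: G_def)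
  have "P2 ?j' * \<xi> = P2 ?j * \<xi>"
    using fibration_P(1)[OF fib S(1)] fibration_P(1)[OF fib S(2)] by (simp add: \<xi>_def)
  then have P2: "P2 ?j' = P2 ?j" using \<xi> by simp
  have 1: "(P1 ?j' - P1 ?j) * Tt ?b = d * a * G"
    using fibration_P(2)[OF fib S(1)] fibration_P(2)[OF fib S(2)] unfolding P2 G_def
    by (simp add: algebra_simps)
  have 2: "(Q3 ?j' - Q3 ?j) * \<xi>\<^sup>2 = d * G"
    using fibration_Q3[OF fib S(1)] fibration_Q3[OF fib S(2)] unfolding P2 G_def \<xi>_def[symmetric]
    by (simp add: algebra_simps)
  have 3: "P1 ?j' - P1 ?j = A' * (Q3 ?j' - Q3 ?j)" using K K' unfolding P2 by (simp add: algebra_simps)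
  have "A' * Tt ?b * (d * G) = a * \<xi>\<^sup>2 * (d * G)"
    using 1 2 3 by algebra
  then show ?thesis using d(2) G AB by (simp add: \<xi>_def)
qed

definition projectable :: bool where
  "projectable \<longleftrightarrow> fibration \<and> (\<forall>b\<in>B. Xu b = 0)"

text \<open>As \<open>u_x\<close> varies along the equation, the new \<open>A\<close> stays fixed.
  So \<open>a * (Xx + s * Xu)\<^sup>2\<close> is constant in \<open>s\<close>, and its leading
  coefficient \<open>a * (Xu)\<^sup>2\<close> must vanish.\<close>

lemma maps_imp_projectable:
  assumes m: "maps_equations_to_equations \<Omega> \<Phi>"
  shows projectable
  unfolding projectable_def
proof (intro conjI ballI)
  show fib: fibration using m by (rule maps_imp_fibration)
  fix b0 assume b0: "b0 \<in> B"
  obtain t x u where e: "b0 = (t, x, u)" by (cases b0)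
  obtain p1 p2 q1 q2 q3 a b where z: "(((t, x, u), (p1, p2), (q1, q2, q3)), (a, b)) \<in> \<Omega>"
    "p1 = a * q3 + b * p2" "a \<noteq> 0" using B_representative[OF m] b0 unfolding e by metis
  obtain d where d: "d > 0" "\<And>s. \<bar>s - p2\<bar> < d \<Longrightarrow>
    (((t, x, u), (a * q3 + b * s, s), (q1, q2, q3)), (a, b)) \<in> \<Omega> \<and>
    snd (\<Phi> (((t, x, u), (a * q3 + b * s, s), (q1, q2, q3)), (a, b))) =
    snd (\<Phi> (((t, x, u), (p1, p2), (q1, q2, q3)), (a, b)))"
    using vary_p2[OF m z(1,2)] by blast
  let ?c = "fst (snd (\<Phi> (((t, x, u), (p1, p2), (q1, q2, q3)), (a, b)))) * Tt b0"
  have "(a * (Xx b0)\<^sup>2 - ?c) + (2 * a * Xx b0 * Xu b0) * s + (a * (Xu b0)\<^sup>2) * s\<^sup>2 = 0" if "\<bar>s - p2\<bar> < d" for s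
  proof -
    have "?c = a * (Xx b0 + s * Xu b0)\<^sup>2"
      using Kolmogorov_A[OF m conjunct1[OF d(2)[OF that]] refl] d(2)[OF that] unfolding e by simp
    then show ?thesis by (simp add: power2_eq_square algebra_simps)
  qed
  from quadratic_coefficients_zero[OF d(1) this] show "Xu b0 = 0" using z(3) by simp
qed

lemma D_zero_of_constant:
  assumes "\<And>b. b \<in> B \<Longrightarrow> F b = (c::real)" "b \<in> B"
  shows "D F b v = 0"
  using D_cong_open[OF open_B assms(2), of F "\<lambda>_. c"] assms(1) by (simp add: frechet_derivative_const)

lemma D_commute: "smooth_on B (F :: base \<Rightarrow> real) \<Longrightarrow> b \<in> B \<Longrightarrow> D (\<lambda>b. D F b v) b w = D (\<lambda>b. D F b w) b v"
  by (rule smooth_on_second_derivative_symmetric[OF open_B])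

lemma projectable_Xx: "projectable \<Longrightarrow> b \<in> B \<Longrightarrow> Tt b \<noteq> 0 \<and> Xx b \<noteq> 0"
proof -
  assume p: projectable and b: "b \<in> B"
  obtain t x u where e: "b = (t, x, u)" by (cases b)
  obtain p1 p2 q where "((t, x, u), (p1, p2), q) \<in> S" using b unfolding B_eq e by fastforce
  from fibration_nondegenerate[OF _ this] show ?thesis using p b by (simp add: projectable_def e)
qed

text \<open>\<open>X_xu = X_ux\<close>, and \<open>X_u\<close> vanishes identically.\<close>

lemma projectable_D_Xx:
  assumes projectable "b \<in> B" shows "D Xx b (0, dx, du) = dx * Xxx b"
proof -
  have "D Xx b (0, 0, 1) = D Xu b (0, 1, 0)" using D_commute[OF smooth_components(2) assms(2)] .
  also have "\<dots> = 0" by (rule D_zero_of_constant[where c = 0]) (use assms in \<open>auto simp: projectable_def\<close>)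
  finally show ?thesis using D_linear[OF smooth_partials(2) assms(2), of "(0, 1, 0)" 0 dx du] by simp
qed

section \<open>Splitting the transformed equation with respect to \<open>u_x\<close>\<close>

text \<open>This is the new equation after insertion of the prolongation formulas. \<open>M\<close>
  collects everything that multiplies \<open>P2\<close>; it depends on the jet only through the base
  point and the new \<open>B\<close>, so it stays fixed while \<open>u_x\<close> varies along the
  equation.\<close>

lemma Kolmogorov_polynomial:
  assumes m: "maps_equations_to_equations \<Omega> \<Phi>"
    and z: "(((t, x, u), (p1, p2), (q1, q2, q3)), (a, b)) \<in> \<Omega>" and k: "p1 = a * q3 + b * p2"
    and b0: "b0 = (t, x, u)"
    and M: "M = Xt b0 - a * Xxx b0 + snd (snd (\<Phi> (((t, x, u), (p1, p2), (q1, q2, q3)), (a, b)))) * Tt b0"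
  shows "(M * Ux b0 + a * Xx b0 * D Ux b0 (0, 1, 0) - Xx b0 * Ut b0) +
    (M * Uu b0 + a * Xx b0 * (D Ux b0 (0, 0, 1) + D Uu b0 (0, 1, 0)) - Xx b0 * b * Uu b0) * p2 +
    (a * Xx b0 * D Uu b0 (0, 0, 1)) * p2\<^sup>2 = 0"
proof -
  have pr: projectable and fib: fibration using maps_imp_projectable[OF m] by (simp_all add: projectable_def)
  let ?j = "((t, x, u), (p1, p2), (q1, q2, q3))"
  have S: "?j \<in> S" and B: "b0 \<in> B" using z in_domain_imp b0 by blast+
  obtain A' B' where AB: "snd (\<Phi> (?j, (a, b))) = (A', B')" by fastforce
  have K: "P1 ?j = A' * Q3 ?j + B' * P2 ?j"
    using transformed_equation(2)[OF m z] k AB \<psi>_eq[OF S] by (simp add: \<phi>_eq)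
  have Xu: "Xu b0 = 0" and n: "Tt b0 \<noteq> 0" "Xx b0 \<noteq> 0"
    using pr B projectable_Xx[OF pr B] by (auto simp: projectable_def)
  have A: "A' * Tt b0 = a * (Xx b0)\<^sup>2" using Kolmogorov_A[OF m z k] AB Xu b0 by simp
  have P2: "P2 ?j * Xx b0 = Ux b0 + p2 * Uu b0"
    and P1: "P1 ?j * Tt b0 = Ut b0 + p1 * Uu b0 - P2 ?j * Xt b0"
    using fibration_P[OF fib S] Xu b0 by simp_all
  have DXu: "D Xu b0 (0, 1, p2) = 0"
    by (rule D_zero_of_constant[OF _ B, where c = 0]) (use pr in \<open>auto simp: projectable_def\<close>)
  have Q3: "Q3 ?j * (Xx b0)\<^sup>2 = (D Ux b0 (0, 1, 0) + p2 * D Ux b0 (0, 0, 1)) +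
      p2 * (D Uu b0 (0, 1, 0) + p2 * D Uu b0 (0, 0, 1)) - P2 ?j * Xxx b0 + q3 * Uu b0"
    using fibration_Q3[OF fib S] DXu projectable_D_Xx[OF pr B, of 1 p2] Xu
      D_linear[OF smooth_partials(3) B, of _ 0 1 p2] unfolding b0 by simp
  have M: "M = Xt b0 - a * Xxx b0 + B' * Tt b0" using M AB by simp
  \<comment> \<open>The formula for \<open>A\<close> turns the coefficient of \<open>Q3\<close> into
    \<open>a * (Xx b0)\<^sup>2\<close>, the multiple for which \<open>Q3\<close> is known.\<close>
  have "P1 ?j * Tt b0 = a * ((Xx b0)\<^sup>2 * Q3 ?j) + B' * Tt b0 * P2 ?j" using K A by algebra
  then have "Ut b0 + p1 * Uu b0 = a * ((D Ux b0 (0, 1, 0) + p2 * D Ux b0 (0, 0, 1)) +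
      p2 * (D Uu b0 (0, 1, 0) + p2 * D Uu b0 (0, 0, 1)) + q3 * Uu b0) + M * P2 ?j"
    using P1 Q3 M by algebra
  \<comment> \<open>Substituting \<open>u_t\<close> from the old equation cancels the terms with
    \<open>u_xx\<close>; the factor \<open>Xx\<close> clears the denominator of
    \<open>P2\<close>.\<close>
  then have "Xx b0 * (Ut b0 + b * p2 * Uu b0) = a * Xx b0 * ((D Ux b0 (0, 1, 0) + p2 * D Ux b0 (0, 0, 1)) +
      p2 * (D Uu b0 (0, 1, 0) + p2 * D Uu b0 (0, 0, 1))) + M * (Ux b0 + p2 * Uu b0)"
    using P2 k by algebra
  then show ?thesis by (simp add: power2_eq_square algebra_simps)
qed

text \<open>The jet in the hypothesis need not satisfy the equation: the new elements are moved to a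
  representative that does, where \<open>u_x\<close> runs through an interval.\<close>

lemma Kolmogorov_coefficients:
  assumes m: "maps_equations_to_equations \<Omega> \<Phi>"
    and z: "((b0, r), (a, b)) \<in> \<Omega>"
    and M: "M = Xt b0 - a * Xxx b0 + snd (snd (\<Phi> ((b0, r), (a, b)))) * Tt b0"
  shows "M * Ux b0 + a * Xx b0 * D Ux b0 (0, 1, 0) = Xx b0 * Ut b0"
    "M * Uu b0 + a * Xx b0 * (D Ux b0 (0, 0, 1) + D Uu b0 (0, 1, 0)) = Xx b0 * b * Uu b0"
    "D Uu b0 (0, 0, 1) = 0"
    "fst (snd (\<Phi> ((b0, r), (a, b)))) * Tt b0 = a * (Xx b0)\<^sup>2"
proof -
  obtain t x u where e: "b0 = (t, x, u)" by (cases b0)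
  obtain j where j: "fst j = b0" "(j, (a, b)) \<in> \<Omega>" "kolmogorov (a, b) j"
    "snd (\<Phi> (j, (a, b))) = snd (\<Phi> ((b0, r), (a, b)))"
    by (rule Kolmogorov_representative[OF m z]) simp
  obtain p1 p2 q1 q2 q3 where je: "j = ((t, x, u), (p1, p2), (q1, q2, q3))"
    using j(1) unfolding e by (metis prod.collapse)
  have z: "(((t, x, u), (p1, p2), (q1, q2, q3)), (a, b)) \<in> \<Omega>" "p1 = a * q3 + b * p2"
    using j(2,3) unfolding je by simp_all
  have a: "a \<noteq> 0" using admissible z(1) unfolding admissible_domain_def by (auto simp: elements_of_def)
  obtain d where d: "d > 0" "\<And>s. \<bar>s - p2\<bar> < d \<Longrightarrow>
    (((t, x, u), (a * q3 + b * s, s), (q1, q2, q3)), (a, b)) \<in> \<Omega> \<and>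
    snd (\<Phi> (((t, x, u), (a * q3 + b * s, s), (q1, q2, q3)), (a, b))) =
    snd (\<Phi> (((t, x, u), (p1, p2), (q1, q2, q3)), (a, b)))"
    using vary_p2[OF m z] by blast
  have "(M * Ux b0 + a * Xx b0 * D Ux b0 (0, 1, 0) - Xx b0 * Ut b0) +
    (M * Uu b0 + a * Xx b0 * (D Ux b0 (0, 0, 1) + D Uu b0 (0, 1, 0)) - Xx b0 * b * Uu b0) * s +
    (a * Xx b0 * D Uu b0 (0, 0, 1)) * s\<^sup>2 = 0" if "\<bar>s - p2\<bar> < d" for s
    by (rule Kolmogorov_polynomial[OF m conjunct1[OF d(2)[OF that]] refl e])
      (use M j(4) d(2)[OF that] je in simp)
  note c = quadratic_coefficients_zero[OF d(1) this]
  have B: "b0 \<in> B" and pr: projectable using z(1) in_domain_imp e maps_imp_projectable[OF m] by blast+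
  show "M * Ux b0 + a * Xx b0 * D Ux b0 (0, 1, 0) = Xx b0 * Ut b0"
    "M * Uu b0 + a * Xx b0 * (D Ux b0 (0, 0, 1) + D Uu b0 (0, 1, 0)) = Xx b0 * b * Uu b0"
    using c by simp_all
  show "D Uu b0 (0, 0, 1) = 0" using c a projectable_Xx[OF pr B] by simp
  show "fst (snd (\<Phi> ((b0, r), (a, b)))) * Tt b0 = a * (Xx b0)\<^sup>2"
    using Kolmogorov_A[OF m z] pr B e j(4) je by (simp add: projectable_def)
qed

text \<open>The differential form of \<open>U = U1 * u + U0\<close> with locally constant
  \<open>U1\<close> and \<open>U0\<close>.\<close>

definition affine_fibres :: bool where
  "affine_fibres \<longleftrightarrow> projectable \<and>
    (\<forall>b\<in>B. Ut b = 0 \<and> Ux b = 0 \<and> Uu b \<noteq> 0 \<and> (\<forall>v. D Uu b v = 0))"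

text \<open>The derivatives are taken of the components on the base space, at the base point itself,
  so no global functions of \<open>t\<close> and \<open>(t, x)\<close> are presupposed.\<close>

definition transforms_elements :: bool where
  "transforms_elements \<longleftrightarrow> (\<forall>b0 r a b. ((b0, r), (a, b)) \<in> \<Omega> \<longrightarrow> snd (\<Phi> ((b0, r), (a, b))) =
    ((Xx b0)\<^sup>2 / Tt b0 * a, Xx b0 / Tt b0 * b - (Xt b0 - Xxx b0 * a) / Tt b0))"

text \<open>Two values \<open>b\<close>, \<open>b'\<close> over the same jet, with the same
  \<open>a\<close>, are compared. The coefficients of \<open>u_x\<close> give
  \<open>M' - M = Xx * (b' - b)\<close>, which is nonzero; the coefficients free of
  \<open>u_x\<close> give \<open>(M' - M) * Ux = 0\<close>.\<close>

lemma maps_imp_Ux_zero: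
  assumes m: "maps_equations_to_equations \<Omega> \<Phi>" and B: "b0 \<in> B"
  shows "Ux b0 = 0" "Uu b0 \<noteq> 0"
proof -
  have pr: projectable using maps_imp_projectable[OF m] .
  note n = projectable_Xx[OF pr B]
  obtain t x u where e: "b0 = (t, x, u)" by (cases b0)
  obtain p1 p2 q1 q2 q3 a b where z: "((b0, (p1, p2), (q1, q2, q3)), (a, b)) \<in> \<Omega>"
    using B_representative[OF m] B unfolding e by metis
  let ?r = "((p1, p2), (q1, q2, q3))"
  have Xu: "Xu b0 = 0" using pr B by (simp add: projectable_def)
  show Uu: "Uu b0 \<noteq> 0"
    using fibration_G_nonzero[of t x u p1 p2 "(q1, q2, q3)"] pr in_domain_imp[OF z] Xu e
    by (simp add: projectable_def)
  obtain d where d: "d > 0" "\<forall>s. \<bar>s\<bar> < d \<longrightarrow> ((b0, ?r), (a, b)) + s *\<^sub>R (0, (0, 1)) \<in> \<Omega>"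
    using open_line[OF open_domain z] by blast
  define b' where "b' = b + d / 2"
  have "((b0, ?r), (a, b)) + (d / 2) *\<^sub>R (0, (0, 1)) = ((b0, ?r), (a, b'))"
    by (simp add: b'_def)
  then have z': "((b0, ?r), (a, b')) \<in> \<Omega>" using d(1) d(2)[rule_format, of "d / 2"] by simp
  obtain M where M: "M * Ux b0 + a * Xx b0 * D Ux b0 (0, 1, 0) = Xx b0 * Ut b0"
    "M * Uu b0 + a * Xx b0 * (D Ux b0 (0, 0, 1) + D Uu b0 (0, 1, 0)) = Xx b0 * b * Uu b0"
    using Kolmogorov_coefficients(1,2)[OF m z refl] by blast
  obtain M' where M': "M' * Ux b0 + a * Xx b0 * D Ux b0 (0, 1, 0) = Xx b0 * Ut b0"
    "M' * Uu b0 + a * Xx b0 * (D Ux b0 (0, 0, 1) + D Uu b0 (0, 1, 0)) = Xx b0 * b' * Uu b0"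
    using Kolmogorov_coefficients(1,2)[OF m z' refl] by blast
  have "(M' - M) * Uu b0 = Xx b0 * (b' - b) * Uu b0" using M(2) M'(2) by (simp add: algebra_simps)
  then have "M' - M = Xx b0 * (b' - b)" using Uu by simp
  then have "M' - M \<noteq> 0" using n d(1) by (simp only: b'_def) simp
  moreover have "(M' - M) * Ux b0 = 0" using M(1) M'(1) by algebra
  ultimately show "Ux b0 = 0" by simp
qed

text \<open>Once \<open>U_x\<close> vanishes identically, the first coefficient gives
  \<open>U_t = 0\<close>. Symmetry of second derivatives makes \<open>U_ux\<close> and
  \<open>U_ut\<close> vanish, and dividing the second coefficient by \<open>U_u\<close> leaves the
  formula for the new \<open>B\<close>.\<close>

lemma maps_imp_normal_form:
  assumes m: "maps_equations_to_equations \<Omega> \<Phi>"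
  shows affine_fibres transforms_elements
proof -
  have pr: projectable using maps_imp_projectable[OF m] .
  have DUx: "D Ux b0 v = 0" if "b0 \<in> B" for b0 v
    by (rule D_zero_of_constant[where c = 0]) (use maps_imp_Ux_zero(1)[OF m] that in auto)
  have DUu: "D Uu b0 (0, 1, 0) = 0" if "b0 \<in> B" for b0
    using D_commute[OF smooth_components(3) that] DUx[OF that] by metis
  have Ut: "Ut b0 = 0 \<and> D Uu b0 (0, 0, 1) = 0" if B: "b0 \<in> B" for b0
  proof -
    obtain t x u where e: "b0 = (t, x, u)" by (cases b0)
    obtain p1 p2 q1 q2 q3 a b where z: "((b0, (p1, p2), (q1, q2, q3)), (a, b)) \<in> \<Omega>"
      using B_representative[OF m B[unfolded e]] unfolding e by metis
    show ?thesis using Kolmogorov_coefficients(1,3)[OF m z refl] DUx[OF B] maps_imp_Ux_zero(1)[OF m B]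
        projectable_Xx[OF pr that] by simp
  qed
  have DUt: "D Ut b0 v = 0" if "b0 \<in> B" for b0 v
    by (rule D_zero_of_constant[where c = 0]) (use Ut that in auto)
  have "D Uu b0 (1, 0, 0) = 0" if "b0 \<in> B" for b0
    using D_commute[OF smooth_components(3) that] DUt[OF that] by metis
  then have "D Uu b0 v = 0" if "b0 \<in> B" for b0 v
    using D_linear[OF smooth_partials(3) that] DUu[OF that] Ut[OF that] that
    by (cases v) (metis add_0 mult_zero_right)
  then show affine_fibres unfolding affine_fibres_def using pr Ut maps_imp_Ux_zero[OF m] by blast
  show transforms_elements unfolding transforms_elements_def
  proof (intro allI impI)
    fix b0 r a b assume z: "((b0, r), (a, b)) \<in> \<Omega>"
    have B: "b0 \<in> B" using in_domain_imp[OF z] by simp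
    note n = projectable_Xx[OF pr B]
    obtain A' B' where AB: "snd (\<Phi> ((b0, r), (a, b))) = (A', B')" by fastforce
    have "(Xt b0 - a * Xxx b0 + B' * Tt b0) * Uu b0 = Xx b0 * b * Uu b0"
      using Kolmogorov_coefficients(2)[OF m z refl] DUx[OF B] DUu[OF B] AB by simp
    then have "Xt b0 - a * Xxx b0 + B' * Tt b0 = Xx b0 * b" using maps_imp_Ux_zero(2)[OF m B] by simp
    moreover have "A' * Tt b0 = a * (Xx b0)\<^sup>2" using Kolmogorov_coefficients(4)[OF m z refl] AB by simp
    ultimately show "snd (\<Phi> ((b0, r), (a, b))) =
        ((Xx b0)\<^sup>2 / Tt b0 * a, Xx b0 / Tt b0 * b - (Xt b0 - Xxx b0 * a) / Tt b0)"
      using n unfolding AB by (simp add: field_simps)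
  qed
qed

end

subsection \<open>Normal form on convex pieces\<close>

lemma deriv_along:
  fixes f :: "'a::euclidean_space \<Rightarrow> real"
  assumes "(c has_derivative (\<lambda>s. s *\<^sub>R v)) (at t)" "(f has_derivative f') (at (c t))"
  shows "((\<lambda>s. f (c s)) has_real_derivative f' v) (at t)"
proof -
  have "linear f'" using assms(2) by (rule has_derivative_linear)
  then have "f' (s *\<^sub>R v) = f' v * s" for s by (simp add: linear_cmul mult.commute)
  then show ?thesis
    using diff_chain_at[OF assms] by (simp add: o_def has_field_derivative_def)
qed

lemma deriv_cong_open:
  assumes "open N" "t \<in> N" "\<And>s. s \<in> N \<Longrightarrow> f s = g s" "(g has_real_derivative g') (at t)"
  shows "deriv f t = g'"
proof -
  have "(f has_real_derivative g') (at t)"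
    by (rule has_field_derivative_transform_within_open[OF assms(4,1,2)]) (simp add: assms(3))
  then show ?thesis by (rule DERIV_imp_deriv)
qed

lemma mean_value_segment:
  fixes F :: "'a::euclidean_space \<Rightarrow> real"
  assumes "convex C" "C \<subseteq> S" "smooth_on S F" "b1 \<in> C" "b2 \<in> C"
  shows "\<exists>b\<in>C. F b2 - F b1 = D F b (b2 - b1)"
proof -
  have C: "b1 + s *\<^sub>R (b2 - b1) \<in> C" if "0 \<le> s" "s \<le> 1" for s
  proof -
    have "b1 + s *\<^sub>R (b2 - b1) = (1 - s) *\<^sub>R b1 + s *\<^sub>R b2" by (simp add: algebra_simps)
    then show ?thesis using assms(1,4,5) that convexD[of C b1 b2 "1 - s" s] by simp
  qed
  have "((\<lambda>s. F (b1 + s *\<^sub>R (b2 - b1))) has_real_derivative D F (b1 + s *\<^sub>R (b2 - b1)) (b2 - b1)) (at s)"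
    if "0 \<le> s" "s \<le> 1" for s
    by (rule deriv_along[OF _ smooth_on_has_derivative[OF assms(3)]])
      (use C[OF that] assms(2) in \<open>auto intro!: derivative_eq_intros\<close>)
  then have "\<exists>s. 0 < s \<and> s < 1 \<and> F (b1 + 1 *\<^sub>R (b2 - b1)) - F (b1 + 0 *\<^sub>R (b2 - b1)) =
      (1 - 0) * D F (b1 + s *\<^sub>R (b2 - b1)) (b2 - b1)"
    by (intro MVT2[of 0 1 "\<lambda>s. F (b1 + s *\<^sub>R (b2 - b1))"]) auto
  then obtain s where "0 < s" "s < 1" "F (b1 + 1 *\<^sub>R (b2 - b1)) - F (b1 + 0 *\<^sub>R (b2 - b1)) =
      (1 - 0) * D F (b1 + s *\<^sub>R (b2 - b1)) (b2 - b1)"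
    by blast
  then show ?thesis using C[of s] by (intro bexI[of _ "b1 + s *\<^sub>R (b2 - b1)"]) simp_all
qed

lemma constant_segment:
  fixes F :: "'a::euclidean_space \<Rightarrow> real"
  assumes "convex C" "C \<subseteq> S" "smooth_on S F" "b1 \<in> C" "b2 \<in> C" "\<And>b. b \<in> C \<Longrightarrow> D F b (b2 - b1) = 0"
  shows "F b2 = F b1"
  using mean_value_segment[OF assms(1-5)] assms(6) by auto

lemma D_zero_of_constant_along:
  fixes F :: "'a::euclidean_space \<Rightarrow> real"
  assumes "open C" "b \<in> C" "F differentiable (at b)" "\<And>s. b + s *\<^sub>R v \<in> C \<Longrightarrow> F (b + s *\<^sub>R v) = F b"
  shows "D F b v = 0"
proof -
  let ?N = "(\<lambda>s::real. b + s *\<^sub>R v) -` C"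
  have N: "open ?N" "0 \<in> ?N" using assms(1,2) by (auto intro!: open_vimage continuous_intros)
  have "((\<lambda>s. F (b + s *\<^sub>R v)) has_real_derivative D F b v) (at 0)"
    by (rule deriv_along[where c = "\<lambda>s. b + s *\<^sub>R v" and f = F])
      (use assms(3) in \<open>auto intro!: derivative_eq_intros simp: frechet_derivative_works\<close>)
  moreover have "deriv (\<lambda>s. F (b + s *\<^sub>R v)) 0 = 0"
    by (rule deriv_cong_open[OF N, where g = "\<lambda>_. F b"]) (use assms(4) in auto)
  ultimately show ?thesis using DERIV_imp_deriv by fastforce
qed

lemma smooth_on_empty: "smooth_on {} f"
  by (rule smooth_on_local) simp

lemma has_form_onD:
  assumes "has_form_on Q \<Phi> T X U1 U0" "(((t, x, u), p, q), (a, b)) \<in> Q"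
  shows "base_of (\<Phi> (((t, x, u), p, q), (a, b))) = (T t, X (t, x), U1 * u + U0)"
    "snd (\<Phi> (((t, x, u), p, q), (a, b))) = ((partial_x X (t, x))\<^sup>2 / deriv T t * a,
      partial_x X (t, x) / deriv T t * b - (partial_t X (t, x) - partial_x (partial_x X) (t, x) * a) / deriv T t)"
  using assms unfolding has_form_on_def Let_def elements_of_def by blast+

context jet_transformation begin

text \<open>Slices of \<open>C\<close> parallel to the axes are open, so one-variable derivatives
  see only the agreement on \<open>C\<close>. The second \<open>x\<close>-derivative needs the
  formula for the first along a whole slice.\<close>

lemma parameters_partials:
  assumes C: "open C" "C \<subseteq> B" and b: "(t, x, u) \<in> C"
    and T': "\<And>t x u. (t, x, u) \<in> C \<Longrightarrow> T' t = T (t, x, u)"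
    and X': "\<And>t x u. (t, x, u) \<in> C \<Longrightarrow> X' (t, x) = X (t, x, u)"
  shows "deriv T' t = Tt (t, x, u)" "partial_t X' (t, x) = Xt (t, x, u)" "partial_x X' (t, x) = Xx (t, x, u)"
    "partial_x (partial_x X') (t, x) = Xxx (t, x, u)"
proof -
  have N: "open ((\<lambda>s. (s, x, u)) -` C)" "t \<in> (\<lambda>s. (s, x, u)) -` C"
    using b by (auto intro!: open_vimage C continuous_intros)
  have M: "open ((\<lambda>y. (t, y, u)) -` C)" "x \<in> (\<lambda>y. (t, y, u)) -` C"
    using b by (auto intro!: open_vimage C continuous_intros)
  have c1: "((\<lambda>s. (s, x, u)) has_derivative (\<lambda>s. s *\<^sub>R (1, 0, 0))) (at t)"
    and c2: "((\<lambda>y. (t, y, u)) has_derivative (\<lambda>s. s *\<^sub>R (0, 1, 0))) (at y)" for y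
    by (auto intro!: derivative_eq_intros simp: zero_prod_def)
  have d: "(F has_derivative D F b) (at b)" if "smooth_on B F" "b \<in> C" for F :: "base \<Rightarrow> real" and b
    using smooth_on_has_derivative that C(2) by blast
  show "deriv T' t = Tt (t, x, u)"
    by (rule deriv_cong_open[OF N _ deriv_along[OF c1 d[OF smooth_components(1)]]]) (use T' b in auto)
  show "partial_t X' (t, x) = Xt (t, x, u)" unfolding partial_t_def prod.case
    by (rule deriv_cong_open[OF N _ deriv_along[OF c1 d[OF smooth_components(2)]]]) (use X' b in auto)
  have x: "partial_x X' (t, y) = Xx (t, y, u)" if "(t, y, u) \<in> C" for y
  proof -
    have "deriv (\<lambda>y. X' (t, y)) y = D X (t, y, u) (0, 1, 0)"
      by (rule deriv_cong_open[OF M(1) _ _ deriv_along[OF c2 d[OF smooth_components(2)]]]) (use X' that in auto)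
    then show ?thesis by (simp add: partial_x_def)
  qed
  then show "partial_x X' (t, x) = Xx (t, x, u)" using b by blast
  have "deriv (\<lambda>y. partial_x X' (t, y)) x = D (\<lambda>b. Xx b) (t, x, u) (0, 1, 0)"
    by (rule deriv_cong_open[OF M _ deriv_along[OF c2 d[OF smooth_partials(2)]]]) (use x b in auto)
  then show "partial_x (partial_x X') (t, x) = Xxx (t, x, u)" by (simp add: partial_x_def[of "partial_x X'"])
qed

lemma projectable_D:
  assumes projectable "b \<in> B"
  shows "D T b v = fst v * Tt b" "D X b v = fst v * Xt b + fst (snd v) * Xx b"
  using fibration_D_T[of b "fst v" "fst (snd v)" "snd (snd v)"] assms
    D_linear[OF smooth_components(2) assms(2), of "fst v" "fst (snd v)" "snd (snd v)"]
  by (simp_all add: projectable_def)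

lemma affine_fibresD:
  assumes affine_fibres "b \<in> B"
  shows "Ut b = 0" "Ux b = 0" "Uu b \<noteq> 0" "D Uu b v = 0"
  using assms unfolding affine_fibres_def by blast+

lemma transforms_elementsD:
  assumes transforms_elements "((b0, r), (a, b)) \<in> \<Omega>"
  shows "snd (\<Phi> ((b0, r), (a, b))) =
    ((Xx b0)\<^sup>2 / Tt b0 * a, Xx b0 / Tt b0 * b - (Xt b0 - Xxx b0 * a) / Tt b0)"
  using assms unfolding transforms_elements_def by blast

lemma B_obtains:
  assumes "b0 \<in> B" obtains r a b where "((b0, r), (a, b)) \<in> \<Omega>"
proof -
  obtain z where "z \<in> \<Omega>" "b0 = fst (fst z)" using assms by (auto simp: B_def base_of_def jet_of_def)
  then show thesis using that[of "snd (fst z)" "fst (snd z)" "snd (snd z)"] by simp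
qed

text \<open>Two points of \<open>C\<close> over the same \<open>t\<close>, or over the same
  \<open>(t, x)\<close>, are joined by a segment in \<open>C\<close> along which the derivative of
  \<open>T\<close>, respectively \<open>X\<close>, vanishes.\<close>

lemma normal_form_imp_has_form:
  assumes af: affine_fibres and te: transforms_elements
    and Q: "open Q" "Q \<subseteq> \<Omega>" "convex (base_of ` Q)"
  shows "\<exists>T X U1 U0. admissible_parameters ((indep \<circ> jet_of) ` Q) T X U1 \<and> has_form_on Q \<Phi> T X U1 U0"
proof (cases "Q = {}")
  case True
  \<comment> \<open>An empty piece provides no base point at which to read off \<open>U1\<close>,
    but it requires only that \<open>U1\<close> be nonzero.\<close>
  then show ?thesis
    by (intro exI[of _ "\<lambda>_. 0"] exI[of _ 1] exI[of _ 0])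
      (auto simp: admissible_parameters_def has_form_on_def smooth_on_empty)
next
  case False
  have pr: projectable using af by (simp add: affine_fibres_def)
  define C where "C = base_of ` Q"
  have "C = fst ` (fst ` Q)" by (simp add: C_def base_of_def[abs_def] jet_of_def[abs_def] image_image)
  then have C: "open C" "convex C" "C \<subseteq> B" "C \<noteq> {}"
    using open_image_fst[OF open_image_fst[OF Q(1)]] Q False by (auto simp: C_def B_def)
  \<comment> \<open>Any point of \<open>C\<close> over \<open>t\<close> serves; the next claims show
    that the choice does not matter.\<close>
  define T' where "T' t = T (SOME b. b \<in> C \<and> fst b = t)" for t
  define X' where "X' p = X (SOME b. b \<in> C \<and> (fst b, fst (snd b)) = p)" for p
  have T': "T' t = T (t, x, u)" if tx: "(t, x, u) \<in> C" for t x u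
  proof -
    let ?b = "SOME b. b \<in> C \<and> fst b = t"
    have "?b \<in> C \<and> fst ?b = t" by (rule someI[of _ "(t, x, u)"]) (use tx in simp)
    then obtain b where b: "b \<in> C" "fst b = t" "T' t = T b" using T'_def by blast
    have "T b = T (t, x, u)"
    proof (rule constant_segment[OF C(2,3) smooth_components(1) tx b(1)])
      fix c assume "c \<in> C"
      then have "c \<in> B" using C(3) by blast
      then show "D T c (b - (t, x, u)) = 0"
        using projectable_D(1)[OF pr, of c "b - (t, x, u)"] b(2) by simp
    qed
    then show ?thesis using b by simp
  qed
  have X': "X' (t, x) = X (t, x, u)" if tx: "(t, x, u) \<in> C" for t x u
  proof -
    let ?b = "SOME b. b \<in> C \<and> (fst b, fst (snd b)) = (t, x)"
    have "?b \<in> C \<and> (fst ?b, fst (snd ?b)) = (t, x)" by (rule someI[of _ "(t, x, u)"]) (use tx in simp)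
    then obtain b where b: "b \<in> C" "fst b = t" "fst (snd b) = x" "X' (t, x) = X b" using X'_def by blast
    have "X b = X (t, x, u)"
    proof (rule constant_segment[OF C(2,3) smooth_components(2) tx b(1)])
      fix c assume "c \<in> C"
      then have "c \<in> B" using C(3) by blast
      then show "D X c (b - (t, x, u)) = 0"
        using projectable_D(2)[OF pr, of c "b - (t, x, u)"] b(2,3) by simp
    qed
    then show ?thesis using b by simp
  qed
  have parts: "deriv T' t = Tt (t, x, u)" "partial_t X' (t, x) = Xt (t, x, u)" "partial_x X' (t, x) = Xx (t, x, u)"
    "partial_x (partial_x X') (t, x) = Xxx (t, x, u)" if "(t, x, u) \<in> C" for t x u
    using parameters_partials[OF C(1,3) that, of T' X'] T' X' by blast+
  obtain c0 where c0: "c0 \<in> C" using C(4) by blast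
  define U1 where "U1 = Uu c0"
  have Uu: "Uu c = U1" if "c \<in> C" for c
    unfolding U1_def
    by (rule constant_segment[OF C(2,3) smooth_partials(3) c0 that])
      (rule affine_fibresD(4)[OF af], use C(3) in blast)
  \<comment> \<open>\<open>U - U1 * u\<close> has zero derivative on \<open>C\<close>, so its value
    at \<open>c0\<close> is the additive constant.\<close>
  define U0 where "U0 = U c0 - U1 * snd (snd c0)"
  have U: "U c = U1 * snd (snd c) + U0" if "c \<in> C" for c
  proof -
    have sm: "smooth_on B (\<lambda>b. U b - U1 * snd (snd b))"
      by (intro smooth_intros open_B smooth_components)
    have "D (\<lambda>b. U b - U1 * snd (snd b)) b v = 0" if "b \<in> C" for b v
    proof -
      have "b \<in> B" using that C by blast
      have "((\<lambda>b. U b - U1 * snd (snd b)) has_derivative (\<lambda>v. D U b v - U1 * snd (snd v))) (at b)"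
        by (intro has_derivative_diff smooth_on_has_derivative[OF smooth_components(3) \<open>b \<in> B\<close>]
          has_derivative_mult_right has_derivative_snd has_derivative_ident)
      then have "D (\<lambda>b. U b - U1 * snd (snd b)) b v = D U b v - U1 * snd (snd v)" by (simp add: D_eqI)
      moreover have "D U b v = U1 * snd (snd v)"
        using D_linear[OF smooth_components(3) \<open>b \<in> B\<close>, of "fst v" "fst (snd v)" "snd (snd v)"] af \<open>b \<in> B\<close> Uu[OF that]
        by (simp add: affine_fibres_def)
      ultimately show ?thesis by simp
    qed
    from constant_segment[OF C(2,3) sm c0 that this] show ?thesis by (simp add: U0_def)
  qed
  have W: "(indep \<circ> jet_of) ` Q = (\<lambda>b. (fst b, fst (snd b))) ` C"
    by (simp add: C_def image_image indep_def base_of_def o_def)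
  have fW: "fst ` ((indep \<circ> jet_of) ` Q) = fst ` C" unfolding W by (simp add: image_image)
  have "smooth_on (fst ` C) T'"
  proof (rule smooth_on_local)
    fix t assume "t \<in> fst ` C"
    then obtain x u where tx: "(t, x, u) \<in> C" by auto
    let ?N = "(\<lambda>s. (s, x, u)) -` C"
    have o: "open ?N" by (intro open_vimage C continuous_intros)
    have "smooth_on ?N (\<lambda>s. T (s, x, u))"
      by (rule smooth_on_compose[OF o open_B _ smooth_components(1)]) (use C(3) in \<open>auto intro!: smooth_intros o\<close>)
    then have "smooth_on ?N T'" by (rule smooth_on_cong[OF _ o]) (use T' in auto)
    then show "\<exists>V. open V \<and> t \<in> V \<and> smooth_on V T'" using o tx by blast
  qed
  moreover have "smooth_on ((indep \<circ> jet_of) ` Q) X'"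
    unfolding W
  proof (rule smooth_on_local)
    fix p assume "p \<in> (\<lambda>b. (fst b, fst (snd b))) ` C"
    then obtain t x u where tx: "(t, x, u) \<in> C" "p = (t, x)" by auto
    let ?N = "(\<lambda>p. (fst p, snd p, u)) -` C"
    have o: "open ?N" by (intro open_vimage C continuous_intros)
    have "smooth_on ?N (\<lambda>p. X (fst p, snd p, u))"
      by (rule smooth_on_compose[OF o open_B _ smooth_components(2)]) (use C(3) in \<open>auto intro!: smooth_intros o\<close>)
    then have "smooth_on ?N X'" by (rule smooth_on_cong[OF _ o]) (use X' in auto)
    then show "\<exists>V. open V \<and> p \<in> V \<and> smooth_on V X'" using o tx by auto
  qed
  moreover have "\<forall>(t, x)\<in>(indep \<circ> jet_of) ` Q. deriv T' t * partial_x X' (t, x) \<noteq> 0"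
    unfolding W
  proof (rule ballI, rule case_prodI2)
    fix p t x assume "p \<in> (\<lambda>b. (fst b, fst (snd b))) ` C" "p = (t, x)"
    then obtain c where "c \<in> C" "fst c = t" "fst (snd c) = x" by auto
    then have u: "(t, x, snd (snd c)) \<in> C" by auto
    then have "(t, x, snd (snd c)) \<in> B" using C(3) by blast
    then show "deriv T' t * partial_x X' (t, x) \<noteq> 0"
      using parts[OF u] projectable_Xx[OF pr, of "(t, x, snd (snd c))"] by simp
  qed
  moreover have "U1 \<noteq> 0" using af c0 C(3) by (auto simp: U1_def affine_fibres_def)
  ultimately have "admissible_parameters ((indep \<circ> jet_of) ` Q) T' X' U1"
    unfolding admissible_parameters_def fW by (intro conjI)
  moreover have "has_form_on Q \<Phi> T' X' U1 U0"
    unfolding has_form_on_def Let_def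
  proof (intro allI impI conjI)
    fix t x u p q a b assume z: "(((t, x, u), p, q), (a, b)) \<in> Q"
    have c: "(t, x, u) \<in> C" using z unfolding C_def by (force simp: base_of_def jet_of_def)
    have z\<Omega>: "(((t, x, u), p, q), (a, b)) \<in> \<Omega>" using z Q by blast
    show "base_of (\<Phi> (((t, x, u), p, q), (a, b))) = (T' t, X' (t, x), U1 * u + U0)"
      using base_component[OF z\<Omega>] \<phi>_eq[of "(t, x, u)"] T'[OF c] X'[OF c] U[OF c] by (simp add: base_of_def jet_of_def)
    show "elements_of (\<Phi> (((t, x, u), p, q), (a, b))) = ((partial_x X' (t, x))\<^sup>2 / deriv T' t * a,
        partial_x X' (t, x) / deriv T' t * b - (partial_t X' (t, x) - partial_x (partial_x X') (t, x) * a) / deriv T' t)"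
      unfolding elements_of_def parts[OF c] using transforms_elementsD[OF te z\<Omega>] .
  qed
  ultimately show ?thesis by blast
qed

text \<open>The hypothesis is applied to a ball around each point, whose base is convex as a linear
  image. Since the conclusions are pointwise, the parameters may differ from ball to ball.\<close>

lemma has_form_imp_normal_form:
  assumes Q: "\<And>Q. open Q \<Longrightarrow> Q \<subseteq> \<Omega> \<Longrightarrow> convex (base_of ` Q) \<Longrightarrow>
    \<exists>T X U1 U0. admissible_parameters ((indep \<circ> jet_of) ` Q) T X U1 \<and> has_form_on Q \<Phi> T X U1 U0"
  shows affine_fibres transforms_elements
proof -
  have main: "\<exists>C T' X' U1 U0. open C \<and> C \<subseteq> B \<and> b0 \<in> C \<and> U1 \<noteq> 0 \<and>
      (\<forall>t x u. (t, x, u) \<in> C \<longrightarrow> \<phi> (t, x, u) = (T' t, X' (t, x), U1 * u + U0)) \<and>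
      snd (\<Phi> ((b0, r), (a, b))) = ((partial_x X' (fst b0, fst (snd b0)))\<^sup>2 / deriv T' (fst b0) * a,
        partial_x X' (fst b0, fst (snd b0)) / deriv T' (fst b0) * b - (partial_t X' (fst b0, fst (snd b0)) -
        partial_x (partial_x X') (fst b0, fst (snd b0)) * a) / deriv T' (fst b0))"
    if z: "((b0, r), (a, b)) \<in> \<Omega>" for b0 r a b
  proof -
    obtain e where e: "e > 0" "ball ((b0, r), (a, b)) e \<subseteq> \<Omega>" using z open_domain openE by blast
    let ?Q = "ball ((b0, r), (a, b)) e"
    have l: "linear base_of"
      unfolding base_of_def[abs_def] jet_of_def[abs_def] by (rule linearI) simp_all
    obtain T' X' U1 U0 where f: "admissible_parameters ((indep \<circ> jet_of) ` ?Q) T' X' U1" "has_form_on ?Q \<Phi> T' X' U1 U0"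
      using Q[OF open_ball e(2)] convex_linear_image[OF l convex_ball] by blast
    let ?C = "base_of ` ?Q"
    have "?C = fst ` (fst ` ?Q)" by (simp add: base_of_def[abs_def] jet_of_def[abs_def] image_image)
    then have o: "open ?C" using open_image_fst[OF open_image_fst[OF open_ball]] by metis
    have "((b0, r), (a, b)) \<in> ?Q" using e by simp
    then have b0: "b0 \<in> ?C" by (rule rev_image_eqI) (simp add: base_of_def jet_of_def)
    have "\<phi> (t, x, u) = (T' t, X' (t, x), U1 * u + U0)" if tx: "(t, x, u) \<in> ?C" for t x u
    proof -
      obtain p q a b where "(((t, x, u), p, q), (a, b)) \<in> ?Q"
        using tx unfolding base_of_def jet_of_def by fastforce
      moreover from this have "(((t, x, u), p, q), (a, b)) \<in> \<Omega>" using e(2) by blast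
      ultimately show ?thesis using has_form_onD(1)[OF f(2)] base_component[of "(((t, x, u), p, q), (a, b))"]
        by (metis base_of_def jet_of_def fst_conv)
    qed
    moreover have "U1 \<noteq> 0" using f(1) by (simp add: admissible_parameters_def)
    moreover have "?C \<subseteq> B" unfolding B_def using e(2) by (rule image_mono)
    moreover have "snd (\<Phi> ((b0, r), (a, b))) = ((partial_x X' (fst b0, fst (snd b0)))\<^sup>2 / deriv T' (fst b0) * a,
        partial_x X' (fst b0, fst (snd b0)) / deriv T' (fst b0) * b - (partial_t X' (fst b0, fst (snd b0)) -
        partial_x (partial_x X') (fst b0, fst (snd b0)) * a) / deriv T' (fst b0))"
      using has_form_onD(2)[OF f(2), of "fst b0" "fst (snd b0)" "snd (snd b0)" "fst r" "snd r" a b] e(1) by simp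
    ultimately show ?thesis using o b0 by blast
  qed
  have "D T b0 (0, 1, 0) = 0 \<and> D T b0 (0, 0, 1) = 0 \<and> Xu b0 = 0 \<and> Ut b0 = 0 \<and> Ux b0 = 0 \<and> Uu b0 \<noteq> 0 \<and> (\<forall>v. D Uu b0 v = 0)"
    if b0: "b0 \<in> B" for b0
  proof -
    obtain r a b where z: "((b0, r), (a, b)) \<in> \<Omega>" using B_obtains[OF b0] by metis
    obtain C T' X' U1 U0 where C: "open C" "C \<subseteq> B" "b0 \<in> C" "U1 \<noteq> 0"
      and \<phi>: "\<And>t x u. (t, x, u) \<in> C \<Longrightarrow> \<phi> (t, x, u) = (T' t, X' (t, x), U1 * u + U0)"
      using main[OF z] by blast
    have c: "T b = T' (fst b)" "X b = X' (fst b, fst (snd b))" "U b = U1 * snd (snd b) + U0" if "b \<in> C" for b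
      using that \<phi>[of "fst b" "fst (snd b)" "snd (snd b)"] by (simp_all add: T_def X_def U_def)
    have "D T b0 (0, 1, 0) = 0" "D T b0 (0, 0, 1) = 0"
      by (rule D_zero_of_constant_along[OF C(1,3) differentiable_B[OF smooth_components(1) b0]]; use c(1) C(3) in simp)+
    moreover have "Xu b0 = 0"
      by (rule D_zero_of_constant_along[OF C(1,3) differentiable_B[OF smooth_components(2) b0]]; use c(2) C(3) in simp)
    moreover have DU: "D U b v = U1 * snd (snd v)" if "b \<in> C" for b v
    proof -
      have "D (\<lambda>b. U1 * snd (snd b) + U0) b = (\<lambda>v. U1 * snd (snd v))"
        by (rule D_eqI) (auto intro!: derivative_eq_intros)
      then show ?thesis using D_cong_open[OF C(1) that, of U "\<lambda>b. U1 * snd (snd b) + U0"] c(3) by simp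
    qed
    moreover have "D Uu b0 v = 0" for v
      using D_cong_open[OF C(1,3), of "\<lambda>b. Uu b" "\<lambda>_. U1"] DU by (simp add: frechet_derivative_const)
    ultimately show ?thesis using C(3,4) by simp
  qed
  then show affine_fibres by (simp add: affine_fibres_def projectable_def fibration_def)
  show transforms_elements unfolding transforms_elements_def
  proof (intro allI impI)
    fix b0 r a b assume z: "((b0, r), (a, b)) \<in> \<Omega>"
    obtain t x u where e: "b0 = (t, x, u)" by (cases b0)
    obtain C T' X' U1 U0 where C: "open C" "C \<subseteq> B" "(t, x, u) \<in> C"
      and \<phi>: "\<And>t x u. (t, x, u) \<in> C \<Longrightarrow> \<phi> (t, x, u) = (T' t, X' (t, x), U1 * u + U0)"
      and s: "snd (\<Phi> ((b0, r), (a, b))) = ((partial_x X' (t, x))\<^sup>2 / deriv T' t * a,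
        partial_x X' (t, x) / deriv T' t * b - (partial_t X' (t, x) - partial_x (partial_x X') (t, x) * a) / deriv T' t)"
      using main[OF z] unfolding e fst_conv snd_conv by blast
    have "deriv T' t = Tt (t, x, u)" "partial_t X' (t, x) = Xt (t, x, u)" "partial_x X' (t, x) = Xx (t, x, u)"
      "partial_x (partial_x X') (t, x) = Xxx (t, x, u)"
      by (rule parameters_partials[OF C]; use \<phi> in \<open>simp add: T_def X_def\<close>)+
    then show "snd (\<Phi> ((b0, r), (a, b))) =
        ((Xx b0)\<^sup>2 / Tt b0 * a, Xx b0 / Tt b0 * b - (Xt b0 - Xxx b0 * a) / Tt b0)"
      unfolding s by (simp add: e)
  qed
qed

section \<open>The normal form maps equations to equations\<close>

text \<open>The prolongation formulas yield
  \<open>(P1 - A' * Q3 - B' * P2) * Tt = Uu * (p1 - a * q3 - b * p2)\<close> with \<open>Tt\<close>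
  and \<open>Uu\<close> nonzero, at all jets of the domain.\<close>

lemma normal_form_equation:
  assumes af: affine_fibres and te: transforms_elements and z: "(j, (a, b)) \<in> \<Omega>"
  shows "kolmogorov (a, b) j \<longleftrightarrow> kolmogorov (snd (\<Phi> (j, (a, b)))) (\<psi> j)"
proof -
  obtain b0 p1 p2 q1 q2 q3 where j: "j = (b0, (p1, p2), (q1, q2, q3))" by (metis prod.exhaust)
  obtain t x u where b0: "b0 = (t, x, u)" by (cases b0)
  have S: "((t, x, u), (p1, p2), (q1, q2, q3)) \<in> S" and B: "b0 \<in> B"
    using z in_domain_imp unfolding j b0 by blast+
  have pr: projectable and fib: fibration using af by (simp_all add: affine_fibres_def projectable_def)
  have U: "Ut b0 = 0" "Ux b0 = 0" "Uu b0 \<noteq> 0" "\<And>v. D Uu b0 v = 0" "Xu b0 = 0"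
    using affine_fibresD[OF af B] pr B unfolding projectable_def by blast+
  have n: "Tt b0 \<noteq> 0" "Xx b0 \<noteq> 0" using projectable_Xx[OF pr B] by simp_all
  have DU: "D Ux b0 v = 0" for v
    by (rule D_zero_of_constant[OF _ B, where c = 0]) (use af in \<open>auto simp: affine_fibres_def\<close>)
  have DX: "D Xu b0 v = 0" for v
    by (rule D_zero_of_constant[OF _ B, where c = 0]) (use pr in \<open>auto simp: projectable_def\<close>)
  have P2: "P2 j * Xx b0 = p2 * Uu b0" and P1: "P1 j * Tt b0 = p1 * Uu b0 - P2 j * Xt b0"
    using fibration_P[OF fib S] U unfolding j b0 by simp_all
  have Q3: "Q3 j * (Xx b0)\<^sup>2 = q3 * Uu b0 - P2 j * Xxx b0"
    using fibration_Q3[OF fib S] U DU DX projectable_D_Xx[OF pr B, of 1 p2] unfolding j b0 by simp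
  define A' where "A' = (Xx b0)\<^sup>2 / Tt b0 * a"
  define B' where "B' = Xx b0 / Tt b0 * b - (Xt b0 - Xxx b0 * a) / Tt b0"
  have AB: "snd (\<Phi> (j, (a, b))) = (A', B')"
    using te z unfolding transforms_elements_def j A'_def B'_def by blast
  have A: "A' * Tt b0 = (Xx b0)\<^sup>2 * a" and B: "B' * Tt b0 = Xx b0 * b - (Xt b0 - Xxx b0 * a)"
    using n by (simp_all add: A'_def B'_def field_simps)
  have "(P1 j - A' * Q3 j - B' * P2 j) * Tt b0 = Uu b0 * (p1 - a * q3 - b * p2)"
    using P1 P2 Q3 A B by algebra
  then have "P1 j - A' * Q3 j - B' * P2 j = 0 \<longleftrightarrow> p1 - a * q3 - b * p2 = 0"
    using n(1) U(3) by (metis mult_eq_0_iff)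
  moreover have "\<psi> j = ((T b0, X b0, U b0), (P1 j, P2 j), (Q1 j, Q2 j, Q3 j))"
    using \<psi>_eq[OF S] unfolding j b0 by (simp add: \<phi>_eq)
  ultimately show ?thesis unfolding AB by (auto simp: j b0)
qed

lemma u_independent_partial:
  assumes "smooth_on B (F :: base \<Rightarrow> real)" "\<And>b. b \<in> B \<Longrightarrow> D F b (0, 0, 1) = 0" "b \<in> B"
  shows "D (\<lambda>b. D F b v) b (0, 0, 1) = 0"
  unfolding D_commute[OF assms(1,3), of v] by (rule D_zero_of_constant[OF _ assms(3)]) (rule assms(2))

lemma u_independent:
  assumes "convex C" "C \<subseteq> B" "smooth_on B (F :: base \<Rightarrow> real)" "\<And>b. b \<in> B \<Longrightarrow> D F b (0, 0, 1) = 0"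
    "(t, x, u) \<in> C" "(t, x, u') \<in> C"
  shows "F (t, x, u) = F (t, x, u')"
proof (rule constant_segment[OF assms(1,2,3,6,5)])
  fix b assume "b \<in> C"
  then show "D F b ((t, x, u) - (t, x, u')) = 0"
    using D_linear[OF assms(3), of b 0 0 "u - u'"] assms(2,4) by auto
qed

text \<open>The new elements are given as functions of old points and must become functions of the
  new \<open>(t, x)\<close>. A smooth local right inverse \<open>\<beta>\<close> of
  \<open>(T, X)\<close> is taken from a local inverse of \<open>\<Phi>\<close>. Its
  \<open>u\<close>-component may differ from that of the original point, which is harmless because
  all derivatives in the formulas are independent of \<open>u\<close> on a convex ball.\<close>

lemma normal_form_imp_maps:
  assumes af: affine_fibres and te: transforms_elements
  shows "maps_equations_to_equations \<Omega> \<Phi>"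
  unfolding maps_equations_to_equations_def
proof (intro allI impI)
  fix W \<theta> j assume ar: "arbitrary_elements_on W \<theta>" and j: "indep j \<in> W \<and> lift \<theta> j \<in> \<Omega>"
  have pr: projectable using af by (simp add: affine_fibres_def)
  have W: "open W" "smooth_on W \<theta>" "\<And>p. p \<in> W \<Longrightarrow> fst (\<theta> p) \<noteq> 0"
    using ar by (auto simp: arbitrary_elements_on_def)
  obtain V0 V0' g where V0: "open V0" "lift \<theta> j \<in> V0" "V0 \<subseteq> \<Omega>" "open V0'"
    "homeomorphism V0 V0' \<Phi> g" "smooth_on V0' g"
    using local_diffeo[unfolded local_diffeomorphism_on_def, THEN bspec, OF conjunct2[OF j]] by blast
  let ?b0 = "fst j"
  have S: "j \<in> S" and b0: "?b0 \<in> B" using in_domain_imp[of ?b0 "snd j" "\<theta> (indep j)"] j by (simp_all add: lift_def)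
  obtain r where r: "r > 0" "ball ?b0 r \<subseteq> B" using open_B b0 openE by blast
  define C where "C = ball ?b0 r"
  have C: "open C" "convex C" "C \<subseteq> B" "?b0 \<in> C" using r by (auto simp: C_def)
  let ?w = "\<Phi> (lift \<theta> j)"
  \<comment> \<open>The new \<open>u\<close>, the new derivatives and the new elements are frozen at
    their values at \<open>?w\<close>, leaving the new \<open>(t, x)\<close> as variables.\<close>
  define ins where "ins p = (((fst p, snd p, U ?b0), snd (fst ?w)), snd ?w)" for p :: "real \<times> real"
  define \<beta> where "\<beta> p = fst (fst (g (ins p)))" for p
  let ?i = "\<lambda>b::base. (fst b, fst (snd b))"
  let ?p = "\<lambda>b. (T b, X b)"
  have w: "?w \<in> V0'" "g ?w = lift \<theta> j" using V0(2,5) by (auto simp: homeomorphism_def)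
  have "fst (fst ?w) = \<phi> ?b0"
    using base_component[of "lift \<theta> j"] j by (simp add: base_of_def jet_of_def lift_def)
  then have ins0: "ins (?p ?b0) = ?w" unfolding ins_def by (intro prod_eqI) (simp_all add: \<phi>_eq)
  have \<beta>0: "\<beta> (?p ?b0) = ?b0" unfolding \<beta>_def ins0 w(2) by (simp add: lift_def)
  define N1 where "N1 = ins -` V0'"
  have N1: "open N1" unfolding N1_def ins_def by (intro open_vimage V0 continuous_intros)
  have s\<beta>: "smooth_on N1 \<beta>"
    unfolding \<beta>_def[abs_def]
    by (intro smooth_on_fst N1 smooth_on_compose[OF N1 V0(4) _ V0(6)])
      (auto simp: N1_def ins_def[abs_def] intro!: smooth_intros N1[unfolded N1_def ins_def[abs_def]])
  have \<phi>\<beta>: "T (\<beta> p) = fst p" "X (\<beta> p) = snd p" if "p \<in> N1" for p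
  proof -
    have "g (ins p) \<in> V0" "\<Phi> (g (ins p)) = ins p"
      using V0(5) that by (auto simp: N1_def homeomorphism_def)
    then have "\<phi> (\<beta> p) = fst (fst (ins p))"
      using base_component[of "g (ins p)"] V0(3) by (auto simp: base_of_def jet_of_def \<beta>_def)
    then show "T (\<beta> p) = fst p" "X (\<beta> p) = snd p" by (simp_all add: \<phi>_eq ins_def)
  qed
  define N2 where "N2 = N1 \<inter> (\<beta> -` C \<inter> (\<lambda>p. ?i (\<beta> p)) -` W)"
  have c\<beta>: "continuous_on N1 \<beta>" using s\<beta> by (rule smooth_on_continuous)
  have N2: "open N2"
  proof -
    have "N2 = (N1 \<inter> \<beta> -` C) \<inter> (N1 \<inter> (\<lambda>p. ?i (\<beta> p)) -` W)" by (auto simp: N2_def)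
    moreover have "open (N1 \<inter> \<beta> -` C)" by (rule continuous_open_preimage[OF c\<beta> N1 C(1)])
    moreover have "open (N1 \<inter> (\<lambda>p. ?i (\<beta> p)) -` W)"
      by (rule continuous_open_preimage[OF _ N1 W(1)]) (intro continuous_intros c\<beta>)
    ultimately show ?thesis by auto
  qed
  have \<beta>N2: "\<beta> p \<in> C" "\<beta> p \<in> B" "?i (\<beta> p) \<in> W" if "p \<in> N2" for p using that C(3) by (auto simp: N2_def)
  \<comment> \<open>The formulas of the normal form, evaluated at the old base point
    \<open>\<beta> p\<close>.\<close>
  define \<theta>' where "\<theta>' p = (let c = \<beta> p; a = fst (\<theta> (?i c)); b = snd (\<theta> (?i c)) in
    ((Xx c)\<^sup>2 / Tt c * a, Xx c / Tt c * b - (Xt c - Xxx c * a) / Tt c))" for p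
  have s\<beta>2: "smooth_on N2 \<beta>" by (rule smooth_on_subset[OF s\<beta>]) (simp add: N2_def)
  have s1: "smooth_on N2 (\<lambda>p. F (\<beta> p))" if "smooth_on B F" for F :: "base \<Rightarrow> real"
    by (rule smooth_on_compose[OF N2 open_B s\<beta>2 that]) (use \<beta>N2 in auto)
  have s2: "smooth_on N2 (\<lambda>p. \<theta> (?i (\<beta> p)))"
    by (rule smooth_on_compose[OF N2 W(1) _ W(2)]) (use \<beta>N2 in \<open>auto intro!: smooth_intros N2 s\<beta>2\<close>)
  have nz: "Tt (\<beta> p) \<noteq> 0" "Xx (\<beta> p) \<noteq> 0" if "p \<in> N2" for p
    using projectable_Xx[OF pr] \<beta>N2[OF that] by simp_all
  have "smooth_on N2 \<theta>'"
    unfolding \<theta>'_def Let_def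
    by (intro smooth_intros N2 s2 s1[OF smooth_partials(1)] s1[OF smooth_partials(2)]
        s1[OF smooth_on_frechet_derivative[OF smooth_partials(2)]] nz(1)) assumption+
  moreover have "fst (\<theta>' p) \<noteq> 0" if "p \<in> N2" for p
    using nz[OF that] W(3)[OF \<beta>N2(3)[OF that]] by (simp add: \<theta>'_def Let_def)
  ultimately have ar': "arbitrary_elements_on N2 \<theta>'"
    using N2 by (simp add: arbitrary_elements_on_def)
  define V1 where "V1 = indep -` W \<inter> fst -` C"
  have V1: "open V1" unfolding V1_def indep_def[abs_def] by (intro open_Int open_vimage W C continuous_intros)
  define V where "V = V1 \<inter> (\<lambda>i. (lift \<theta> i, ?p (fst i))) -` (\<Omega> \<times> N2)"
  have ci: "continuous_on V1 (\<lambda>i. \<theta> (indep i))"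
    by (rule continuous_on_compose2[OF smooth_on_continuous[OF W(2)]])
      (auto simp: V1_def indep_def[abs_def] intro!: continuous_intros)
  have cB: "continuous_on V1 (\<lambda>i. F (fst i))" if "smooth_on B F" for F :: "base \<Rightarrow> real"
    by (rule continuous_on_compose2[OF smooth_on_continuous[OF that]])
      (use C(3) in \<open>auto simp: V1_def intro!: continuous_intros\<close>)
  have V: "open V"
    unfolding V_def
    by (rule continuous_open_preimage[OF _ V1 open_Times[OF open_domain N2]])
      (auto simp: lift_def[abs_def] intro!: continuous_intros ci cB smooth_components)
  have "?p ?b0 \<in> N1" using w by (simp add: N1_def ins0)
  then have "?p ?b0 \<in> N2" using \<beta>0 C(4) j by (simp add: N2_def indep_def)
  then have jV: "j \<in> V" using j C(4) by (simp add: V_def V1_def)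
  have u1: "D T b (0, 0, 1) = 0" "D X b (0, 0, 1) = 0" "D (\<lambda>b. Xx b) b (0, 0, 1) = 0" if "b \<in> B" for b
    using projectable_D[OF pr that, of "(0, 0, 1)"] projectable_D_Xx[OF pr that, of 0 1] by simp_all
  have u0: "D (\<lambda>b. Tt b) b (0, 0, 1) = 0" "D (\<lambda>b. Xt b) b (0, 0, 1) = 0" "D (\<lambda>b. Xxx b) b (0, 0, 1) = 0" if "b \<in> B" for b
    by (rule u_independent_partial; use smooth_components smooth_partials u1 that in blast)+
  have main: "snd (\<Phi> (lift \<theta> i)) = \<theta>' (?p (fst i))" if i: "i \<in> V" for i
  proof -
    have iV: "lift \<theta> i \<in> \<Omega>" "?p (fst i) \<in> N2" "fst i \<in> C" "indep i \<in> W"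
      using i by (auto simp: V_def V1_def)
    obtain t x u r where ie: "i = ((t, x, u), r)" by (metis prod.exhaust)
    define p where "p = ?p (t, x, u)"
    obtain t' x' u' where b': "\<beta> p = (t', x', u')" by (metis prod.exhaust)
    have p: "p \<in> N2" "p \<in> N1" using iV(2) by (simp_all add: ie p_def N2_def)
    have c: "(t, x, u) \<in> C" "(t', x', u') \<in> C" using iV(3) \<beta>N2(1)[OF p(1)] by (simp_all add: ie b')
    have eq: "T (t', x', u') = T (t, x, u)" "X (t', x', u') = X (t, x, u)"
      using \<phi>\<beta>[OF p(2)] unfolding b' by (simp_all add: p_def)
    obtain c1 where c1: "c1 \<in> C" "T (t', x', u') - T (t, x, u) = D T c1 ((t', x', u') - (t, x, u))"
      using mean_value_segment[OF C(2,3) smooth_components(1) c] by blast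
    have "c1 \<in> B" using c1(1) C(3) by blast
    note B1 = projectable_D(1)[OF pr this, of "(t', x', u') - (t, x, u)"] projectable_Xx[OF pr this]
    \<comment> \<open>Equal values of \<open>T\<close> force equal \<open>t\<close> since
      \<open>Tt\<close> does not vanish on \<open>C\<close>; afterwards equal values of
      \<open>X\<close> force equal \<open>x\<close> in the same way. Nothing is claimed about
      \<open>u'\<close>.\<close>
    have "(t' - t) * Tt c1 = 0" using c1(2) unfolding eq(1) B1(1) by simp
    then have t: "t' = t" using B1(2) by simp
    obtain c2 where c2: "c2 \<in> C" "X (t', x', u') - X (t, x, u) = D X c2 ((t', x', u') - (t, x, u))"
      using mean_value_segment[OF C(2,3) smooth_components(2) c] by blast
    have "c2 \<in> B" using c2(1) C(3) by blast
    note B2 = projectable_D(2)[OF pr this, of "(t', x', u') - (t, x, u)"] projectable_Xx[OF pr this]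
    have "(x' - x) * Xx c2 = 0" using c2(2) unfolding eq(2) B2(1) by (simp add: t)
    then have x: "x' = x" using B2(2) by simp
    have c': "(t, x, u') \<in> C" using c(2) t x by simp
    have "Tt (t, x, u') = Tt (t, x, u)" "Xt (t, x, u') = Xt (t, x, u)" "Xx (t, x, u') = Xx (t, x, u)"
      "Xxx (t, x, u') = Xxx (t, x, u)"
      by (rule u_independent[OF C(2,3) _ _ c' c(1), where F = "\<lambda>b. Tt b"]
          u_independent[OF C(2,3) _ _ c' c(1), where F = "\<lambda>b. Xt b"]
          u_independent[OF C(2,3) _ _ c' c(1), where F = "\<lambda>b. Xx b"]
          u_independent[OF C(2,3) _ _ c' c(1), where F = "\<lambda>b. Xxx b"];
        use smooth_partials smooth_on_frechet_derivative[OF smooth_partials(2)] u0 u1 in blast)+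
    note e = this
    have l: "lift \<theta> i = (((t, x, u), r), (fst (\<theta> (t, x)), snd (\<theta> (t, x))))"
      by (simp add: lift_def indep_def ie)
    have "snd (\<Phi> (lift \<theta> i)) = ((Xx (t, x, u))\<^sup>2 / Tt (t, x, u) * fst (\<theta> (t, x)),
        Xx (t, x, u) / Tt (t, x, u) * snd (\<theta> (t, x)) - (Xt (t, x, u) - Xxx (t, x, u) * fst (\<theta> (t, x))) / Tt (t, x, u))"
      unfolding l by (rule transforms_elementsD[OF te iV(1)[unfolded l]])
    also have "\<dots> = \<theta>' p" unfolding \<theta>'_def b' t x Let_def fst_conv snd_conv e ..
    finally show ?thesis by (simp add: p_def ie)
  qed
  have "\<forall>i\<in>V. indep i \<in> W \<and> lift \<theta> i \<in> \<Omega> \<and> (let i' = jet_of (\<Phi> (lift \<theta> i)) in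
      indep i' \<in> N2 \<and> \<Phi> (lift \<theta> i) = lift \<theta>' i' \<and> (kolmogorov (\<theta> (indep i)) i \<longleftrightarrow> kolmogorov (\<theta>' (indep i')) i'))"
  proof
    fix i assume i: "i \<in> V"
    have iV: "(i, \<theta> (indep i)) \<in> \<Omega>" "?p (fst i) \<in> N2" "indep i \<in> W"
      using i by (auto simp: V_def V1_def lift_def)
    then have S: "i \<in> S" using in_domain_imp[of "fst i" "snd i"] by simp
    have p: "jet_of (\<Phi> (lift \<theta> i)) = \<psi> i" using jet_component[OF iV(1)] by (simp add: jet_of_def lift_def)
    have ind: "indep (\<psi> i) = ?p (fst i)" using \<psi>_eq[OF S] by (simp add: indep_def \<phi>_eq)
    have m: "snd (\<Phi> (i, \<theta> (indep i))) = \<theta>' (indep (\<psi> i))" using main[OF i] by (simp add: ind lift_def)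
    have "\<Phi> (lift \<theta> i) = lift \<theta>' (\<psi> i)" using \<Phi>_eq[OF iV(1)] m by (simp add: lift_def)
    moreover have "kolmogorov (\<theta> (indep i)) i \<longleftrightarrow> kolmogorov (\<theta>' (indep (\<psi> i))) (\<psi> i)"
      using normal_form_equation[OF af te, of i "fst (\<theta> (indep i))" "snd (\<theta> (indep i))"] iV(1) m by simp
    ultimately show "indep i \<in> W \<and> lift \<theta> i \<in> \<Omega> \<and> (let i' = jet_of (\<Phi> (lift \<theta> i)) in
      indep i' \<in> N2 \<and> \<Phi> (lift \<theta> i) = lift \<theta>' i' \<and> (kolmogorov (\<theta> (indep i)) i \<longleftrightarrow> kolmogorov (\<theta>' (indep i')) i'))"
      using iV unfolding p Let_def ind by (simp add: lift_def)
  qed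
  then show "\<exists>V W' \<theta>'. open V \<and> j \<in> V \<and> arbitrary_elements_on W' \<theta>' \<and>
     (\<forall>i\<in>V. indep i \<in> W \<and> lift \<theta> i \<in> \<Omega> \<and> (let i' = jet_of (\<Phi> (lift \<theta> i)) in
      indep i' \<in> W' \<and> \<Phi> (lift \<theta> i) = lift \<theta>' i' \<and> (kolmogorov (\<theta> (indep i)) i \<longleftrightarrow> kolmogorov (\<theta>' (indep i')) i')))"
    using V jV ar' by (intro exI[of _ V] exI[of _ N2] exI[of _ \<theta>'] conjI)
qed

end

lemma point_transformation_iff:
  "point_transformation \<Omega> \<Phi> \<longleftrightarrow> (\<exists>\<phi> \<psi>. jet_transformation \<Omega> \<Phi> \<phi> \<psi>)"
  unfolding point_transformation_def jet_transformation_def by auto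

lemma equivalence_group_iff:
  "in_equivalence_group \<Omega> \<Phi> \<longleftrightarrow>
    point_transformation \<Omega> \<Phi> \<and>
    (\<forall>Q. open Q \<and> Q \<subseteq> \<Omega> \<and> convex (base_of ` Q) \<longrightarrow>
      (\<exists>T X U1 U0. admissible_parameters ((indep \<circ> jet_of) ` Q) T X U1 \<and> has_form_on Q \<Phi> T X U1 U0))"
proof (cases "point_transformation \<Omega> \<Phi>")
  case True
  then obtain \<phi> \<psi> where "jet_transformation \<Omega> \<Phi> \<phi> \<psi>" unfolding point_transformation_iff by blast
  then interpret jet_transformation \<Omega> \<Phi> \<phi> \<psi> .
  show ?thesis
    using True maps_imp_normal_form normal_form_imp_has_form has_form_imp_normal_form normal_form_imp_maps
    unfolding in_equivalence_group_def by meson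
qed (simp add: in_equivalence_group_def)

subsection \<open>Transformations with given parameters\<close>

locale point_parameters =
  fixes W :: "(real \<times> real) set" and T :: "real \<Rightarrow> real" and X :: "real \<times> real \<Rightarrow> real" and U1 U0 :: real
  assumes open_W: "open W" and admissible: "admissible_parameters W T X U1"
begin

abbreviation "T' p \<equiv> T (fst p)" for p :: "real \<times> real"
abbreviation "Tt p \<equiv> D (\<lambda>p. T' p) p (1, 0)"
abbreviation "Ttt p \<equiv> D (\<lambda>p. Tt p) p (1, 0)"
abbreviation "Xt p \<equiv> D X p (1, 0)"
abbreviation "Xx p \<equiv> D X p (0, 1)"
abbreviation "Xtt p \<equiv> D (\<lambda>p. Xt p) p (1, 0)"
abbreviation "Xtx p \<equiv> D (\<lambda>p. Xx p) p (1, 0)"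
abbreviation "Xxx p \<equiv> D (\<lambda>p. Xx p) p (0, 1)"

lemma U1_nonzero: "U1 \<noteq> 0" and smooth_X: "smooth_on W X"
  using admissible by (simp_all add: admissible_parameters_def)

lemma smooth_T: "smooth_on W (\<lambda>p. T' p)"
proof -
  have "smooth_on (fst ` W) T" using admissible by (simp add: admissible_parameters_def)
  from smooth_on_compose[OF open_W open_image_fst[OF open_W] _ this, of fst]
  show ?thesis using smooth_on_fst[OF open_W smooth_on_id[OF open_W]] by simp
qed

lemma smooth_parameters: "smooth_on W (\<lambda>p. Tt p)" "smooth_on W (\<lambda>p. Ttt p)" "smooth_on W (\<lambda>p. Xt p)" "smooth_on W (\<lambda>p. Xx p)"
  "smooth_on W (\<lambda>p. Xtt p)" "smooth_on W (\<lambda>p. Xtx p)" "smooth_on W (\<lambda>p. Xxx p)"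
  by (intro smooth_on_frechet_derivative smooth_T smooth_X)+

lemma D_pair:
  assumes "smooth_on W (F :: real \<times> real \<Rightarrow> real)" "p \<in> W"
  shows "D F p v = fst v * D F p (1, 0) + snd v * D F p (0, 1)"
proof -
  have lin: "linear (D F p)" using smooth_on_has_derivative[OF assms] by (rule has_derivative_linear)
  have "v = fst v *\<^sub>R (1, 0) + snd v *\<^sub>R (0, 1)" by (simp add: prod_eq_iff)
  then have "D F p v = D F p (fst v *\<^sub>R (1, 0) + snd v *\<^sub>R (0, 1))" by (rule arg_cong)
  then show ?thesis by (simp only: linear_add[OF lin] linear_cmul[OF lin] real_scaleR_def)
qed

lemma T_x_zero: "p \<in> W \<Longrightarrow> D (\<lambda>p. T' p) p (0, 1) = 0"
  by (rule D_zero_of_constant_along[OF open_W])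
    (auto intro: differentiableI smooth_on_has_derivative smooth_T)

lemma D_T: "p \<in> W \<Longrightarrow> D (\<lambda>p. T' p) p v = fst v * Tt p"
  using D_pair[OF smooth_T, of p v] T_x_zero[of p] by simp

lemma D_Tt: "p \<in> W \<Longrightarrow> D (\<lambda>p. Tt p) p v = fst v * Ttt p"
proof -
  assume p: "p \<in> W"
  have "D (\<lambda>p. Tt p) p (0, 1) = D (\<lambda>p. D (\<lambda>p. T' p) p (0, 1)) p (1, 0)"
    by (rule smooth_on_second_derivative_symmetric[OF open_W smooth_T p])
  also have "\<dots> = 0"
    using D_cong_open[OF open_W p, of "\<lambda>p. D (\<lambda>p. T' p) p (0, 1)" "\<lambda>_. 0"] T_x_zero
    by (simp add: frechet_derivative_const)
  finally show ?thesis using D_pair[OF smooth_parameters(1) p, of v] by simp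
qed

lemma D_Xt: "p \<in> W \<Longrightarrow> D (\<lambda>p. Xt p) p v = fst v * Xtt p + snd v * Xtx p"
  using D_pair[OF smooth_parameters(3), of p v]
    smooth_on_second_derivative_symmetric[OF open_W smooth_X, of p "(1, 0)" "(0, 1)"] by simp

lemma line_derivatives:
  assumes "smooth_on W (F :: real \<times> real \<Rightarrow> real)" "(t, x) \<in> W"
  shows "((\<lambda>s. F (s, x)) has_real_derivative D F (t, x) (1, 0)) (at t)"
    "((\<lambda>y. F (t, y)) has_real_derivative D F (t, x) (0, 1)) (at x)"
  by (rule deriv_along[where c = "\<lambda>s. (s, x)" and f = F] deriv_along[where c = "\<lambda>y. (t, y)" and f = F],
      auto intro!: derivative_eq_intros smooth_on_has_derivative[OF assms] simp: zero_prod_def)+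

lemma parameter_derivatives:
  assumes p: "(t, x) \<in> W"
  shows "deriv T t = Tt (t, x)" "partial_t X (t, x) = Xt (t, x)" "partial_x X (t, x) = Xx (t, x)"
    "partial_x (partial_x X) (t, x) = Xxx (t, x)"
proof -
  show "deriv T t = Tt (t, x)" using line_derivatives(1)[OF smooth_T p] by (simp add: DERIV_imp_deriv)
  show "partial_t X (t, x) = Xt (t, x)"
    using line_derivatives(1)[OF smooth_X p] by (simp add: partial_t_def DERIV_imp_deriv)
  have x: "partial_x X (t, y) = Xx (t, y)" if "(t, y) \<in> W" for y
    using line_derivatives(2)[OF smooth_X that] by (simp add: partial_x_def DERIV_imp_deriv)
  then show "partial_x X (t, x) = Xx (t, x)" using p by blast
  have "deriv (\<lambda>y. partial_x X (t, y)) x = Xxx (t, x)"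
    by (rule deriv_cong_open[of "(\<lambda>y. (t, y)) -` W", OF _ _ _ line_derivatives(2)[OF smooth_parameters(4) p]])
      (use p x in \<open>auto intro!: open_vimage open_W continuous_intros\<close>)
  then show "partial_x (partial_x X) (t, x) = Xxx (t, x)" by (simp add: partial_x_def[of "partial_x X"])
qed

lemma nonzero: "p \<in> W \<Longrightarrow> Tt p \<noteq> 0 \<and> Xx p \<noteq> 0"
proof -
  assume p: "p \<in> W"
  obtain t x where e: "p = (t, x)" by (cases p)
  have "deriv T t * partial_x X (t, x) \<noteq> 0" using admissible p unfolding admissible_parameters_def e by blast
  then show ?thesis using parameter_derivatives[of t x] p by (simp add: e)
qed

text \<open>The map is triangular. On a ball, the mean value theorem for \<open>T\<close> gives
  injectivity in \<open>t\<close>, then for \<open>X\<close> in \<open>x\<close>. Invariance of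
  domain supplies a continuous inverse, and the bootstrap from the explicit inverse Jacobian makes
  it smooth.\<close>

lemma local_inverse:
  assumes "p0 \<in> W"
  obtains N N' h where "open N" "p0 \<in> N" "N \<subseteq> W" "open N'" "homeomorphism N N' (\<lambda>p. (T' p, X p)) h" "smooth_on N' h"
proof -
  let ?F = "\<lambda>p. (T' p, X p)"
  obtain r where r: "r > 0" "ball p0 r \<subseteq> W" using open_W assms openE by blast
  define N where "N = ball p0 r"
  have N: "open N" "p0 \<in> N" "N \<subseteq> W" "convex N" using r by (auto simp: N_def)
  have inj: "inj_on ?F N"
  proof (rule inj_onI)
    fix p q assume pq: "p \<in> N" "q \<in> N" "?F p = ?F q"
    obtain c where c: "c \<in> N" "T' q - T' p = D (\<lambda>p. T' p) c (q - p)"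
      using mean_value_segment[OF N(4,3) smooth_T pq(1,2)] by blast
    have cW: "c \<in> W" using c(1) N(3) by blast
    have "fst (q - p) * Tt c = 0" using c(2) pq(3) D_T[OF cW, of "q - p"] by simp
    then have f: "fst p = fst q" using nonzero[OF cW] by simp
    obtain c' where c': "c' \<in> N" "X q - X p = D X c' (q - p)"
      using mean_value_segment[OF N(4,3) smooth_X pq(1,2)] by blast
    have c'W: "c' \<in> W" using c'(1) N(3) by blast
    have "snd (q - p) * Xx c' = 0" using c'(2) pq(3) f D_pair[OF smooth_X c'W, of "q - p"] by simp
    then have "snd p = snd q" using nonzero[OF c'W] by simp
    then show "p = q" using f by (simp add: prod_eq_iff)
  qed
  have cont: "continuous_on N ?F"
    by (intro continuous_on_Pair continuous_on_subset[OF smooth_on_continuous N(3)] smooth_T smooth_X)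
  obtain h where h: "homeomorphism N (?F ` N) ?F h"
    using invariance_of_domain_homeomorphism[OF N(1) cont _ inj] by auto
  have N': "open (?F ` N)" by (rule invariance_of_domain[OF cont N(1) inj])
  \<comment> \<open>The inverse of the triangular matrix with rows \<open>(Tt, 0)\<close> and
    \<open>(Xt, Xx)\<close>.\<close>
  define G where "G p w = (fst w / Tt p, (snd w - Xt p * (fst w / Tt p)) / Xx p)" for p and w :: "real \<times> real"
  have hN: "h y \<in> N" "?F (h y) = y" if "y \<in> ?F ` N" for y
    using h that by (auto simp: homeomorphism_def)
  have dh: "(h has_derivative G (h y)) (at y)" if y: "y \<in> ?F ` N" for y
  proof (rule has_derivative_inverse_basic[where f = ?F, OF _ _ _ _ N' y hN(2)])
    have p: "h y \<in> W" using hN(1)[OF y] N(3) by blast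
    have "((\<lambda>p. (T' p, X p)) has_derivative (\<lambda>v. (D (\<lambda>p. T' p) (h y) v, D X (h y) v))) (at (h y))"
      by (intro has_derivative_Pair smooth_on_has_derivative[OF _ p] smooth_T smooth_X)
    then show F: "(?F has_derivative (\<lambda>v. (fst v * Tt (h y), fst v * Xt (h y) + snd v * Xx (h y)))) (at (h y))"
      by (rule has_derivative_eq_rhs) (intro ext arg_cong2[where f = Pair] D_T[OF p] D_pair[OF smooth_X p])
    show "bounded_linear (G (h y))"
      unfolding linear_conv_bounded_linear[symmetric] using nonzero[OF p]
      by (intro linearI) (auto simp: G_def field_simps)
    show "G (h y) \<circ> (\<lambda>v. (fst v * Tt (h y), fst v * Xt (h y) + snd v * Xx (h y))) = id"
      using nonzero[OF p] by (auto simp: G_def fun_eq_iff)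
    show "continuous (at y) h"
      using h N' y by (auto simp: homeomorphism_def continuous_on_eq_continuous_at)
  qed
  have sG: "smooth_on N (\<lambda>p. G p v)" for v
    unfolding G_def using nonzero N(3)
    by (intro smooth_intros N(1) smooth_on_subset[OF _ N(3)] smooth_parameters) auto
  have "h ` ?F ` N \<subseteq> N" using hN(1) by blast
  then have "smooth_on (?F ` N) h" by (rule smooth_on_bootstrap[OF N' N(1) _ sG dh])
  then show thesis using that[OF N(1-3) N' h] by blast
qed

text \<open>
  Differentiating \<open>U1 u + U0 = v (T t, X (t, x))\<close> up to second order and solving for the derivatives
  of \<open>v\<close> gives the components below; the local inverse \<open>\<Psi>\<close> uses the unsolved relations.
\<close>

definition P2 :: "jet \<Rightarrow> real" where
  "P2 j = U1 * snd (fst (snd j)) / Xx (indep j)"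
definition P1 :: "jet \<Rightarrow> real" where
  "P1 j = (U1 * fst (fst (snd j)) - Xt (indep j) * P2 j) / Tt (indep j)"
definition Q3 :: "jet \<Rightarrow> real" where
  "Q3 j = (U1 * snd (snd (snd (snd j))) - Xxx (indep j) * P2 j) / (Xx (indep j))\<^sup>2"
definition Q2 :: "jet \<Rightarrow> real" where
  "Q2 j = (U1 * fst (snd (snd (snd j))) - Xtx (indep j) * P2 j - Xx (indep j) * Xt (indep j) * Q3 j) /
     (Xx (indep j) * Tt (indep j))"
definition Q1 :: "jet \<Rightarrow> real" where
  "Q1 j = (U1 * fst (snd (snd j)) - Ttt (indep j) * P1 j - Xtt (indep j) * P2 j -
     2 * Tt (indep j) * Xt (indep j) * Q2 j - (Xt (indep j))\<^sup>2 * Q3 j) / (Tt (indep j))\<^sup>2"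

definition \<phi> :: "base \<Rightarrow> base" where
  "\<phi> b = (T (fst b), X (fst b, fst (snd b)), U1 * snd (snd b) + U0)"

definition \<psi> :: "jet \<Rightarrow> jet" where
  "\<psi> j = (\<phi> (fst j), (P1 j, P2 j), (Q1 j, Q2 j, Q3 j))"

definition \<Phi> :: "ext \<Rightarrow> ext" where
  "\<Phi> z = (\<psi> (fst z), (let p = indep (fst z) in
     ((Xx p)\<^sup>2 / Tt p * fst (snd z), Xx p / Tt p * snd (snd z) - (Xt p - Xxx p * fst (snd z)) / Tt p)))"

definition over :: "(real \<times> real) set \<Rightarrow> ext set" where
  "over N = {z. indep (fst z) \<in> N \<and> fst (snd z) \<noteq> 0}"

lemma open_over: "open N \<Longrightarrow> open (over N)"
proof -
  assume "open N"
  then have "open ((\<lambda>z::ext. indep (fst z)) -` N \<inter> (\<lambda>z::ext. fst (snd z)) -` (- {0}))"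
    unfolding indep_def by (intro open_Int open_vimage continuous_intros) auto
  moreover have "(\<lambda>z::ext. indep (fst z)) -` N \<inter> (\<lambda>z::ext. fst (snd z)) -` (- {0}) = over N"
    by (auto simp: over_def)
  ultimately show ?thesis by metis
qed

lemma jet_over: "jet_of ` over N = {j. indep j \<in> N}"
proof -
  have "j \<in> jet_of ` over N" if "indep j \<in> N" for j
    by (rule image_eqI[of _ _ "(j, (1, 0))"]) (use that in \<open>simp_all add: jet_of_def over_def\<close>)
  then show ?thesis by (auto simp: jet_of_def over_def)
qed

lemma open_jets: "open {j. indep j \<in> W}"
  using open_vimage[OF open_W, of indep] unfolding vimage_def indep_def[abs_def]
  by (simp add: continuous_on_fst continuous_on_snd continuous_on_Pair continuous_on_id)

lemma smooth_indep: "open Z \<Longrightarrow> smooth_on Z f \<Longrightarrow> smooth_on Z (\<lambda>z. indep (f z))"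
  unfolding indep_def by (intro smooth_intros)

text \<open>Composition with \<open>f\<close> covers both uses: \<open>f = fst\<close> on the
  extended space and the identity on jets.\<close>

lemma smooth_\<psi>_compose:
  assumes Z: "open Z" "smooth_on Z f" "\<And>z. z \<in> Z \<Longrightarrow> indep (f z) \<in> W"
  shows "smooth_on Z (\<lambda>z. \<psi> (f z))" and "smooth_on Z (\<lambda>z. P1 (f z))" and "smooth_on Z (\<lambda>z. P2 (f z))"
proof -
  have F: "smooth_on Z (\<lambda>z. F (indep (f z)))" if "smooth_on W F" for F :: "real \<times> real \<Rightarrow> real"
    by (rule smooth_on_compose[OF Z(1) open_W smooth_indep[OF Z(1,2)] that]) (use Z(3) in auto)
  have n: "Tt (indep (f z)) \<noteq> 0" "Xx (indep (f z)) \<noteq> 0" if "z \<in> Z" for z using nonzero[OF Z(3)[OF that]] by simp_all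
  note i = smooth_intros Z(1,2) smooth_parameters[THEN F]
  show p2: "smooth_on Z (\<lambda>z. P2 (f z))" unfolding P2_def by (intro i n)
  show p1: "smooth_on Z (\<lambda>z. P1 (f z))" unfolding P1_def by (intro i n p2)
  have q3: "smooth_on Z (\<lambda>z. Q3 (f z))" unfolding Q3_def by (intro i p2) (use n in auto)
  have q2: "smooth_on Z (\<lambda>z. Q2 (f z))" unfolding Q2_def by (intro i p2 q3) (use n in auto)
  have q1: "smooth_on Z (\<lambda>z. Q1 (f z))" unfolding Q1_def by (intro i p1 p2 q2 q3) (use n in auto)
  have "smooth_on Z (\<lambda>z. T (fst (fst (f z))))" "smooth_on Z (\<lambda>z. X (fst (fst (f z)), fst (snd (fst (f z)))))"
    using F[OF smooth_T] F[OF smooth_X] by (simp_all add: indep_def)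
  then show "smooth_on Z (\<lambda>z. \<psi> (f z))" unfolding \<psi>_def \<phi>_def by (intro i p1 p2 q1 q2 q3)
qed

lemma smooth_\<Phi>: "smooth_on (over W) \<Phi>"
proof -
  have o: "open (over W)" by (rule open_over[OF open_W])
  have f: "smooth_on (over W) (\<lambda>z::ext. fst z)" by (intro smooth_intros o)
  have F: "smooth_on (over W) (\<lambda>z. F (indep (fst z)))" if "smooth_on W F" for F :: "real \<times> real \<Rightarrow> real"
    by (rule smooth_on_compose[OF o open_W smooth_indep[OF o f] that]) (auto simp: over_def)
  have n: "Tt (indep (fst z)) \<noteq> 0" if "z \<in> over W" for z using nonzero that by (auto simp: over_def)
  have "smooth_on (over W) (\<lambda>z. \<psi> (fst z))"
    by (rule smooth_\<psi>_compose(1)[OF o f]) (simp add: over_def)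
  then show ?thesis
    unfolding \<Phi>_def[abs_def] Let_def by (intro smooth_intros o smooth_parameters[THEN F] n)
qed

definition \<Psi> :: "(real \<times> real \<Rightarrow> real \<times> real) \<Rightarrow> ext \<Rightarrow> ext" where
  "\<Psi> h z = (let p = h (indep (fst z)); u = snd (snd (fst (fst z)));
       p1 = fst (fst (snd (fst z))); p2 = snd (fst (snd (fst z)));
       q1 = fst (snd (snd (fst z))); q2 = fst (snd (snd (snd (fst z)))); q3 = snd (snd (snd (snd (fst z))));
       a = fst (snd z) * Tt p / (Xx p)\<^sup>2
     in (((fst p, snd p, (u - U0) / U1),
          ((Tt p * p1 + Xt p * p2) / U1, Xx p * p2 / U1),
          ((Ttt p * p1 + Xtt p * p2 + (Tt p)\<^sup>2 * q1 + 2 * Tt p * Xt p * q2 + (Xt p)\<^sup>2 * q3) / U1,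
           (Xtx p * p2 + Xx p * (Tt p * q2 + Xt p * q3)) / U1,
           (Xxx p * p2 + (Xx p)\<^sup>2 * q3) / U1)),
         (a, (Tt p * snd (snd z) + Xt p - Xxx p * a) / Xx p)))"

lemma smooth_\<Psi>:
  assumes N': "open N'" "smooth_on N' h" "h ` N' \<subseteq> W"
  shows "smooth_on (over N') (\<Psi> h)"
proof -
  have o: "open (over N')" by (rule open_over[OF N'(1)])
  have f: "smooth_on (over N') (\<lambda>z::ext. fst z)" by (intro smooth_intros o)
  have h: "smooth_on (over N') (\<lambda>z. h (indep (fst z)))"
    by (rule smooth_on_compose[OF o N'(1) smooth_indep[OF o f] N'(2)]) (auto simp: over_def)
  have F: "smooth_on (over N') (\<lambda>z. F (h (indep (fst z))))" if "smooth_on W F" for F :: "real \<times> real \<Rightarrow> real"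
    by (rule smooth_on_compose[OF o open_W h that]) (use N'(3) in \<open>auto simp: over_def\<close>)
  have n: "Tt (h (indep (fst z))) \<noteq> 0 \<and> Xx (h (indep (fst z))) \<noteq> 0" if "z \<in> over N'" for z
    using nonzero[of "h (indep (fst z))"] N'(3) that by (auto simp: over_def)
  show ?thesis
    unfolding \<Psi>_def[abs_def] Let_def
    by (intro smooth_intros o h smooth_parameters[THEN F]) (use n U1_nonzero in auto)
qed

lemma indep_\<Phi>: "indep (fst (\<Phi> z)) = (T' (indep (fst z)), X (indep (fst z)))"
  by (simp add: \<Phi>_def \<psi>_def \<phi>_def indep_def)

lemma indep_\<Psi>: "indep (fst (\<Psi> h z)) = h (indep (fst z))"
  by (simp add: \<Psi>_def Let_def indep_def)

lemma \<Psi>_\<Phi>: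
  assumes "indep (fst z) \<in> W" "h (T' (indep (fst z)), X (indep (fst z))) = indep (fst z)"
  shows "\<Psi> h (\<Phi> z) = z"
proof -
  obtain t x u p1 p2 q1 q2 q3 a b where z: "z = (((t, x, u), (p1, p2), (q1, q2, q3)), (a, b))"
    by (metis prod.exhaust)
  define j where "j = ((t, x, u), (p1, p2), (q1, q2, q3))"
  have i: "indep j = (t, x)" by (simp add: j_def indep_def)
  have n: "Tt (t, x) \<noteq> 0" "Xx (t, x) \<noteq> 0" using nonzero[of "(t, x)"] assms(1) i by (simp_all add: z j_def)
  have h: "h (T t, X (t, x)) = (t, x)" using assms(2) i by (simp add: z j_def)
  \<comment> \<open>Clearing denominators restores the chain rules for \<open>u_x\<close>,
    \<open>u_t\<close> and the second derivatives, which are the expressions that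
    \<open>\<Psi>\<close> evaluates.\<close>
  have p2: "Xx (t, x) * P2 j = U1 * p2" using n by (simp add: P2_def i) (simp add: j_def)
  have p1: "Tt (t, x) * P1 j + Xt (t, x) * P2 j = U1 * p1" using n by (simp add: P1_def i) (simp add: j_def)
  have q3: "Xxx (t, x) * P2 j + (Xx (t, x))\<^sup>2 * Q3 j = U1 * q3" using n by (simp add: Q3_def i) (simp add: j_def)
  have q2: "Xtx (t, x) * P2 j + Xx (t, x) * (Tt (t, x) * Q2 j + Xt (t, x) * Q3 j) = U1 * q2"
    using n by (simp add: Q2_def i field_simps) (simp add: j_def)
  have q1: "Ttt (t, x) * P1 j + Xtt (t, x) * P2 j + (Tt (t, x))\<^sup>2 * Q1 j + 2 * Tt (t, x) * Xt (t, x) * Q2 j +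
      (Xt (t, x))\<^sup>2 * Q3 j = U1 * q1"
    using n by (simp add: Q1_def i) (simp add: j_def)
  have a: "(Xx (t, x))\<^sup>2 / Tt (t, x) * a * Tt (t, x) / (Xx (t, x))\<^sup>2 = a" using n by simp
  have b: "(Tt (t, x) * (Xx (t, x) / Tt (t, x) * b - (Xt (t, x) - Xxx (t, x) * a) / Tt (t, x)) + Xt (t, x) - Xxx (t, x) * a) /
      Xx (t, x) = b" using n by (simp add: field_simps)
  have "\<Phi> z = (((T t, X (t, x), U1 * u + U0), (P1 j, P2 j), (Q1 j, Q2 j, Q3 j)),
      ((Xx (t, x))\<^sup>2 / Tt (t, x) * a, Xx (t, x) / Tt (t, x) * b - (Xt (t, x) - Xxx (t, x) * a) / Tt (t, x)))"
    unfolding \<Phi>_def \<psi>_def z j_def[symmetric] fst_conv snd_conv i Let_def by (simp add: \<phi>_def j_def)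
  then show ?thesis
    unfolding \<Psi>_def by (simp only: Let_def indep_def fst_conv snd_conv h p1 p2 q1 q2 q3 a b)
      (use U1_nonzero in \<open>simp add: z\<close>)
qed

lemma \<Phi>_\<Psi>:
  assumes "h (indep (fst z)) \<in> W" "T' (h (indep (fst z))) = fst (indep (fst z))" "X (h (indep (fst z))) = snd (indep (fst z))"
  shows "\<Phi> (\<Psi> h z) = z"
proof -
  obtain t x u p1 p2 q1 q2 q3 a b where z: "z = (((t, x, u), (p1, p2), (q1, q2, q3)), (a, b))"
    by (metis prod.exhaust)
  obtain s y where h: "h (t, x) = (s, y)" by fastforce
  have n: "Tt (s, y) \<noteq> 0" "Xx (s, y) \<noteq> 0" "T s = t" "X (s, y) = x"
    using assms nonzero[of "(s, y)"] by (simp_all add: z indep_def h)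
  define j where "j = fst (\<Psi> h z)"
  have j: "j = ((s, y, (u - U0) / U1),
          ((Tt (s, y) * p1 + Xt (s, y) * p2) / U1, Xx (s, y) * p2 / U1),
          ((Ttt (s, y) * p1 + Xtt (s, y) * p2 + (Tt (s, y))\<^sup>2 * q1 + 2 * Tt (s, y) * Xt (s, y) * q2 + (Xt (s, y))\<^sup>2 * q3) / U1,
           (Xtx (s, y) * p2 + Xx (s, y) * (Tt (s, y) * q2 + Xt (s, y) * q3)) / U1,
           (Xxx (s, y) * p2 + (Xx (s, y))\<^sup>2 * q3) / U1))"
    unfolding j_def \<Psi>_def z Let_def by (simp add: indep_def h)
  have i: "indep j = (s, y)" by (simp add: j indep_def)
  have P2: "P2 j = p2" unfolding P2_def i using n U1_nonzero by (simp add: j)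
  have P1: "P1 j = p1" unfolding P1_def i P2 using n U1_nonzero by (simp add: j)
  have Q3: "Q3 j = q3" unfolding Q3_def i P2 using n U1_nonzero by (simp add: j)
  have Q2: "Q2 j = q2" unfolding Q2_def i P2 Q3 using n U1_nonzero by (simp add: j field_simps)
  have Q1: "Q1 j = q1" unfolding Q1_def i P1 P2 Q2 Q3 using n U1_nonzero by (simp add: j)
  have "\<psi> j = ((t, x, u), (p1, p2), (q1, q2, q3))"
    unfolding \<psi>_def P1 P2 Q1 Q2 Q3 using n U1_nonzero by (simp add: \<phi>_def j)
  moreover have "snd (\<Psi> h z) = (a * Tt (s, y) / (Xx (s, y))\<^sup>2,
      (Tt (s, y) * b + Xt (s, y) - Xxx (s, y) * (a * Tt (s, y) / (Xx (s, y))\<^sup>2)) / Xx (s, y))"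
    unfolding \<Psi>_def z Let_def by (simp add: indep_def h)
  \<comment> \<open>Valid for any \<open>c\<close>, as the terms with \<open>Xxx\<close> cancel; the
    old \<open>A\<close> is one such value.\<close>
  moreover have "Xx (s, y) / Tt (s, y) * ((Tt (s, y) * b + Xt (s, y) - Xxx (s, y) * c) / Xx (s, y)) -
      (Xt (s, y) - Xxx (s, y) * c) / Tt (s, y) = b" for c
    using n(1,2) by (simp add: field_simps)
  ultimately show ?thesis
    unfolding \<Phi>_def j_def[symmetric] i Let_def using n(1,2)
    by (simp only: fst_conv snd_conv) (simp add: z)
qed

text \<open>\<open>\<Phi>\<close> covers the map \<open>(T, X)\<close> of the plane and acts on all
  other coordinates by explicitly invertible formulas, so a local inverse in \<open>(t, x)\<close>
  extends to the whole cylinder \<open>over N'\<close>.\<close>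

lemma local_diffeo: "local_diffeomorphism_on (over W) \<Phi>"
  unfolding local_diffeomorphism_on_def
proof
  fix z assume z: "z \<in> over W"
  then have "indep (fst z) \<in> W" by (simp add: over_def)
  then obtain N N' h where N: "open N" "indep (fst z) \<in> N" "N \<subseteq> W" "open N'"
    "homeomorphism N N' (\<lambda>p. (T' p, X p)) h" "smooth_on N' h"
    by (rule local_inverse)
  have h: "\<And>p. p \<in> N \<Longrightarrow> (T' p, X p) \<in> N' \<and> h (T' p, X p) = p"
    "\<And>q. q \<in> N' \<Longrightarrow> h q \<in> N \<and> (T' (h q), X (h q)) = q"
    using N(5) by (auto simp: homeomorphism_def)
  have n: "fst (snd (\<Phi> w)) \<noteq> 0" if "w \<in> over N" for w
    using that nonzero[of "indep (fst w)"] N(3) by (auto simp: over_def \<Phi>_def Let_def)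
  have n': "fst (snd (\<Psi> h w)) \<noteq> 0" if "w \<in> over N'" for w
    using that nonzero[of "h (indep (fst w))"] h(2)[of "indep (fst w)"] N(3) by (auto simp: over_def \<Psi>_def Let_def)
  have to: "\<Phi> w \<in> over N' \<and> \<Psi> h (\<Phi> w) = w" if "w \<in> over N" for w
    using that n[OF that] h(1)[of "indep (fst w)"] \<Psi>_\<Phi>[of w h] N(3) by (auto simp: over_def indep_\<Phi>)
  have from': "\<Psi> h w \<in> over N \<and> \<Phi> (\<Psi> h w) = w" if "w \<in> over N'" for w
  proof -
    have i: "indep (fst w) \<in> N'" using that by (simp add: over_def)
    have "\<Phi> (\<Psi> h w) = w"
      by (rule \<Phi>_\<Psi>) (use h(2)[OF i] N(3) in \<open>auto simp: prod_eq_iff\<close>)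
    then show ?thesis using n'[OF that] h(2)[OF i] by (simp add: over_def indep_\<Psi>)
  qed
  have s: "smooth_on (over N) \<Phi>" by (rule smooth_on_subset[OF smooth_\<Phi>]) (use N(3) in \<open>auto simp: over_def\<close>)
  have s': "smooth_on (over N') (\<Psi> h)" by (rule smooth_\<Psi>[OF N(4,6)]) (use h(2) N(3) in auto)
  have "homeomorphism (over N) (over N') \<Phi> (\<Psi> h)"
    by (rule homeomorphismI[OF smooth_on_continuous[OF s] smooth_on_continuous[OF s']]) (use to from' in auto)
  moreover have "z \<in> over N" using z N(2) by (simp add: over_def)
  moreover have "over N \<subseteq> over W" using N(3) by (auto simp: over_def)
  ultimately show "\<exists>V V' g. open V \<and> z \<in> V \<and> V \<subseteq> over W \<and> open V' \<and> homeomorphism V V' \<Phi> g \<and> smooth_on V \<Phi> \<and> smooth_on V' g"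
    using s s' open_over[OF N(1)] open_over[OF N(4)] by blast
qed

text \<open>The fibre over a base point and a pair of elements is the full space of derivatives,
  hence convex. Resetting \<open>u_t\<close> reaches the equation within it.\<close>

lemma admissible_over: "admissible_domain (over W)"
  unfolding admissible_domain_def
proof (intro conjI allI impI)
  show "open (over W)" by (rule open_over[OF open_W])
  show "\<forall>z\<in>over W. fst (elements_of z) \<noteq> 0" by (simp add: over_def elements_of_def)
  fix j \<theta> assume j: "(j, \<theta>) \<in> over W"
  obtain b p1 p2 q1 q2 q3 where e: "j = (b, (p1, p2), (q1, q2, q3))" by (metis prod.exhaust)
  let ?S = "{i. fst i = fst j \<and> (i, \<theta>) \<in> over W}"
  let ?j = "(b, (fst \<theta> * q3 + snd \<theta> * p2, p2), (q1, q2, q3))"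
  have S: "?S = {fst j} \<times> UNIV" using j by (auto simp: over_def indep_def)
  have "convex ?S" unfolding S by (intro convex_Times) auto
  moreover have "j \<in> ?S" "?j \<in> ?S" unfolding S by (auto simp: e)
  ultimately have "connected_component ?S j ?j"
    unfolding connected_component_def using convex_connected by blast
  moreover have "kolmogorov \<theta> ?j" by (cases \<theta>; cases b) simp
  ultimately show "\<exists>j'. kolmogorov \<theta> j' \<and> connected_component ?S j j'" by blast
qed

lemma has_derivative_indep:
  assumes "smooth_on W (F :: real \<times> real \<Rightarrow> real)" "indep j \<in> W"
  shows "((\<lambda>j. F (indep j)) has_derivative (\<lambda>v. D F (indep j) (fst (fst v), fst (snd (fst v))))) (at j)"
proof -
  have "(indep has_derivative (\<lambda>v. (fst (fst v), fst (snd (fst v))))) (at j)"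
    unfolding indep_def[abs_def] by (intro has_derivative_Pair has_derivative_fst has_derivative_snd has_derivative_ident)
  from diff_chain_at[OF this smooth_on_has_derivative[OF assms]] show ?thesis by (simp add: o_def)
qed

text \<open>The first-order chain rules, kept free of denominators, are differentiated along a
  contact vector and compared with the second-order relations that define \<open>Q1\<close>,
  \<open>Q2\<close>, \<open>Q3\<close>.\<close>

lemma contact: "preserves_contact_on {j. indep j \<in> W} \<psi>"
  unfolding preserves_contact_on_def
proof
  fix j assume "j \<in> {j. indep j \<in> W}"
  then have j: "indep j \<in> W" by simp
  obtain t x u p1 p2 q1 q2 q3 where je: "j = ((t, x, u), (p1, p2), (q1, q2, q3))" by (metis prod.exhaust)
  let ?Z = "{j. indep j \<in> W}"
  let ?p = "(t, x)"
  have i: "indep j = ?p" by (simp add: je indep_def)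
  have p: "?p \<in> W" using j i by simp
  have n: "Tt ?p \<noteq> 0" "Xx ?p \<noteq> 0" using nonzero[OF p] by simp_all
  have id: "smooth_on ?Z (\<lambda>j. j)" by (rule smooth_on_id[OF open_jets])
  have sm: "smooth_on ?Z \<psi>" "smooth_on ?Z P1" "smooth_on ?Z P2"
    using smooth_\<psi>_compose[OF open_jets id] by simp_all
  note d = smooth_on_has_derivative[OF sm(1)] smooth_on_has_derivative[OF sm(2)] smooth_on_has_derivative[OF sm(3)]
  have dj: "(\<psi> has_derivative D \<psi> j) (at j)" "(P1 has_derivative D P1 j) (at j)" "(P2 has_derivative D P2 j) (at j)"
    using d j by simp_all
  note hi = has_derivative_indep[OF _ j]
  have "D \<psi> j v \<in> contact_plane (\<psi> j)" if v: "v \<in> contact_plane j" for v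
  proof -
    obtain dt dx dutt dutx duxx where ve: "v = ((dt, dx, p1 * dt + p2 * dx), (q1 * dt + q2 * dx, q2 * dt + q3 * dx), (dutt, dutx, duxx))"
      using v by (auto simp: je)
    have rP2: "P2 i * Xx (indep i) = U1 * snd (fst (snd i))" if "i \<in> ?Z" for i
      using that nonzero[of "indep i"] by (simp add: P2_def)
    have rP1: "P1 i * Tt (indep i) + Xt (indep i) * P2 i = U1 * fst (fst (snd i))" if "i \<in> ?Z" for i
      using that nonzero[of "indep i"] by (simp add: P1_def)
    have "((\<lambda>i. P2 i * Xx (indep i)) has_derivative
        (\<lambda>v. P2 j * D (\<lambda>p. Xx p) (indep j) (fst (fst v), fst (snd (fst v))) + D P2 j v * Xx (indep j))) (at j)"
      by (rule has_derivative_mult[OF dj(3) hi[OF smooth_parameters(4)]])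
    from has_derivative_transform_within_open[OF this open_jets _ rP2]
    have "((\<lambda>i. U1 * snd (fst (snd i))) has_derivative
        (\<lambda>v. P2 j * D (\<lambda>p. Xx p) (indep j) (fst (fst v), fst (snd (fst v))) + D P2 j v * Xx (indep j))) (at j)"
      using j by simp
    moreover have "((\<lambda>i::jet. U1 * snd (fst (snd i))) has_derivative (\<lambda>v. U1 * snd (fst (snd v)))) (at j)"
      by (intro has_derivative_mult_right has_derivative_fst has_derivative_snd has_derivative_ident)
    ultimately have "(\<lambda>v. P2 j * D (\<lambda>p. Xx p) (indep j) (fst (fst v), fst (snd (fst v))) + D P2 j v * Xx (indep j)) =
        (\<lambda>v. U1 * snd (fst (snd v)))" by (rule has_derivative_unique)
    from fun_cong[OF this, of v]
    have DP2: "P2 j * (dt * Xtx ?p + dx * Xxx ?p) + D P2 j v * Xx ?p = U1 * (q2 * dt + q3 * dx)"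
      using D_pair[OF smooth_parameters(4) p, of "(dt, dx)"] by (simp add: i ve)
    have "((\<lambda>i. P1 i * Tt (indep i) + Xt (indep i) * P2 i) has_derivative
        (\<lambda>v. (P1 j * D (\<lambda>p. Tt p) (indep j) (fst (fst v), fst (snd (fst v))) + D P1 j v * Tt (indep j)) +
          (Xt (indep j) * D P2 j v + D (\<lambda>p. Xt p) (indep j) (fst (fst v), fst (snd (fst v))) * P2 j))) (at j)"
      by (intro has_derivative_add has_derivative_mult dj hi smooth_parameters)
    from has_derivative_transform_within_open[OF this open_jets _ rP1]
    have "((\<lambda>i. U1 * fst (fst (snd i))) has_derivative
        (\<lambda>v. (P1 j * D (\<lambda>p. Tt p) (indep j) (fst (fst v), fst (snd (fst v))) + D P1 j v * Tt (indep j)) +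
          (Xt (indep j) * D P2 j v + D (\<lambda>p. Xt p) (indep j) (fst (fst v), fst (snd (fst v))) * P2 j))) (at j)"
      using j by simp
    moreover have "((\<lambda>i::jet. U1 * fst (fst (snd i))) has_derivative (\<lambda>v. U1 * fst (fst (snd v)))) (at j)"
      by (intro has_derivative_mult_right has_derivative_fst has_derivative_snd has_derivative_ident)
    ultimately have "(\<lambda>v. (P1 j * D (\<lambda>p. Tt p) (indep j) (fst (fst v), fst (snd (fst v))) + D P1 j v * Tt (indep j)) +
          (Xt (indep j) * D P2 j v + D (\<lambda>p. Xt p) (indep j) (fst (fst v), fst (snd (fst v))) * P2 j)) =
        (\<lambda>v. U1 * fst (fst (snd v)))" by (rule has_derivative_unique)
    from fun_cong[OF this, of v]
    have DP1: "P1 j * (dt * Ttt ?p) + D P1 j v * Tt ?p + Xt ?p * D P2 j v + (dt * Xtt ?p + dx * Xtx ?p) * P2 j =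
        U1 * (q1 * dt + q2 * dx)"
      using D_Tt[OF p, of "(dt, dx)"] D_Xt[OF p, of "(dt, dx)"] by (simp add: i ve)
    have P2: "P2 j * Xx ?p = U1 * p2" and P1: "P1 j * Tt ?p + Xt ?p * P2 j = U1 * p1"
      using rP2[of j] rP1[of j] p by (simp_all add: i) (simp_all add: je)
    have Q3: "Xxx ?p * P2 j + (Xx ?p)\<^sup>2 * Q3 j = U1 * q3" using n by (simp add: Q3_def i) (simp add: je)
    have Q2: "Xtx ?p * P2 j + Xx ?p * (Tt ?p * Q2 j + Xt ?p * Q3 j) = U1 * q2"
      using n by (simp add: Q2_def i field_simps) (simp add: je)
    have Q1: "Ttt ?p * P1 j + Xtt ?p * P2 j + (Tt ?p)\<^sup>2 * Q1 j + 2 * Tt ?p * Xt ?p * Q2 j + (Xt ?p)\<^sup>2 * Q3 j = U1 * q1"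
      using n by (simp add: Q1_def i) (simp add: je)
    \<comment> \<open>Eliminating \<open>U1 * q2\<close> and \<open>U1 * q3\<close> cancels the
      terms with \<open>P2\<close>. This has to precede the computation for \<open>P1\<close>, whose
      differentiated relation contains the derivative of \<open>P2\<close>.\<close>
    have "Xx ?p * D P2 j v = Xx ?p * (Q2 j * (Tt ?p * dt) + Q3 j * (Xt ?p * dt + Xx ?p * dx))"
      using DP2 Q3 Q2 by algebra
    then have c2: "D P2 j v = Q2 j * (Tt ?p * dt) + Q3 j * (Xt ?p * dt + Xx ?p * dx)" using n by simp
    have "Tt ?p * D P1 j v = Tt ?p * (Q1 j * (Tt ?p * dt) + Q2 j * (Xt ?p * dt + Xx ?p * dx))"
      using DP1 c2 Q3 Q2 Q1 by algebra
    then have c1: "D P1 j v = Q1 j * (Tt ?p * dt) + Q2 j * (Xt ?p * dt + Xx ?p * dx)" using n by simp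
    have cU: "U1 * (p1 * dt + p2 * dx) = P1 j * (Tt ?p * dt) + P2 j * (Xt ?p * dt + Xx ?p * dx)"
      using P1 P2 by algebra
    have "((\<lambda>i. fst (\<psi> i)) has_derivative (\<lambda>v. (D (\<lambda>p. T' p) (indep j) (fst (fst v), fst (snd (fst v))),
        D X (indep j) (fst (fst v), fst (snd (fst v))), U1 * snd (snd (fst v))))) (at j)"
    proof -
      have "(\<lambda>i. fst (\<psi> i)) = (\<lambda>i. (T' (indep i), X (indep i), U1 * snd (snd (fst i)) + U0))"
        by (simp add: \<psi>_def \<phi>_def indep_def fun_eq_iff)
      moreover have "((\<lambda>i::jet. U1 * snd (snd (fst i)) + U0) has_derivative (\<lambda>v. U1 * snd (snd (fst v)))) (at j)"
        by (auto intro!: derivative_eq_intros)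
      ultimately show ?thesis using hi[OF smooth_T] hi[OF smooth_X] by (simp add: has_derivative_Pair)
    qed
    from fun_cong[OF has_derivative_unique[OF has_derivative_fst[OF dj(1)] this], of v]
    have f: "fst (D \<psi> j v) = (Tt ?p * dt, Xt ?p * dt + Xx ?p * dx, U1 * (p1 * dt + p2 * dx))"
      using D_T[OF p, of "(dt, dx)"] D_pair[OF smooth_X p, of "(dt, dx)"] by (simp add: i ve mult.commute)
    have "((\<lambda>i. fst (fst (snd (\<psi> i)))) has_derivative (\<lambda>v. fst (fst (snd (D \<psi> j v))))) (at j)"
      "((\<lambda>i. snd (fst (snd (\<psi> i)))) has_derivative (\<lambda>v. snd (fst (snd (D \<psi> j v))))) (at j)"
      by (intro has_derivative_fst has_derivative_snd dj)+
    then have g: "fst (fst (snd (D \<psi> j v))) = D P1 j v" "snd (fst (snd (D \<psi> j v))) = D P2 j v"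
      using D_eqI by (force simp: \<psi>_def)+
    have "D \<psi> j v = ((Tt ?p * dt, Xt ?p * dt + Xx ?p * dx, U1 * (p1 * dt + p2 * dx)), (D P1 j v, D P2 j v), snd (snd (D \<psi> j v)))"
      by (intro prod_eqI) (simp_all add: f g)
    moreover have "\<psi> j = ((T t, X ?p, U1 * u + U0), (P1 j, P2 j), (Q1 j, Q2 j, Q3 j))"
      unfolding \<psi>_def by (simp add: \<phi>_def je)
    moreover have "((Tt ?p * dt, Xt ?p * dt + Xx ?p * dx, U1 * (p1 * dt + p2 * dx)), (D P1 j v, D P2 j v), w) \<in>
        contact_plane ((T t, X ?p, U1 * u + U0), (P1 j, P2 j), (Q1 j, Q2 j, Q3 j))" for w
      by (cases w) (use c1 c2 cU in simp)
    ultimately show ?thesis by metis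
  qed
  then show "\<exists>D. (\<psi> has_derivative D) (at j) \<and> D ` contact_plane j \<subseteq> contact_plane (\<psi> j)"
    using dj(1) by blast
qed

lemma point_transformation_\<Phi>: "point_transformation (over W) \<Phi>"
  unfolding point_transformation_def jet_over
proof (intro conjI admissible_over local_diffeo)
  show "\<exists>\<phi>. \<forall>z\<in>over W. base_of (\<Phi> z) = \<phi> (base_of z)"
    by (intro exI[of _ \<phi>]) (simp add: \<Phi>_def \<psi>_def base_of_def jet_of_def)
  show "\<exists>\<psi>. (\<forall>z\<in>over W. jet_of (\<Phi> z) = \<psi> (jet_of z)) \<and> preserves_contact_on {j. indep j \<in> W} \<psi>"
    by (intro exI[of _ \<psi>]) (simp add: \<Phi>_def jet_of_def contact)
qed

lemma has_form_\<Phi>: "has_form_on (over W) \<Phi> T X U1 U0"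
  unfolding has_form_on_def Let_def
proof (intro allI impI conjI)
  fix t x u p q a b assume "(((t, x, u), p, q), (a, b)) \<in> over W"
  then have "(t, x) \<in> W" by (simp add: over_def indep_def)
  then show "elements_of (\<Phi> (((t, x, u), p, q), (a, b))) = ((partial_x X (t, x))\<^sup>2 / deriv T t * a,
      partial_x X (t, x) / deriv T t * b - (partial_t X (t, x) - partial_x (partial_x X) (t, x) * a) / deriv T t)"
    by (simp add: elements_of_def \<Phi>_def Let_def indep_def parameter_derivatives)
  show "base_of (\<Phi> (((t, x, u), p, q), (a, b))) = (T t, X (t, x), U1 * u + U0)"
    by (simp add: base_of_def jet_of_def \<Phi>_def \<psi>_def \<phi>_def)
qed

text \<open>The global parameters restrict to every convex piece, so the characterization already
  proved yields membership without a separate check on equations.\<close>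

lemma in_equivalence_group_\<Phi>: "in_equivalence_group (over W) \<Phi>"
  unfolding equivalence_group_iff
proof (intro conjI allI impI point_transformation_\<Phi>)
  fix Q assume Q: "open Q \<and> Q \<subseteq> over W \<and> convex (base_of ` Q)"
  have s: "(indep \<circ> jet_of) ` Q \<subseteq> W" using Q by (auto simp: over_def jet_of_def)
  have "admissible_parameters ((indep \<circ> jet_of) ` Q) T X U1"
    using admissible s smooth_on_subset[OF _ image_mono[OF s]] smooth_on_subset[OF _ s]
    unfolding admissible_parameters_def by blast
  moreover have "has_form_on Q \<Phi> T X U1 U0"
    using has_form_\<Phi> Q unfolding has_form_on_def by blast
  ultimately show "\<exists>T X U1 U0. admissible_parameters ((indep \<circ> jet_of) ` Q) T X U1 \<and> has_form_on Q \<Phi> T X U1 U0"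
    by blast
qed

end

text \<open>The second conjunct shows that the parameters really are arbitrary: each admissible
  choice comes with components for derivatives and is realized over all of \<open>W\<close>, with no
  restriction on \<open>u\<close> and its derivatives.\<close>

theorem corollary24:
  shows "(\<forall>\<Omega> \<Phi>. in_equivalence_group \<Omega> \<Phi> \<longleftrightarrow>
            point_transformation \<Omega> \<Phi> \<and>
            (\<forall>Q. open Q \<and> Q \<subseteq> \<Omega> \<and> convex (base_of ` Q) \<longrightarrow>
              (\<exists>T X U1 U0. admissible_parameters ((indep \<circ> jet_of) ` Q) T X U1 \<and>
                 has_form_on Q \<Phi> T X U1 U0))) \<and>
         (\<forall>W T X U1 U0. open W \<and> admissible_parameters W T X U1 \<longrightarrow>
            (\<exists>\<Phi>. let \<Omega> = {z. indep (jet_of z) \<in> W \<and> fst (elements_of z) \<noteq> 0} in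
               in_equivalence_group \<Omega> \<Phi> \<and> has_form_on \<Omega> \<Phi> T X U1 U0))"
proof (intro conjI allI equivalence_group_iff impI)
  fix W T X U1 U0 assume "open W \<and> admissible_parameters W T X U1"
  then interpret point_parameters W T X U1 U0 by (simp add: point_parameters_def)
  have "{z. indep (jet_of z) \<in> W \<and> fst (elements_of z) \<noteq> 0} = over W"
    by (simp add: over_def jet_of_def elements_of_def)
  then show "\<exists>\<Phi>. let \<Omega> = {z. indep (jet_of z) \<in> W \<and> fst (elements_of z) \<noteq> 0} in
      in_equivalence_group \<Omega> \<Phi> \<and> has_form_on \<Omega> \<Phi> T X U1 U0"
    unfolding Let_def using in_equivalence_group_\<Phi> has_form_\<Phi> by metis
qed

end
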